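(* For every integer $d\ge3$ there is a positive real number $c(d)$, depending only on $d$, such that the following holds. Let $F(X_1,X_2)$ be a binary form with integer coefficients, degree $d$ and $\Delta_F\ne0$, and let $m$ be a positive integer. Then $$\left|N^*_F(m)-m^{2/d}V_F\right|\le c(d)\,m^{\frac1{d-1}}\mathcal H(F)^{d-2}.$$
   Context: Factor $F=L_1\cdots L_d$ with linear forms $L_i\in\mathbb C[X_1,X_2]$, and let $\mathbf L_i\in\mathbb C^2$ be the coefficient vector of $L_i$. For $\mathbf x\in\mathbb C^2$, $\|\mathbf x\|=(x_1\overline{x}_1+x_2\overline{x}_2)^{1/2}$. Then $\mathcal H(F)=\prod_{i=1}^d\|\mathbf L_i\|$ (independent of the factorization chosen). The discriminant is $\Delta_F=\prod_{(i_1,i_2)}\det(\mathbf L_{i_1}^{tr},\mathbf L_{i_2}^{tr})$, the product over all ordered pairs of distinct integers from $\{1,\dots,d\}$, where $tr$ denotes transpose. $N^*_F(m)$ is the number of $(a_1,a_2)\in\mathbb Z^2$ with $0<|F(a_1,a_2)|\le m$, and $V_F$ is the area of $\{(x_1,x_2)\in\mathbb R^2:|F(x_1,x_2)|\le1\}$. *)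

theory Defs
  imports "HOL-Analysis.Analysis" "HOL-Computational_Algebra.Fundamental_Theorem_Algebra"
begin

text \<open>
  The binary form of degree \<open>d\<close> with coefficients \<open>a\<close> is
  \<open>a 0 * X2^d + a 1 * X1 * X2^(d-1) + \<dots> + a d * X1^d\<close>;
  values of \<open>a\<close> beyond \<open>d\<close> are irrelevant.  It is evaluated in any commutative ring.
\<close>

definition form_eval :: "nat \<Rightarrow> (nat \<Rightarrow> int) \<Rightarrow> 'a::comm_ring_1 ^ 2 \<Rightarrow> 'a" where
  "form_eval d a x = (\<Sum>i\<le>d. of_int (a i) * (x $ 1) ^ i * (x $ 2) ^ (d - i))"

text \<open>
  Since the complex numbers are an infinite field, a factorization of the form into linear
  forms is the same as an identity of functions on pairs of complex numbers.
\<close>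

definition linear_factorization :: "nat \<Rightarrow> (nat \<Rightarrow> int) \<Rightarrow> (nat \<Rightarrow> complex ^ 2) \<Rightarrow> bool" where
  "linear_factorization d a L \<longleftrightarrow>
     (\<forall>x :: complex ^ 2. form_eval d a x = (\<Prod>i<d. L i $ 1 * x $ 1 + L i $ 2 * x $ 2))"

text \<open>
  A choice of linear factors; one exists for every \<open>d > 0\<close>, see \<open>linear_factorization_exists\<close>.
  The two quantities defined from it below do not depend on the choice: two factorizations
  of a nonzero form differ by a permutation and by scalars whose product is 1.
\<close>

definition linear_factors :: "nat \<Rightarrow> (nat \<Rightarrow> int) \<Rightarrow> nat \<Rightarrow> complex ^ 2" where
  "linear_factors d a = (SOME L. linear_factorization d a L)"

definition form_height :: "nat \<Rightarrow> (nat \<Rightarrow> int) \<Rightarrow> real" where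
  "form_height d a = (\<Prod>i<d. norm (linear_factors d a i))"

definition form_discriminant :: "nat \<Rightarrow> (nat \<Rightarrow> int) \<Rightarrow> complex" where
  "form_discriminant d a =
     (\<Prod>(i, j) \<in> {(i, j). i < d \<and> j < d \<and> i \<noteq> j}.
        det (transpose (vector [linear_factors d a i, linear_factors d a j]) :: complex ^ 2 ^ 2))"

definition form_solutions :: "nat \<Rightarrow> (nat \<Rightarrow> int) \<Rightarrow> nat \<Rightarrow> (int ^ 2) set" where
  "form_solutions d a m = {x. 0 < \<bar>form_eval d a x\<bar> \<and> \<bar>form_eval d a x\<bar> \<le> int m}"

definition form_region :: "nat \<Rightarrow> (nat \<Rightarrow> int) \<Rightarrow> (real ^ 2) set" where
  "form_region d a = {x. \<bar>form_eval d a x\<bar> \<le> 1}"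

definition form_area :: "nat \<Rightarrow> (nat \<Rightarrow> int) \<Rightarrow> real" where
  "form_area d a = measure lebesgue (form_region d a)"

lemma complex_binary_form_factors:
  fixes p :: "complex poly"
  assumes "degree p \<le> d"
  shows "\<exists>c L. \<forall>x :: complex ^ 2. (\<Sum>i\<le>d. coeff p i * (x $ 1) ^ i * (x $ 2) ^ (d - i)) =
           c * (\<Prod>i<d. L i $ 1 * x $ 1 + (L i :: complex ^ 2) $ 2 * x $ 2)"
  using assms
proof (induction d arbitrary: p)
  case 0
  then show ?case by (intro exI[of _ "coeff p 0"]) simp
next
  case (Suc d)
  define h where "h n q x = (\<Sum>i\<le>n. coeff q i * (x $ 1) ^ i * (x $ 2) ^ (n - i))"
    for n and q :: "complex poly" and x :: "complex ^ 2"
  have h_Suc: "h (Suc d) q x = x $ 2 * h d q x" if "degree q \<le> d" for q x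
    using that unfolding h_def
    by (auto simp: sum_distrib_left coeff_eq_0 Suc_diff_le algebra_simps intro!: sum.cong)
  have h_pCons: "h (Suc d) (pCons 0 q) x = x $ 1 * h d q x" for q x
    unfolding h_def
    by (subst sum.atMost_Suc_shift) (simp add: sum_distrib_left algebra_simps)
  have "\<exists>q u. degree q \<le> d \<and>
          (\<forall>x. h (Suc d) p x = (u $ 1 * x $ 1 + (u :: complex ^ 2) $ 2 * x $ 2) * h d q x)"
  proof (cases "degree p \<le> d")
    case True
    then show ?thesis
      by (intro exI[of _ p] exI[of _ "vector [0, 1]"]) (simp add: h_Suc)
  next
    case False
    then have "degree p = Suc d" using Suc.prems by simp
    then have "\<not> constant (poly p)" by (simp add: constant_degree)
    then obtain r where "poly p r = 0" using fundamental_theorem_of_algebra by blast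
    then obtain q where q: "p = [:- r, 1:] * q" by (auto simp: poly_eq_0_iff_dvd)
    have "q \<noteq> 0" using q \<open>degree p = Suc d\<close> by auto
    then have dq: "degree q = d"
      using \<open>degree p = Suc d\<close> unfolding q by (subst (asm) degree_mult_eq) auto
    have "h (Suc d) p x = (x $ 1 + (- r) * x $ 2) * h d q x" for x
    proof -
      have "h (Suc d) p x = - r * h (Suc d) q x + h (Suc d) (pCons 0 q) x"
        unfolding h_def q
        by (simp add: sum.distrib sum_subtractf sum_negf sum_distrib_left ring_distribs mult.assoc del: sum.atMost_Suc)
      then show ?thesis using h_Suc[of q x] h_pCons[of q x] dq by (simp add: algebra_simps)
    qed
    then show ?thesis using dq
      by (intro exI[of _ q] exI[of _ "vector [1, - r]"]) simp
  qed
  then obtain q u where q: "degree q \<le> d"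
    and hq: "\<And>x. h (Suc d) p x = (u $ 1 * x $ 1 + (u :: complex ^ 2) $ 2 * x $ 2) * h d q x"
    by blast
  obtain c L where cL: "\<And>x :: complex ^ 2. h d q x =
      c * (\<Prod>i<d. L i $ 1 * x $ 1 + (L i :: complex ^ 2) $ 2 * x $ 2)"
    using Suc.IH[OF q] unfolding h_def by blast
  show ?case
    using hq cL unfolding h_def[of "Suc d"]
    by (intro exI[of _ c] exI[of _ "L(d := u)"]) (simp add: mult_ac del: sum.atMost_Suc)
qed

lemma linear_factorization_exists:
  assumes "d > 0"
  shows "\<exists>L. linear_factorization d a L"
proof -
  define p :: "complex poly" where "p = (\<Sum>i\<le>d. monom (of_int (a i)) i)"
  have cp: "coeff p i = of_int (a i)" if "i \<le> d" for i
    using that by (simp add: p_def coeff_sum)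
  have "degree p \<le> d"
    unfolding p_def by (intro degree_sum_le) (auto intro: order_trans[OF degree_monom_le])
  then obtain c L where cL: "\<And>x :: complex ^ 2.
      (\<Sum>i\<le>d. coeff p i * (x $ 1) ^ i * (x $ 2) ^ (d - i)) =
        c * (\<Prod>i<d. L i $ 1 * x $ 1 + (L i :: complex ^ 2) $ 2 * x $ 2)"
    using complex_binary_form_factors by blast
  obtain e where e: "d = Suc e" using assms by (cases d) auto
  have "linear_factorization d a (L(e := c *s L e))"
    unfolding linear_factorization_def
  proof
    fix x :: "complex ^ 2"
    have "form_eval d a x = c * (\<Prod>i<d. L i $ 1 * x $ 1 + L i $ 2 * x $ 2)"
      unfolding form_eval_def cL[symmetric] by (simp add: cp)
    then show "form_eval d a x = (\<Prod>i<d. (L(e := c *s L e)) i $ 1 * x $ 1 +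
                 (L(e := c *s L e)) i $ 2 * x $ 2)"
      by (simp add: e algebra_simps)
  qed
  then show ?thesis by blast
qed

end

theory Submission
  imports Defs "Jordan_Normal_Form.Char_Poly"
begin

text \<open>
  Write \<open>H\<close> for the height and normalise the linear factors to have length 1.  If the \<open>i\<close>-th factor is
  the smallest one at \<open>x\<close>, the others are bounded below by the sines of their angles to it, and since
  the discriminant is a nonzero integer the product of these sines is at least \<open>H\<^bsup>-(d-1)\<^esup>\<close>.  Hence
  \<open>\<bar>F(x)\<bar> \<le> m\<close> forces \<open>x\<close> into one of \<open>d\<close> cusps in which the \<open>i\<close>-th factor is at most
  \<open>K / \<bar>x\<bar>\<^bsup>d-1\<^esup>\<close> with \<open>K \<lless> m H\<^bsup>d-2\<^esup>\<close>.

  Put \<open>E = m\<^bsup>1/(d-1)\<^esup> H\<^bsup>d-2\<^esup>\<close>.  In a square of side about \<open>E\<close> the lattice points are compared with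
  the area by slicing in both directions: each slice is a union of boundedly many intervals, so the
  error is \<open>O(E)\<close>.  Outside the square the cusps have area \<open>O(E)\<close>.  A lattice point there is \<open>t\<close> times a
  primitive one with \<open>t\<^sup>d \<le> m\<close>.  In a dyadic shell the primitive points of a cusp give well separated
  rational numbers in a short interval, so there are at most \<open>1 + O(area)\<close> of them.  Beyond a
  polynomial bound in \<open>m H\<close>, consecutive primitive points satisfy a gap principle, and Thue's theorem on
  two good approximations leaves only boundedly many.  The \<open>O(log(m H))\<close> shells contribute
  \<open>O(m\<^bsup>1/d\<^esup> log(m H)) = O(E)\<close>.
\<close>

hide_const (open) Module.smult
no_notation vec_index (infixl "$" 100)

section \<open>Integrality of the discriminant\<close>

text \<open>The constant depends on \<open>d\<close> alone, so every estimate must be uniform in the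
  form. Thue's theorem is therefore used to bound a number of solutions in terms of
  \<open>d\<close>, beyond a threshold polynomial in the height. The cut-off balances two errors: a
  square of side \<open>R\<close> costs about \<open>R\<close>, and the cusps outside it have area
  about K / R^(d-2). As K is at most a constant times E^(d-1), both are O(E) for R about E. A cusp
  bound says that p/q approximates a root to within K / q^d, and d exceeds Thue's exponent d/2 + 1
  exactly when d \<ge> 3. The number of shells brings in two logarithms. That of m is absorbed
  because only m^(1/d) multipliers t occur and 1/d < 1/(d-1); that of H because ln H \<le> H^(d-2).
  The form may be reducible over the rationals: it can vanish at infinitely many lattice points, and
  no root may be assumed to have degree d. Each linear factor is treated in the chart where its root
  has modulus at most 1, if need be after exchanging the variables.\<close>

lemma det_vandermonde:
  fixes \<alpha> :: "nat \<Rightarrow> 'a :: idom"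
  shows "Determinant.det (Matrix.mat n n (\<lambda>(i, j). \<alpha> i ^ j)) = (\<Prod>k<n. \<Prod>j<k. \<alpha> k - \<alpha> j)"
proof -
  \<comment> \<open>\<open>N k\<close> runs through the Newton basis at the nodes. \<open>T\<close>
    lists its coefficients and is unitriangular, while \<open>V * T\<close> evaluates it at the
    nodes and is lower triangular.\<close>
  define N where "N k = (\<Prod>j<k. [:- \<alpha> j, 1:])" for k
  define V T where "V = Matrix.mat n n (\<lambda>(i, j). \<alpha> i ^ j)"
    and "T = Matrix.mat n n (\<lambda>(j, k). coeff (N k) j)"
  have car: "V \<in> carrier_mat n n" "T \<in> carrier_mat n n" by (auto simp: V_def T_def)
  have deg: "degree (N k) = k" for k
    unfolding N_def by (subst degree_prod_eq_sum_degree) auto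
  have monic: "coeff (N k) k = 1" for k
    using lead_coeff_prod[of "\<lambda>j. [:- \<alpha> j, 1:]" "{..<k}"] deg[of k] by (simp add: N_def)
  have VT: "(V * T) $$ (i, k) = poly (N k) (\<alpha> i)" if "i < n" "k < n" for i k
  proof -
    have "(V * T) $$ (i, k) = (\<Sum>j<n. \<alpha> i ^ j * coeff (N k) j)"
      using that by (simp add: V_def T_def scalar_prod_def atLeast0LessThan)
    also have "\<dots> = (\<Sum>j\<le>k. \<alpha> i ^ j * coeff (N k) j)"
      using that deg by (intro sum.mono_neutral_right) (auto intro: coeff_eq_0)
    finally show ?thesis by (simp add: poly_altdef deg mult.commute)
  qed
  have "Determinant.det T = 1"
    using car by (subst det_upper_triangular[of _ n])
      (auto simp: prod_list_diag_prod T_def monic deg intro!: upper_triangularI coeff_eq_0)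
  moreover have "Determinant.det (V * T) = (\<Prod>k<n. \<Prod>j<k. \<alpha> k - \<alpha> j)"
  proof (subst det_lower_triangular[of n])
    show "(V * T) $$ (i, j) = 0" if "i < j" "j < n" for i j
      using that VT[of i j] by (auto simp: N_def poly_prod)
    show "V * T \<in> carrier_mat n n" using car by simp
    show "prod_list (diag_mat (V * T)) = (\<Prod>k<n. \<Prod>j<k. \<alpha> k - \<alpha> j)"
      using car VT by (simp add: prod_list_diag_prod atLeast0LessThan N_def poly_prod)
  qed
  ultimately show ?thesis using det_mult[OF car] by (simp add: V_def)
qed

lemma coeff_synthetic_division:
  fixes g :: "'a :: comm_ring_1 poly"
  assumes "f = [:- x, 1:] * g"
  shows "coeff f 0 = - x * coeff g 0" "coeff f (Suc k) = coeff g k - x * coeff g (Suc k)"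
  using assms by (simp_all add: coeff_pCons)

text \<open>
  With \<open>f\<^sub>i = f / (X - \<alpha>\<^sub>i)\<close>, this is the Bezoutian \<open>\<Sum>\<^sub>i f\<^sub>i(X) f\<^sub>i(Y)\<close> of \<open>f\<close> and \<open>f'\<close>.
\<close>

lemma bezoutian_coeff_Ints:
  fixes f :: "int poly" and g :: "nat \<Rightarrow> complex poly"
  assumes fg: "\<And>i. i < n \<Longrightarrow> map_poly of_int f = [:- \<alpha> i, 1:] * g i"
    and df: "pderiv (map_poly of_int f) = (\<Sum>i<n. g i)"
  shows "(\<Sum>i<n. coeff (g i) k * coeff (g i) l) \<in> \<int>"
proof -
  let ?f = "map_poly of_int f :: complex poly"
  have fZ: "coeff ?f k \<in> \<int>" for k by (simp add: coeff_map_poly)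
  have dZ: "coeff (pderiv ?f) k \<in> \<int>" for k by (simp add: coeff_pderiv coeff_map_poly)
  have dcoeff: "coeff (pderiv ?f) k = (\<Sum>i<n. coeff (g i) k)" for k
    by (simp add: df coeff_sum)
  show ?thesis
  proof (induction k arbitrary: l)
  case 0
  have "(\<Sum>i<n. coeff (g i) 0 * coeff (g i) l) =
      (\<Sum>i<n. coeff (g i) 0 * (coeff ?f (Suc l) + \<alpha> i * coeff (g i) (Suc l)))"
    using fg[THEN coeff_synthetic_division(2)] by (intro sum.cong) simp_all
  also have "\<dots> = (\<Sum>i<n. coeff (g i) 0 * coeff ?f (Suc l) - coeff ?f 0 * coeff (g i) (Suc l))"
    using fg[THEN coeff_synthetic_division(1)] by (intro sum.cong) (simp_all add: algebra_simps)
  also have "\<dots> = coeff (pderiv ?f) 0 * coeff ?f (Suc l) - coeff ?f 0 * coeff (pderiv ?f) (Suc l)"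
    by (simp add: dcoeff sum_subtractf sum_distrib_left sum_distrib_right)
  finally show ?case using fZ dZ by simp
next
  case (Suc k)
  \<comment> \<open>Synthetic division moves one degree from the first factor to the second, at the
    cost of products of coefficients of f and f'. The induction thus descends along an antidiagonal,
    which is why \<open>l\<close> is arbitrary.\<close>
  have "(\<Sum>i<n. coeff (g i) (Suc k) * coeff (g i) l) =
      (\<Sum>i<n. coeff (g i) (Suc k) * (coeff ?f (Suc l) + \<alpha> i * coeff (g i) (Suc l)))"
    using fg[THEN coeff_synthetic_division(2)] by (intro sum.cong) simp_all
  also have "\<dots> = (\<Sum>i<n. coeff (g i) (Suc k) * coeff ?f (Suc l) - coeff ?f (Suc k) * coeff (g i) (Suc l)
                 + coeff (g i) k * coeff (g i) (Suc l))"
  proof (intro sum.cong refl)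
    fix i assume "i \<in> {..<n}"
    then have "coeff (g i) k = coeff ?f (Suc k) + \<alpha> i * coeff (g i) (Suc k)"
      using fg[THEN coeff_synthetic_division(2), of i k] by simp
    then show "coeff (g i) (Suc k) * (coeff ?f (Suc l) + \<alpha> i * coeff (g i) (Suc l)) =
        coeff (g i) (Suc k) * coeff ?f (Suc l) - coeff ?f (Suc k) * coeff (g i) (Suc l)
        + coeff (g i) k * coeff (g i) (Suc l)"
      by (simp add: algebra_simps)
  qed
  also have "\<dots> = coeff (pderiv ?f) (Suc k) * coeff ?f (Suc l) - coeff ?f (Suc k) * coeff (pderiv ?f) (Suc l)
                 + (\<Sum>i<n. coeff (g i) k * coeff (g i) (Suc l))"
    by (simp add: dcoeff sum_subtractf sum.distrib sum_distrib_left sum_distrib_right)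
  finally show ?case using fZ dZ Suc.IH[of "Suc l"] by simp
  qed
qed

text \<open>Up to a triangular factor, the Vandermonde matrix is the matrix \<open>G\<close> of
  coefficients of the cofactors f / (X - \<alpha>). The Gram matrix of \<open>G\<close> is integral
  by the Bezoutian identity, so the square of det \<open>G\<close> is an integer. Neither resultants
  nor symmetric functions are required.\<close>

lemma poly_discriminant_Ints:
  fixes f :: "int poly" and \<alpha> :: "nat \<Rightarrow> complex"
  assumes "n > 0" and f: "map_poly of_int f = smult a (\<Prod>i<n. [:- \<alpha> i, 1:])"
  shows "(a ^ (n - 1) * (\<Prod>k<n. \<Prod>j<k. \<alpha> k - \<alpha> j))\<^sup>2 \<in> \<int>"
proof -
  define g where "g i = smult a (\<Prod>j\<in>{..<n} - {i}. [:- \<alpha> j, 1:])" for i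
  let ?f = "map_poly of_int f :: complex poly"
  have fg: "?f = [:- \<alpha> i, 1:] * g i" if "i < n" for i
    using that prod.remove[of "{..<n}" i "\<lambda>i. [:- \<alpha> i, 1:]"] unfolding f g_def by simp
  have df: "pderiv ?f = (\<Sum>i<n. g i)"
  proof -
    have "smult a (\<Sum>i<n. p i) = (\<Sum>i<n. smult a (p i))" for p :: "nat \<Rightarrow> complex poly"
      by (induction n) (simp_all add: smult_add_right)
    then show ?thesis by (simp add: f pderiv_smult pderiv_prod g_def pderiv_pCons)
  qed
  have coeff_f: "coeff ?f k = of_int (coeff f k)" for k by (simp add: coeff_map_poly)
  have degg: "degree (g i) \<le> n - 1" if "i < n" for i
    using that unfolding g_def
    by (intro order_trans[OF degree_smult_le]) (subst degree_prod_eq_sum_degree, auto)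
  have lead: "coeff ?f n = a"
    using lead_coeff_prod[of "\<lambda>j. [:- \<alpha> j, 1:]" "{..<n}"]
      degree_prod_eq_sum_degree[of "{..<n}" "\<lambda>j. [:- \<alpha> j, 1:]"] by (simp add: f)
  have syn: "coeff (g i) (n - 1 - k) = (\<Sum>j\<le>k. coeff ?f (n - k + j) * \<alpha> i ^ j)" if "i < n" "k < n" for i k
    using \<open>k < n\<close>
  proof (induction k)
    case 0
    then show ?case
      using coeff_synthetic_division(2)[OF fg[OF \<open>i < n\<close>], of "n - 1"] degg[OF \<open>i < n\<close>]
      by (simp add: coeff_eq_0)
  next
    case (Suc k)
    have "coeff (g i) (n - 1 - Suc k) = coeff ?f (n - Suc k) + \<alpha> i * coeff (g i) (n - 1 - k)"
      using Suc.prems coeff_synthetic_division(2)[OF fg[OF \<open>i < n\<close>], of "n - 1 - Suc k"]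
      by (simp add: Suc_diff_Suc)
    also have "\<dots> = coeff ?f (n - Suc k) + (\<Sum>j\<le>k. coeff ?f (n - Suc k + Suc j) * \<alpha> i ^ Suc j)"
      using Suc by (simp add: sum_distrib_left mult_ac Suc_diff_Suc)
    finally show ?case by (subst sum.atMost_Suc_shift) simp
  qed
  \<comment> \<open>Column 0 would consist of the common leading coefficient \<open>a\<close> of the
    cofactors. It is replaced by 1, so that the determinant carries \<open>a ^ (n - 1)\<close> and
    not \<open>a ^ n\<close>; the Gram entries against it become coefficients of f', and n in the
    corner.\<close>
  define G V U where "G = Matrix.mat n n (\<lambda>(i, k). if k = 0 then 1 else coeff (g i) (n - 1 - k))"
    and "V = Matrix.mat n n (\<lambda>(i, j). \<alpha> i ^ j)"
    and "U = Matrix.mat n n (\<lambda>(j, k). if k = 0 then if j = 0 then 1 else 0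
               else if j \<le> k then coeff ?f (n - k + j) else 0)"
  have car: "G \<in> carrier_mat n n" "U \<in> carrier_mat n n" "V \<in> carrier_mat n n"
    by (auto simp: G_def U_def V_def)
  have "G = V * U"
  proof (rule eq_matI)
    fix i k assume ik: "i < dim_row (V * U)" "k < dim_col (V * U)"
    then have *: "i < n" "k < n" using car by auto
    have "(V * U) $$ (i, k) = (\<Sum>j<n. \<alpha> i ^ j * U $$ (j, k))"
      using * by (simp add: V_def U_def scalar_prod_def atLeast0LessThan)
    also have "\<dots> = (\<Sum>j\<le>k. \<alpha> i ^ j * U $$ (j, k))"
      using * by (intro sum.mono_neutral_right) (auto simp: U_def)
    also have "\<dots> = G $$ (i, k)"
      using * syn[of i k] by (simp add: U_def G_def mult.commute cong: if_cong)
    finally show "G $$ (i, k) = (V * U) $$ (i, k)" by simp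
  qed (use car in auto)
  moreover have "Determinant.det U = a ^ (n - 1)"
  proof (subst det_upper_triangular[of _ n])
    show "upper_triangular U" by (auto simp: U_def)
    show "prod_list (diag_mat U) = a ^ (n - 1)"
      using \<open>n > 0\<close> lead prod.remove[of "{0..<n}" 0 "\<lambda>i. if i = 0 then 1 else a"]
      by (simp add: prod_list_diag_prod U_def cong: if_cong)
  qed (use car in auto)
  ultimately have detG: "Determinant.det G = a ^ (n - 1) * (\<Prod>k<n. \<Prod>j<k. \<alpha> k - \<alpha> j)"
    using det_mult[OF car(3,2)] det_vandermonde[of n \<alpha>] by (simp add: V_def)
  define S where "S = transpose_mat G * G"
  have carS: "S \<in> carrier_mat n n" using car by (simp add: S_def)
  have SZ: "S $$ (k, l) \<in> \<int>" if "k < n" "l < n" for k l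
  proof -
    have S: "S $$ (k, l) = (\<Sum>i<n. G $$ (i, k) * G $$ (i, l))"
      using that car by (simp add: S_def scalar_prod_def atLeast0LessThan)
    have "(\<Sum>i<n. coeff (g i) k) \<in> \<int>" for k
    proof -
      have "(\<Sum>i<n. coeff (g i) k) = coeff (pderiv ?f) k" by (simp add: df coeff_sum)
      then show ?thesis by (simp add: coeff_pderiv coeff_f)
    qed
    then show ?thesis
      using that bezoutian_coeff_Ints[OF fg df] unfolding S
      by (cases "k = 0"; cases "l = 0") (simp_all add: G_def)
  qed
  have "Determinant.det S \<in> \<int>"
    unfolding det_def'[OF carS]
    by (auto intro!: Ints_sum Ints_mult Ints_prod SZ simp: sign_def dest: permutes_in_image)
  then show ?thesis
    using detG det_mult[of "transpose_mat G" n G] det_transpose[OF car(1)] car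
    by (simp add: S_def power2_eq_square)
qed


lemma prod_offdiag_eq_square:
  fixes f :: "nat \<Rightarrow> nat \<Rightarrow> real"
  assumes "\<And>i j. f i j = f j i"
  shows "(\<Prod>i<n. \<Prod>j\<in>{..<n} - {i}. f i j) = (\<Prod>k<n. \<Prod>j<k. f k j)\<^sup>2"
proof (induction n)
  case (Suc n)
  have "(\<Prod>i<n. \<Prod>j\<in>{..<Suc n} - {i}. f i j) = (\<Prod>i<n. f i n * (\<Prod>j\<in>{..<n} - {i}. f i j))"
  proof (intro prod.cong refl)
    fix i assume "i \<in> {..<n}"
    then have "{..<Suc n} - {i} = insert n ({..<n} - {i})" by auto
    then show "(\<Prod>j\<in>{..<Suc n} - {i}. f i j) = f i n * (\<Prod>j\<in>{..<n} - {i}. f i j)" by simp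
  qed
  moreover have "{..<Suc n} - {n} = {..<n}" by auto
  ultimately show ?case
    using Suc.IH assms by (simp add: prod.distrib power2_eq_square mult_ac)
qed simp

lemma prod_offdiag_mult:
  fixes w :: "'a \<Rightarrow> real"
  assumes "finite I" "\<And>i. i \<in> I \<Longrightarrow> w i \<noteq> 0"
  shows "(\<Prod>i\<in>I. \<Prod>j\<in>I - {i}. w i * w j) = (\<Prod>i\<in>I. w i) ^ (2 * (card I - 1))"
proof (cases "I = {}")
  case False
  define P where "P = (\<Prod>i\<in>I. w i)"
  have P: "P \<noteq> 0" using assms by (simp add: P_def)
  have "(\<Prod>i\<in>I. \<Prod>j\<in>I - {i}. w i * w j) = (\<Prod>i\<in>I. w i ^ (card I - 1) * (P / w i))"
  proof (intro prod.cong refl)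
    fix i assume "i \<in> I"
    then show "(\<Prod>j\<in>I - {i}. w i * w j) = w i ^ (card I - 1) * (P / w i)"
      using assms prod.remove[of I i w] by (simp add: prod.distrib P_def card_Diff_singleton)
  qed
  also have "\<dots> = P ^ (card I - 1) * (P ^ card I / P)"
    by (simp add: prod.distrib prod_dividef P_def prod_power_distrib)
  also have "P ^ card I / P = P ^ (card I - 1)"
    using P False assms by (simp add: power_diff card_gt_0_iff Suc_leI)
  finally show ?thesis by (simp add: P_def power_mult power2_eq_square power_mult_distrib mult_2 power_add)
qed simp

lemma norm_of_int_ge_1: "k \<noteq> 0 \<Longrightarrow> 1 \<le> norm (of_int k :: complex)"
proof -
  assume "k \<noteq> 0"
  then have "1 \<le> \<bar>k\<bar>" by simp
  then have "1 \<le> real_of_int \<bar>k\<bar>" by linarith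
  then show ?thesis by simp
qed

lemma poly_discriminant_ge_1:
  fixes f :: "int poly" and \<alpha> :: "'a \<Rightarrow> complex"
  assumes I: "finite I" "I \<noteq> {}" and a: "a \<noteq> 0" and inj: "inj_on \<alpha> I"
    and f: "map_poly of_int f = smult a (\<Prod>i\<in>I. [:- \<alpha> i, 1:])"
  shows "1 \<le> norm a ^ (2 * (card I - 1)) * (\<Prod>i\<in>I. \<Prod>j\<in>I - {i}. norm (\<alpha> i - \<alpha> j))"
proof -
  define n where "n = card I"
  obtain h where h: "bij_betw h {..<n} I"
    using ex_bij_betw_nat_finite[OF I(1)] by (auto simp: n_def atLeast0LessThan)
  define z where "z = a ^ (n - 1) * (\<Prod>k<n. \<Prod>j<k. \<alpha> (h k) - \<alpha> (h j))"
  have "map_poly of_int f = smult a (\<Prod>i<n. [:- \<alpha> (h i), 1:])"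
    unfolding f using prod.reindex_bij_betw[OF h, of "\<lambda>i. [:- \<alpha> i, 1:]"] by simp
  then have "z\<^sup>2 \<in> \<int>"
    using poly_discriminant_Ints[of n f a "\<alpha> \<circ> h"] I by (simp add: z_def n_def card_gt_0_iff)
  moreover have "z \<noteq> 0"
  proof -
    have "\<alpha> (h k) \<noteq> \<alpha> (h j)" if "j < k" "k < n" for j k
    proof
      assume "\<alpha> (h k) = \<alpha> (h j)"
      moreover have "h k \<in> I" "h j \<in> I" using that h by (auto simp: bij_betw_def)
      ultimately have "h k = h j" using inj by (auto dest: inj_onD)
      then have "k = j"
        using that inj_onD[OF bij_betw_imp_inj_on[OF h], of k j] by simp
      then show False using that by simp
    qed
    then show ?thesis using a by (auto simp: z_def)
  qed
  ultimately have "1 \<le> norm (z\<^sup>2)"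
    by (metis Ints_cases of_int_0 power_eq_0_iff norm_of_int_ge_1)
  also have "norm (z\<^sup>2) = (norm z)\<^sup>2" by (rule norm_power)
  also have "norm z = norm a ^ (n - 1) * (\<Prod>k<n. \<Prod>j<k. norm (\<alpha> (h k) - \<alpha> (h j)))"
    by (simp add: z_def norm_mult norm_power prod_norm)
  also have "\<dots>\<^sup>2 = norm a ^ (2 * (n - 1)) * (\<Prod>k<n. \<Prod>j<k. norm (\<alpha> (h k) - \<alpha> (h j)))\<^sup>2"
    by (simp only: power_mult_distrib mult.commute[of 2 "n - 1"] power_mult)
  also have "\<dots> = norm a ^ (2 * (n - 1)) * (\<Prod>i<n. \<Prod>j\<in>{..<n} - {i}. norm (\<alpha> (h i) - \<alpha> (h j)))"
    by (subst prod_offdiag_eq_square[symmetric]) (auto simp: norm_minus_commute)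
  also have "(\<Prod>i<n. \<Prod>j\<in>{..<n} - {i}. norm (\<alpha> (h i) - \<alpha> (h j))) =
      (\<Prod>i<n. \<Prod>j\<in>I - {h i}. norm (\<alpha> (h i) - \<alpha> j))"
  proof (intro prod.cong refl)
    fix i assume i: "i \<in> {..<n}"
    have "bij_betw h ({..<n} - {i}) (I - {h i})"
      using h i by (intro bij_betw_DiffI) (auto simp: bij_betw_def)
    then show "(\<Prod>j\<in>{..<n} - {i}. norm (\<alpha> (h i) - \<alpha> (h j))) = (\<Prod>j\<in>I - {h i}. norm (\<alpha> (h i) - \<alpha> j))"
      by (rule prod.reindex_bij_betw)
  qed
  also have "\<dots> = (\<Prod>i\<in>I. \<Prod>j\<in>I - {i}. norm (\<alpha> i - \<alpha> j))"
    using prod.reindex_bij_betw[OF h, of "\<lambda>i. \<Prod>j\<in>I - {i}. norm (\<alpha> i - \<alpha> j)"] by simp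
  finally show ?thesis by (simp add: n_def)
qed

text \<open>If some \<open>u k\<close> vanishes, the form has a root at infinity and
  \<open>f\<close> drops to degree d - 1. Separability allows only one such factor. The discriminant
  of the form is then, in absolute value, that of \<open>f\<close> times the square of the leading
  coefficient \<open>a\<close> of \<open>f\<close>, which is a nonzero integer.\<close>

lemma form_discriminant_ge_1:
  fixes f :: "int poly" and u v :: "nat \<Rightarrow> complex"
  assumes d: "d \<ge> 2" and f: "map_poly of_int f = (\<Prod>i<d. [:v i, u i:])"
    and D: "\<And>i j. i < d \<Longrightarrow> j < d \<Longrightarrow> i \<noteq> j \<Longrightarrow> u i * v j - u j * v i \<noteq> 0"
  shows "1 \<le> (\<Prod>i<d. \<Prod>j\<in>{..<d} - {i}. norm (u i * v j - u j * v i))"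
proof -
  define I where "I = {i. i < d \<and> u i \<noteq> 0}"
  define \<alpha> where "\<alpha> i = - v i / u i" for i
  define D where "D i j = norm (u i * v j - u j * v i)" for i j
  have D_commute: "D i j = D j i" for i j by (simp add: D_def norm_minus_commute mult.commute)
  have DI: "D i j = norm (u i) * norm (u j) * norm (\<alpha> i - \<alpha> j)" if "i \<in> I" "j \<in> I" for i j
  proof -
    have "u i * v j - u j * v i = u i * u j * (\<alpha> i - \<alpha> j)"
      using that by (simp add: I_def \<alpha>_def field_simps)
    then show ?thesis by (simp add: D_def norm_mult)
  qed
  have inj: "inj_on \<alpha> I"
  proof (rule inj_onI, rule ccontr)
    fix i j assume ij: "i \<in> I" "j \<in> I" "\<alpha> i = \<alpha> j" "i \<noteq> j"
    then have "D i j = 0" using DI by simp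
    then show False using ij assms(3)[of i j] by (simp add: D_def I_def)
  qed
  have lin: "[:v i, u i:] = smult (u i) [:- \<alpha> i, 1:]" if "i \<in> I" for i
    using that by (simp add: I_def \<alpha>_def)
  have finI: "finite I" by (simp add: I_def)
  have main: "1 \<le> norm a ^ (2 * (card I - 1)) * (\<Prod>i\<in>I. \<Prod>j\<in>I - {i}. norm (\<alpha> i - \<alpha> j))"
    if "a \<noteq> 0" "I \<noteq> {}" "map_poly of_int f = smult a (\<Prod>i\<in>I. [:- \<alpha> i, 1:])" for a
    using poly_discriminant_ge_1[OF finI that(2,1) inj that(3)] .
  have prodI: "(\<Prod>i\<in>I. \<Prod>j\<in>I - {i}. D i j) =
      (\<Prod>i\<in>I. norm (u i)) ^ (2 * (card I - 1)) * (\<Prod>i\<in>I. \<Prod>j\<in>I - {i}. norm (\<alpha> i - \<alpha> j))"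
    using prod_offdiag_mult[OF finI, of "\<lambda>i. norm (u i)"]
    by (simp add: DI prod.distrib I_def)
  have lins: "(\<Prod>i\<in>I. [:v i, u i:]) = smult (\<Prod>i\<in>I. u i) (\<Prod>i\<in>I. [:- \<alpha> i, 1:])"
  proof -
    have "(\<Prod>i\<in>I. [:v i, u i:]) = (\<Prod>i\<in>I. smult (u i) [:- \<alpha> i, 1:])"
      by (intro prod.cong refl lin)
    then show ?thesis by (simp only: prod_smult)
  qed
  show ?thesis
  proof (cases "\<exists>k<d. u k = 0")
    case False
    then have I: "I = {..<d}" by (auto simp: I_def)
    have "1 \<le> norm (\<Prod>i\<in>I. u i) ^ (2 * (card I - 1)) * (\<Prod>i\<in>I. \<Prod>j\<in>I - {i}. norm (\<alpha> i - \<alpha> j))"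
    proof (rule main)
      show "(\<Prod>i\<in>I. u i) \<noteq> 0" by (simp add: I_def)
      show "I \<noteq> {}" using d I by (metis lessThan_empty_iff not_numeral_le_zero bot_nat_def)
      show "map_poly of_int f = smult (\<Prod>i\<in>I. u i) (\<Prod>i\<in>I. [:- \<alpha> i, 1:])"
        using lins f by (simp only: I)
    qed
    then show ?thesis using prodI by (simp add: I D_def prod_norm)
  next
    case True
    then obtain k where k: "k < d" "u k = 0" by blast
    have I: "I = {..<d} - {k}"
      using k assms(3)[of k] by (auto simp: I_def)
    then have cI: "card I = d - 1" using k by simp
    have vk: "v k \<noteq> 0"
    proof -
      define j where "j = (if k = 0 then 1 else 0 :: nat)"
      have "j < d" "j \<noteq> k" using d by (auto simp: j_def)
      then have "u j * v k \<noteq> 0" using assms(3)[of k j] k by simp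
      then show ?thesis by simp
    qed
    define a where "a = v k * (\<Prod>i\<in>I. u i)"
    have "a \<noteq> 0" using vk by (simp add: a_def I_def)
    have fa: "map_poly of_int f = smult a (\<Prod>i\<in>I. [:- \<alpha> i, 1:])"
      unfolding f using prod.remove[of "{..<d}" k "\<lambda>i. [:v i, u i:]"] k lins
      by (simp add: a_def I)
    then have "1 \<le> norm a ^ (2 * (card I - 1)) * (\<Prod>i\<in>I. \<Prod>j\<in>I - {i}. norm (\<alpha> i - \<alpha> j))"
      using \<open>a \<noteq> 0\<close> d cI by (intro main) auto
    also have "\<dots> = norm (v k) ^ (2 * (card I - 1)) * (\<Prod>i\<in>I. \<Prod>j\<in>I - {i}. D i j)"
      unfolding prodI by (simp add: a_def norm_mult power_mult_distrib prod_norm)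
    finally have 1: "1 \<le> norm (v k) ^ (2 * (card I - 1)) * (\<Prod>i\<in>I. \<Prod>j\<in>I - {i}. D i j)" .
    have "coeff (map_poly of_int f :: complex poly) (d - 1) = a"
      unfolding fa using cI finI lead_coeff_prod[of "\<lambda>j. [:- \<alpha> j, 1:]" I]
        degree_prod_eq_sum_degree[of I "\<lambda>j. [:- \<alpha> j, 1:]"] by simp
    then have "of_int (coeff f (d - 1)) = a" by (simp add: coeff_map_poly)
    then have a1: "1 \<le> norm a"
      using \<open>a \<noteq> 0\<close> by (metis of_int_0 norm_of_int_ge_1)
    have row: "(\<Prod>j\<in>I. D k j) = norm (v k) ^ (d - 2) * norm a"
    proof -
      have "(\<Prod>j\<in>I. D k j) = (\<Prod>j\<in>I. norm (v k) * norm (u j))"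
        using k by (simp add: D_def norm_mult mult.commute)
      also have "\<dots> = norm (v k) ^ (d - 1) * norm (\<Prod>j\<in>I. u j)"
        by (simp add: prod.distrib cI prod_norm)
      also have "norm (v k) ^ (d - 1) = norm (v k) ^ (d - 2) * norm (v k)"
      proof -
        obtain e where "d = Suc (Suc e)" using d by (metis add_2_eq_Suc le_Suc_ex)
        then show ?thesis by simp
      qed
      finally show ?thesis by (simp add: a_def norm_mult)
    qed
    have "(\<Prod>i<d. \<Prod>j\<in>{..<d} - {i}. D i j) = (\<Prod>j\<in>I. D k j) * (\<Prod>i\<in>I. \<Prod>j\<in>{..<d} - {i}. D i j)"
      unfolding I using k prod.remove[of "{..<d}" k "\<lambda>i. \<Prod>j\<in>{..<d} - {i}. D i j"]
      by (simp only: finite_lessThan lessThan_iff)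
    also have "(\<Prod>i\<in>I. \<Prod>j\<in>{..<d} - {i}. D i j) = (\<Prod>i\<in>I. D i k * (\<Prod>j\<in>I - {i}. D i j))"
    proof (intro prod.cong refl)
      fix i assume i: "i \<in> I"
      then have "{..<d} - {i} = insert k (I - {i})" using k by (auto simp: I)
      then show "(\<Prod>j\<in>{..<d} - {i}. D i j) = D i k * (\<Prod>j\<in>I - {i}. D i j)" by (simp add: I)
    qed
    also have "\<dots> = (\<Prod>j\<in>I. D k j) * (\<Prod>i\<in>I. \<Prod>j\<in>I - {i}. D i j)"
    proof -
      have "(\<Prod>i\<in>I. D i k) = (\<Prod>j\<in>I. D k j)" by (intro prod.cong refl D_commute)
      then show ?thesis by (simp only: prod.distrib)
    qed
    finally have "(\<Prod>i<d. \<Prod>j\<in>{..<d} - {i}. D i j) =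
        (norm a)\<^sup>2 * (norm (v k) ^ (2 * (d - 2)) * (\<Prod>i\<in>I. \<Prod>j\<in>I - {i}. D i j))"
      unfolding row by (simp only: power2_eq_square mult_2 power_add mult_ac)
    moreover have "1 * 1 \<le> (norm a)\<^sup>2 * (norm (v k) ^ (2 * (d - 2)) * (\<Prod>i\<in>I. \<Prod>j\<in>I - {i}. D i j))"
    proof (rule mult_mono)
      show "1 \<le> norm (v k) ^ (2 * (d - 2)) * (\<Prod>i\<in>I. \<Prod>j\<in>I - {i}. D i j)"
        using 1 cI by (metis diff_diff_left one_add_one)
      show "1 \<le> (norm a)\<^sup>2" using a1 by (rule one_le_power)
    qed simp_all
    ultimately have "1 \<le> (\<Prod>i<d. \<Prod>j\<in>{..<d} - {i}. D i j)" by (simp only: mult_1)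
    then show ?thesis by (simp only: D_def mult_1)
  qed
qed

section \<open>Siegel's lemma\<close>

text \<open>Pigeonhole principle: \<open>(X + 1) ^ U\<close> integer vectors in a box are mapped to
  at most \<open>(U * B * X + 1) ^ E\<close> value vectors, and the difference of two vectors with
  the same image is the solution.\<close>

lemma siegel_lemma:
  fixes A :: "nat \<Rightarrow> nat \<Rightarrow> int" and B X :: nat
  assumes A: "\<And>e u. e < E \<Longrightarrow> u < U \<Longrightarrow> \<bar>A e u\<bar> \<le> int B"
    and card: "(U * B * X + 1) ^ E < (X + 1) ^ U"
  shows "\<exists>x. (\<exists>u<U. x u \<noteq> 0) \<and> (\<forall>u. \<bar>x u\<bar> \<le> int X) \<and> (\<forall>e<E. (\<Sum>u<U. A e u * x u) = 0)"
proof -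
  define S where "S = {..<U} \<rightarrow>\<^sub>E {0..int X}"
  \<comment> \<open>The least possible value of the e-th linear form on the box. Starting the range
    there, instead of at -U*B*X, keeps its length at U*B*X.\<close>
  define lo where "lo e = (\<Sum>u<U. min (A e u) 0 * int X)" for e
  define \<phi> where "\<phi> x = (\<lambda>e\<in>{..<E}. \<Sum>u<U. A e u * x u)" for x
  have "\<phi> x \<in> (\<Pi>\<^sub>E e\<in>{..<E}. {lo e..lo e + int (U * B * X)})" if x: "x \<in> S" for x
  proof (rule PiE_I)
    fix e assume e: "e \<in> {..<E}"
    have xb: "0 \<le> x u" "x u \<le> int X" if "u < U" for u using x that by (auto simp: S_def PiE_iff)
    have lower: "lo e \<le> (\<Sum>u<U. A e u * x u)"
      unfolding lo_def
    proof (rule sum_mono)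
      fix u assume "u \<in> {..<U}"
      then show "min (A e u) 0 * int X \<le> A e u * x u"
        using xb[of u] by (cases "A e u \<ge> 0") (auto simp: min_def intro: mult_left_mono_neg)
    qed
    have "(\<Sum>u<U. A e u * x u) - lo e = (\<Sum>u<U. A e u * x u - min (A e u) 0 * int X)"
      by (simp add: lo_def sum_subtractf)
    also have "\<dots> \<le> (\<Sum>u<U. int B * int X)"
    proof (rule sum_mono)
      fix u assume u: "u \<in> {..<U}"
      have B: "\<bar>A e u\<bar> \<le> int B" using A e u by simp
      show "A e u * x u - min (A e u) 0 * int X \<le> int B * int X"
      proof (cases "A e u \<ge> 0")
        case True
        then show ?thesis using xb[of u] B u by (auto simp: min_def intro: mult_mono)
      next
        case False
        have "A e u * x u \<le> 0" using xb[of u] u False by (intro mult_nonpos_nonneg) auto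
        moreover have "- A e u * int X \<le> int B * int X" using B by (intro mult_right_mono) auto
        ultimately show ?thesis using False by (simp add: min_def)
      qed
    qed
    also have "\<dots> = int (U * B * X)" by simp
    finally show "\<phi> x e \<in> {lo e..lo e + int (U * B * X)}" using lower e by (simp add: \<phi>_def)
  qed (simp add: \<phi>_def)
  then have "card (\<phi> ` S) \<le> card (\<Pi>\<^sub>E e\<in>{..<E}. {lo e..lo e + int (U * B * X)})"
    by (intro card_mono finite_PiE) auto
  also have "\<dots> = (U * B * X + 1) ^ E" by (simp add: card_PiE nat_add_distrib nat_mult_distrib flip: of_nat_mult)
  also have "\<dots> < card S" using card by (simp add: S_def card_PiE nat_add_distrib)
  finally have "\<not> inj_on \<phi> S" by (rule pigeonhole)
  then obtain x y where xy: "x \<in> S" "y \<in> S" "\<phi> x = \<phi> y" "x \<noteq> y" by (auto simp: inj_on_def)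
  define z where "z u = (if u < U then x u - y u else 0)" for u
  have "\<exists>u<U. z u \<noteq> 0"
  proof (rule ccontr)
    assume "\<not> (\<exists>u<U. z u \<noteq> 0)"
    then have "x u = y u" if "u \<in> {..<U}" for u using that by (auto simp: z_def)
    then have "x = y" using xy(1,2) unfolding S_def by (metis PiE_ext)
    then show False using xy by simp
  qed
  moreover have "\<bar>z u\<bar> \<le> int X" for u
    using xy(1,2) by (auto simp: z_def S_def PiE_iff) (smt (verit) atLeastAtMost_iff lessThan_iff)
  moreover have "(\<Sum>u<U. A e u * z u) = 0" if "e < E" for e
  proof -
    have "(\<Sum>u<U. A e u * z u) = (\<Sum>u<U. A e u * x u) - (\<Sum>u<U. A e u * y u)"
      by (simp add: z_def algebra_simps sum_subtractf)
    also have "\<dots> = 0" using fun_cong[OF xy(3), of e] that by (simp add: \<phi>_def)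
    finally show ?thesis .
  qed
  ultimately show ?thesis by blast
qed

text \<open>These are the divided derivatives p^(k)(c) / k!. Taking them as coefficients of p(X + c)
  keeps binomials in place of factorials, so integrality and size can be read off. The truncated
  difference \<open>i - k\<close> is harmless, since the binomial vanishes for i < k.\<close>

lemma coeff_pcompose_shift:
  fixes p :: "'a :: comm_ring_1 poly"
  assumes "degree p \<le> n"
  shows "coeff (pcompose p [:c, 1:]) k = (\<Sum>i\<le>n. coeff p i * (of_nat (i choose k) * c ^ (i - k)))"
proof -
  have bin: "coeff ([:c, 1:] ^ i) k = of_nat (i choose k) * c ^ (i - k)" for i k
  proof (induction i arbitrary: k)
    case 0
    then show ?case by (cases k) auto
  next
    case (Suc i)
    show ?case
    proof (cases k)
      case (Suc l)
      have "c * (of_nat (i choose Suc l) * c ^ (i - Suc l)) = of_nat (i choose Suc l) * c ^ (i - l)"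
      proof (cases "Suc l \<le> i")
        case True
        then have "c * c ^ (i - Suc l) = c ^ (i - l)"
          by (metis Suc_diff_Suc Suc_le_lessD power_Suc)
        then show ?thesis by (metis mult.left_commute)
      qed (simp add: binomial_eq_0)
      then show ?thesis using Suc by (simp add: coeff_pCons Suc.IH algebra_simps)
    qed (simp add: coeff_pCons Suc.IH)
  qed
  have mon: "pcompose (monom b i) [:c, 1:] = smult b ([:c, 1:] ^ i)" for b i
    by (induction i) (simp_all add: monom_0 monom_Suc pcompose_pCons)
  have "p = (\<Sum>i\<le>n. monom (coeff p i) i)" using poly_as_sum_of_monoms'[OF assms] by simp
  then have "pcompose p [:c, 1:] = pcompose (\<Sum>i\<le>n. monom (coeff p i) i) [:c, 1:]" by simp
  also have "\<dots> = (\<Sum>i\<le>n. smult (coeff p i) ([:c, 1:] ^ i))" by (simp add: pcompose_sum mon)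
  finally show ?thesis by (simp add: coeff_sum bin)
qed

section \<open>Thue's method\<close>

abbreviation cpoly :: "int poly \<Rightarrow> complex poly" where "cpoly \<equiv> map_poly of_int"

lemma cpoly_pCons: "cpoly (pCons a p) = pCons (of_int a) (cpoly p)"
  by (intro poly_eqI) (simp add: coeff_map_poly coeff_pCons split: nat.split)

lemma pcompose_power: "pcompose (p ^ n) q = pcompose p q ^ n" for p :: "'a :: comm_semiring_1 poly"
  by (induction n) (simp_all add: pcompose_mult pcompose_1)

lemma linear_power_dvd_iff_coeff_pcompose:
  fixes p :: "'a :: comm_ring_1 poly"
  shows "[:- c, 1:] ^ n dvd p \<longleftrightarrow> (\<forall>k<n. coeff (pcompose p [:c, 1:]) k = 0)"
proof -
  have shift: "pcompose [:- c, 1:] [:c, 1:] = [:0, 1:]" "pcompose [:0, 1:] [:- c, 1:] = [:- c, 1:]"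
    "pcompose [:c, 1:] [:- c, 1:] = [:0, 1:]"
    by (simp_all add: pcompose_pCons)
  have "[:- c, 1:] ^ n dvd p \<longleftrightarrow> monom 1 n dvd pcompose p [:c, 1:]"
  proof
    assume "[:- c, 1:] ^ n dvd p"
    then obtain r where "p = [:- c, 1:] ^ n * r" ..
    then have "pcompose p [:c, 1:] = [:0, 1:] ^ n * pcompose r [:c, 1:]"
      by (simp add: pcompose_mult pcompose_power shift)
    then show "monom 1 n dvd pcompose p [:c, 1:]" by (simp add: monom_altdef)
  next
    assume "monom 1 n dvd pcompose p [:c, 1:]"
    then obtain r where r: "pcompose p [:c, 1:] = [:0, 1:] ^ n * r" by (auto simp: monom_altdef)
    have "p = pcompose (pcompose p [:c, 1:]) [:- c, 1:]" by (simp add: shift flip: pcompose_assoc)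
    also have "\<dots> = [:- c, 1:] ^ n * pcompose r [:- c, 1:]"
      unfolding r by (simp add: pcompose_mult pcompose_power shift)
    finally show "[:- c, 1:] ^ n dvd p" by (metis dvd_triv_left)
  qed
  then show ?thesis by (simp add: monom_1_dvd_iff')
qed

text \<open>Gauss's lemma: by multiplicativity of the content, \<open>a\<close> divides the content
  of the cofactor and can be cancelled.\<close>

lemma primitive_dvd_smult_cancel:
  fixes g l :: "int poly"
  assumes l: "content l = 1" and a: "a \<noteq> 0" and dvd: "l dvd smult a g"
  shows "l dvd g"
proof -
  obtain s where eq: "smult a g = l * s" using dvd ..
  have "content (smult a g) = content l * content s"
    unfolding eq by (rule content_mult)
  then have "content s = \<bar>a\<bar> * content g" using l by simp
  then have "a dvd content s" by simp
  then have "[:a:] dvd s" by (simp add: const_poly_dvd_iff_dvd_content)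
  then obtain s' where "s = smult a s'" by (auto elim: dvdE)
  then have eq': "smult a g = smult a (l * s')" using eq by simp
  have "g = l * s'"
  proof (rule poly_eqI)
    fix i
    show "coeff g i = coeff (l * s') i"
      using arg_cong[OF eq', of "\<lambda>h. coeff h i"] a by (simp only: coeff_smult mult_cancel_left) simp
  qed
  then show ?thesis by (rule dvdI)
qed

lemma content_linear_power:
  fixes p q :: int
  assumes "coprime p q" "q \<noteq> 0"
  shows "content ([:- p, q:] ^ n) = 1"
proof (induction n)
  case (Suc n)
  have "content [:- p, q:] = 1"
    using assms by (simp add: content_def cCons_def coprime_iff_gcd_eq_1)
  then show ?case using Suc content_mult[of "[:- p, q:]" "[:- p, q:] ^ n"] by (simp only: power_Suc)
qed simp

lemma primitive_linear_dvd:
  fixes g :: "int poly"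
  assumes co: "coprime p q" and q: "q \<noteq> 0" and root: "poly (cpoly g) (of_int p / of_int q) = 0"
  shows "[:- p, q:] dvd g"
proof -
  let ?l = "[:- p, q:]"
  define r where "r = pseudo_mod g ?l"
  have l0: "?l \<noteq> 0" using q by simp
  obtain a s where a: "a \<noteq> 0" "smult a g = ?l * s + r"
    using pseudo_mod(1)[OF l0, of g] unfolding r_def by blast
  have "degree r = 0" using pseudo_mod(2)[OF l0, of g] q by (auto simp: r_def)
  then obtain b where b: "r = [:b:]" by (rule degree_eq_zeroE)
  have "cpoly (smult a g) = cpoly ?l * cpoly s + cpoly r"
    by (simp only: a(2) of_int_poly_hom.hom_add of_int_poly_hom.hom_mult)
  from arg_cong[OF this, of "\<lambda>h. poly h (of_int p / of_int q)"] have "b = 0"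
    using q root by (simp add: b cpoly_pCons of_int_hom.map_poly_hom_smult)
  then have "smult a g = ?l * s" using a(2) b by simp
  then show ?thesis
    using primitive_dvd_smult_cancel[of ?l a g] content_linear_power[OF co q, of 1] a(1) by (metis dvd_triv_left power_one_right)
qed

text \<open>Turns an order of vanishing at a fraction p/q, known over the complex numbers, into
  divisibility by a power of qX - p over the integers. Then q^n divides the leading coefficient,
  which is how a high order of vanishing contradicts a bound on the coefficients.\<close>

lemma primitive_linear_power_dvd:
  fixes g :: "int poly"
  assumes co: "coprime p q" and q: "q \<noteq> 0" and dvd: "[:- (of_int p / of_int q), 1:] ^ n dvd cpoly g"
  shows "[:- p, q:] ^ n dvd g"
  using dvd
proof (induction n arbitrary: g)
  case (Suc n)
  let ?x = "of_int p / of_int q :: complex"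
  have lin: "cpoly [:- p, q:] = smult (of_int q) [:- ?x, 1:]" using q by (simp add: cpoly_pCons)
  have "poly (cpoly g) ?x = 0"
    using Suc.prems by (auto elim!: dvdE)
  then obtain h where h: "g = [:- p, q:] * h"
    using primitive_linear_dvd[OF co q] by (blast elim: dvdE)
  have "cpoly g = [:- ?x, 1:] * smult (of_int q) (cpoly h)"
    by (simp only: h of_int_poly_hom.hom_mult lin mult_smult_left mult_smult_right)
  then have "[:- ?x, 1:] * [:- ?x, 1:] ^ n dvd [:- ?x, 1:] * smult (of_int q) (cpoly h)"
    using Suc.prems by (simp only: power_Suc)
  then have "[:- ?x, 1:] ^ n dvd smult (of_int q) (cpoly h)"
    by (subst (asm) dvd_times_left_cancel_iff) simp_all
  then have "[:- ?x, 1:] ^ n dvd cpoly h" using q by (simp add: dvd_smult_cancel)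
  then have "[:- p, q:] ^ n dvd h" by (rule Suc.IH)
  then show ?case unfolding h power_Suc by (intro mult_dvd_mono dvd_refl)
qed simp

lemma lead_coeff_dvd_bound:
  fixes w :: "int poly"
  assumes "w \<noteq> 0" "[:- p, q:] ^ n dvd w" "q > 0" "\<And>i. \<bar>coeff w i\<bar> \<le> B"
  shows "q ^ n \<le> B"
proof -
  obtain r where r: "w = [:- p, q:] ^ n * r" using assms(2) ..
  then have "r \<noteq> 0" using assms(1) by auto
  have "lead_coeff w = q ^ n * lead_coeff r"
    using assms(3) by (simp add: r lead_coeff_mult lead_coeff_power)
  then have "\<bar>lead_coeff w\<bar> = q ^ n * \<bar>lead_coeff r\<bar>"
    using assms(3) by (simp add: abs_mult power_abs)
  moreover have "1 \<le> \<bar>lead_coeff r\<bar>" using \<open>r \<noteq> 0\<close> by (simp add: int_one_le_iff_zero_less)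
  then have "q ^ n * 1 \<le> q ^ n * \<bar>lead_coeff r\<bar>"
    using assms(3) by (intro mult_left_mono) auto
  ultimately show ?thesis using assms(4)[of "degree w"] by linarith
qed

text \<open>Subtracting a multiple of \<open>Q\<close> leaves the Wronskian zero and kills the
  coefficient of degree \<open>degree Q\<close>. If the remainder \<open>R\<close> were nonzero,
  comparing leading terms would force \<open>R\<close> and \<open>Q\<close> to have the same degree
  in characteristic 0.\<close>

lemma wronskian_eq_0_imp:
  fixes P Q :: "'a :: field_char_0 poly"
  assumes W: "pderiv P * Q = P * pderiv Q" and Q: "Q \<noteq> 0"
  shows "\<exists>c. P = smult c Q"
proof (rule ccontr)
  assume neq: "\<nexists>c. P = smult c Q"
  define R where "R = P - smult (coeff P (degree Q) / lead_coeff Q) Q"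
  have R0: "R \<noteq> 0" using neq by (auto simp: R_def)
  have WR: "pderiv R * Q = R * pderiv Q"
    using W by (simp add: R_def pderiv_diff pderiv_smult algebra_simps)
  have "degree R = degree Q"
  proof (cases "degree R = 0 \<or> degree Q = 0")
    case True
    then have "pderiv R = 0 \<or> pderiv Q = 0" by (simp add: pderiv_eq_0_iff)
    then have "pderiv R = 0" "pderiv Q = 0" using WR R0 Q by auto
    then show ?thesis by (simp add: pderiv_eq_0_iff)
  next
    case False
    have lc: "lead_coeff (pderiv p) = of_nat (degree p) * lead_coeff p" if "degree p \<noteq> 0" for p :: "'a poly"
      using that by (simp add: degree_pderiv coeff_pderiv)
    have "lead_coeff (pderiv R) * lead_coeff Q = lead_coeff R * lead_coeff (pderiv Q)"
      using arg_cong[OF WR, of lead_coeff] by (simp add: lead_coeff_mult)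
    then have "of_nat (degree R) * (lead_coeff R * lead_coeff Q) = of_nat (degree Q) * (lead_coeff R * lead_coeff Q)"
      using False by (simp add: lc algebra_simps)
    then show ?thesis using R0 Q by simp
  qed
  moreover have "coeff R (degree Q) = 0" using Q by (simp add: R_def)
  ultimately show False using R0 by (metis leading_coeff_0_iff)
qed


text \<open>Coefficients of the remainder of (aX)^s modulo \<open>f\<close>, where a is the leading
  coefficient of \<open>f\<close>. The factor a^s keeps the remainder integral for non-monic
  \<open>f\<close>; the subtracted term is the reduction of the overflow at X^d.\<close>

fun power_residue :: "int poly \<Rightarrow> nat \<Rightarrow> nat \<Rightarrow> int" where
  "power_residue f 0 j = (if j = 0 then 1 else 0)"
| "power_residue f (Suc s) j = lead_coeff f * (if j = 0 then 0 else power_residue f s (j - 1))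
     - power_residue f s (degree f - 1) * coeff f j"

lemma abs_power_residue_le:
  assumes "\<And>i. \<bar>coeff f i\<bar> \<le> A" "A \<ge> 1"
  shows "\<bar>power_residue f s j\<bar> \<le> (2 * A) ^ s"
proof (induction s arbitrary: j)
  case (Suc s)
  have "\<bar>lead_coeff f * (if j = 0 then 0 else power_residue f s (j - 1))\<bar> \<le> A * (2 * A) ^ s"
    using assms Suc.IH[of "j - 1"] by (auto simp: abs_mult intro!: mult_mono)
  moreover have "\<bar>power_residue f s (degree f - 1) * coeff f j\<bar> \<le> (2 * A) ^ s * A"
    using assms Suc.IH[of "degree f - 1"] by (auto simp: abs_mult intro!: mult_mono)
  ultimately show ?case by (simp add: mult.commute mult.assoc)
qed simp

lemma power_residue:
  assumes root: "poly (cpoly f) \<beta> = 0" and deg: "degree f > 0"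
  shows "of_int (lead_coeff f) ^ s * \<beta> ^ s = (\<Sum>j<degree f. of_int (power_residue f s j) * \<beta> ^ j)"
proof (induction s)
  case 0
  have "(\<Sum>j<degree f. of_int (power_residue f 0 j) * \<beta> ^ j) = (\<Sum>j\<in>{0}. \<beta> ^ j)"
    using deg by (intro sum.mono_neutral_cong_right) auto
  then show ?case by simp
next
  case (Suc s)
  let ?d = "degree f" and ?a = "of_int (lead_coeff f) :: complex"
  let ?r = "\<lambda>j. of_int (power_residue f s j) :: complex"
  obtain e where e: "?d = Suc e" using deg by (cases ?d) auto
  have "poly (cpoly f) \<beta> = (\<Sum>j\<le>?d. of_int (coeff f j) * \<beta> ^ j)"
    by (simp add: poly_altdef coeff_map_poly)
  then have top: "?a * \<beta> ^ ?d = - (\<Sum>j<?d. of_int (coeff f j) * \<beta> ^ j)"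
    using root by (simp add: lessThan_Suc_atMost[symmetric] add_eq_0_iff)
  have "?a ^ Suc s * \<beta> ^ Suc s = ?a * \<beta> * (\<Sum>j<?d. ?r j * \<beta> ^ j)"
    using Suc.IH by (simp add: algebra_simps)
  also have "\<dots> = (\<Sum>j<?d. ?a * ?r j * \<beta> ^ Suc j)"
    by (simp add: sum_distrib_left mult_ac)
  also have "\<dots> = (\<Sum>j<e. ?a * ?r j * \<beta> ^ Suc j) + ?r e * (?a * \<beta> ^ ?d)"
    by (simp add: e mult_ac)
  also have "(\<Sum>j<e. ?a * ?r j * \<beta> ^ Suc j) = (\<Sum>j<?d. (if j = 0 then 0 else ?a * ?r (j - 1) * \<beta> ^ j))"
    unfolding e by (subst sum.lessThan_Suc_shift) simp
  also have "\<dots> + ?r e * (?a * \<beta> ^ ?d) = (\<Sum>j<?d. of_int (power_residue f (Suc s) j) * \<beta> ^ j)"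
  proof -
    have "(\<Sum>j<?d. of_int (power_residue f (Suc s) j) * \<beta> ^ j) =
        (\<Sum>j<?d. (if j = 0 then 0 else ?a * ?r (j - 1) * \<beta> ^ j) - ?r e * (of_int (coeff f j) * \<beta> ^ j))"
      by (intro sum.cong) (simp_all add: e algebra_simps)
    then show ?thesis unfolding top by (simp only: sum_subtractf) (simp add: sum_distrib_left)
  qed
  finally show ?case .
qed

text \<open>
  Thue's auxiliary polynomial is \<open>P(X) - Y Q(X)\<close>.  Working modulo \<open>f\<close> instead of modulo the minimal
  polynomial of one root makes it vanish to order \<open>8h\<close> at every root of \<open>f\<close>, which is what excludes
  a degenerate Wronskian when \<open>f\<close> is reducible.
\<close>

lemma thue_auxiliary_polynomials:
  fixes f :: "int poly" and A d h :: nat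
  assumes d: "degree f = d" "d > 0" and A: "\<And>i. \<bar>coeff f i\<bar> \<le> int A" "A \<ge> 1"
  defines "N \<equiv> h * (4 * d + 2)"
  defines "X \<equiv> (8 * A) ^ (2 * d * (N + 1))"
  shows "\<exists>P Q. (P \<noteq> 0 \<or> Q \<noteq> 0) \<and> degree P \<le> N \<and> degree Q \<le> N
    \<and> (\<forall>i. \<bar>coeff P i\<bar> \<le> int X) \<and> (\<forall>i. \<bar>coeff Q i\<bar> \<le> int X)
    \<and> (\<forall>\<beta>. poly (cpoly f) \<beta> = 0 \<longrightarrow> [:- \<beta>, 1:] ^ (8 * h) dvd cpoly P - smult \<beta> (cpoly Q))"
proof -
  define M where "M = N + 1"
  define a where "a = lead_coeff f"
  \<comment> \<open>One equation for each Taylor order j < 8h and each exponent l < d of the root: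
    after reduction modulo \<open>f\<close> the same integer equations serve all roots. An equation
    is indexed by e = j*d + l. The unknowns are the \<open>M\<close> coefficients of P followed by
    those of Q, and their number \<open>2 * M\<close> exceeds \<open>E\<close> by 4h + 2.\<close>
  define E where "E = 8 * h * d"
  \<comment> \<open>Multiplying by a^M lets every power of the root up to exponent \<open>M\<close>
    be replaced by its integral residue. \<open>p\<close> belongs to P; \<open>q\<close> belongs to
    Q, with one more power of the root from the substitution Y = \<beta>.\<close>
  define p where "p j l i = int (i choose j) * a ^ (M - (i - j)) * power_residue f (i - j) l" for j l i
  define q where "q j l i = int (i choose j) * a ^ (M - (i - j + 1)) * power_residue f (i - j + 1) l" for j l i
  define B where "B e u = (if u < M then p (e div d) (e mod d) u else - q (e div d) (e mod d) (u - M))" for e u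
  have a0: "a \<noteq> 0" using d by (auto simp: a_def)
  have coef: "\<bar>int (i choose j) * a ^ (M - s) * power_residue f s l\<bar> \<le> int ((4 * A) ^ M)"
    if "i \<le> N" "s \<le> M" for i j l s
  proof -
    have "\<bar>int (i choose j) * a ^ (M - s) * power_residue f s l\<bar> \<le> 2 ^ M * int A ^ (M - s) * (2 * int A) ^ s"
      unfolding abs_mult
    proof (intro mult_mono)
      have "i choose j \<le> 2 ^ i" by (rule binomial_le_pow2)
      also have "\<dots> \<le> 2 ^ M" using that by (intro power_increasing) (auto simp: M_def)
      finally have "int (i choose j) \<le> int (2 ^ M)" by (rule of_nat_mono)
      then show "\<bar>int (i choose j)\<bar> \<le> 2 ^ M" by simp
      show "\<bar>a ^ (M - s)\<bar> \<le> int A ^ (M - s)"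
        unfolding power_abs using A(1) by (intro power_mono) (auto simp: a_def)
      show "\<bar>power_residue f s l\<bar> \<le> (2 * int A) ^ s"
        using A by (intro abs_power_residue_le) auto
    qed auto
    also have "\<dots> = 2 ^ M * 2 ^ s * int A ^ M"
    proof -
      have e: "int A ^ M = int A ^ (M - s) * int A ^ s" using that by (simp flip: power_add)
      show ?thesis by (simp only: e power_mult_distrib mult_ac)
    qed
    also have "\<dots> \<le> 2 ^ M * 2 ^ M * int A ^ M"
      using that A by (intro mult_mono power_increasing) auto
    also have "\<dots> = (2 * 2 * int A) ^ M" by (simp only: power_mult_distrib)
    also have "\<dots> = int ((4 * A) ^ M)" by simp
    finally show ?thesis .
  qed
  have "\<exists>x. (\<exists>u<2 * M. x u \<noteq> 0) \<and> (\<forall>u. \<bar>x u\<bar> \<le> int X) \<and> (\<forall>e<E. (\<Sum>u<2 * M. B e u * x u) = 0)"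
  proof (rule siegel_lemma)
    fix e u assume "e < E" "u < 2 * M"
    then show "\<bar>B e u\<bar> \<le> int ((4 * A) ^ M)"
      using coef[of u "u - e div d"] coef[of "u - M" "u - M - e div d + 1"]
      unfolding B_def p_def q_def by (auto simp: M_def)
  next
    \<comment> \<open>The coefficients are at most (4A)^M, and the base 8 absorbs the number 2M
      \<le> 2^M of unknowns. With 8hd equations and a surplus of 4h + 2 unknowns, the height must be
      about Y to the power 8hd / 4h, whence X = Y^(2d).\<close>
    define Y where "Y = (8 * A) ^ M"
    have "2 * M \<le> 2 ^ M" unfolding M_def by (induction N) auto
    then have "2 * M * (4 * A) ^ M \<le> 2 ^ M * (4 * A) ^ M" by (rule mult_right_mono) simp
    also have "\<dots> = (2 * (4 * A)) ^ M" by (simp only: power_mult_distrib)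
    also have "\<dots> = Y" by (simp add: Y_def)
    finally have Y: "2 * M * (4 * A) ^ M \<le> Y" .
    have Y1: "1 \<le> Y" using A by (simp add: Y_def)
    have XY: "X = Y ^ (2 * d)" by (simp only: X_def Y_def M_def power_mult[symmetric] mult_ac)
    have "2 * M * (4 * A) ^ M * X + 1 \<le> Y * X + Y" using Y Y1 by (intro add_mono mult_right_mono) auto
    then have "(2 * M * (4 * A) ^ M * X + 1) ^ E \<le> (Y * (X + 1)) ^ E"
      by (intro power_mono) (auto simp: algebra_simps)
    also have "\<dots> = Y ^ E * (X + 1) ^ E" by (rule power_mult_distrib)
    also have "Y ^ E \<le> Y ^ (2 * d * (4 * h + 2))"
      using Y1 by (intro power_increasing) (auto simp: E_def algebra_simps)
    also have "\<dots> = X ^ (4 * h + 2)" by (simp only: XY power_mult)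
    also have "\<dots> < (X + 1) ^ (4 * h + 2)" by (intro power_strict_mono) auto
    also have "(X + 1) ^ (4 * h + 2) * (X + 1) ^ E = (X + 1) ^ (2 * M)"
    proof -
      have "4 * h + 2 + E = 2 * M" by (simp add: E_def M_def N_def algebra_simps)
      then show ?thesis by (metis power_add)
    qed
    finally show "(2 * M * (4 * A) ^ M * X + 1) ^ E < (X + 1) ^ (2 * M)" by simp
  qed
  then obtain x where x: "\<exists>u<2 * M. x u \<noteq> 0" "\<And>u. \<bar>x u\<bar> \<le> int X"
    "\<And>e. e < E \<Longrightarrow> (\<Sum>u<2 * M. B e u * x u) = 0" by blast
  define P Q where "P = Poly (map x [0..<M])" and "Q = Poly (map (\<lambda>i. x (M + i)) [0..<M])"
  have cP: "coeff P i = (if i < M then x i else 0)" and cQ: "coeff Q i = (if i < M then x (M + i) else 0)" for i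
    by (simp_all add: P_def Q_def coeff_Poly_eq nth_default_def)
  have degPQ: "degree P \<le> N" "degree Q \<le> N"
    by (intro degree_le; simp add: cP cQ M_def)+
  have "P \<noteq> 0 \<or> Q \<noteq> 0"
  proof (rule ccontr)
    assume "\<not> (P \<noteq> 0 \<or> Q \<noteq> 0)"
    then have 0: "coeff P i = 0" "coeff Q i = 0" for i by auto
    have "x u = 0" if "u < 2 * M" for u
      using 0(1)[of u] 0(2)[of "u - M"] that unfolding cP cQ by (cases "u < M") (auto split: if_splits)
    then show False using x(1) by blast
  qed
  moreover have "[:- \<beta>, 1:] ^ (8 * h) dvd cpoly P - smult \<beta> (cpoly Q)" if root: "poly (cpoly f) \<beta> = 0" for \<beta>
    unfolding linear_power_dvd_iff_coeff_pcompose
  proof safe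
    fix j assume j: "j < 8 * h"
    let ?G = "cpoly P - smult \<beta> (cpoly Q)"
    let ?a = "of_int a :: complex"
    have red: "?a ^ M * \<beta> ^ s = ?a ^ (M - s) * (\<Sum>l<d. of_int (power_residue f s l) * \<beta> ^ l)" if "s \<le> M" for s
    proof -
      have "?a ^ M = ?a ^ (M - s) * ?a ^ s" using that by (simp flip: power_add)
      then show ?thesis using power_residue[OF root, of s] d by (simp add: a_def mult.assoc)
    qed
    have "degree ?G \<le> N"
      using degPQ by (intro degree_diff_le) (auto intro: order_trans[OF degree_smult_le])
    then have "coeff (pcompose ?G [:\<beta>, 1:]) j = (\<Sum>i\<le>N. coeff ?G i * (of_nat (i choose j) * \<beta> ^ (i - j)))"
      by (rule coeff_pcompose_shift)
    also have "\<dots> = (\<Sum>i<M. of_int (x i) * (of_nat (i choose j) * \<beta> ^ (i - j))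
                          - of_int (x (M + i)) * (of_nat (i choose j) * \<beta> ^ (i - j + 1)))"
      by (rule sum.cong) (auto simp: M_def coeff_map_poly cP cQ algebra_simps)
    finally have "?a ^ M * coeff (pcompose ?G [:\<beta>, 1:]) j =
        (\<Sum>i<M. of_int (x i) * of_nat (i choose j) * (?a ^ M * \<beta> ^ (i - j))
              - of_int (x (M + i)) * of_nat (i choose j) * (?a ^ M * \<beta> ^ (i - j + 1)))"
      by (simp only: sum_distrib_left right_diff_distrib mult_ac)
    also have "\<dots> = (\<Sum>i<M. (\<Sum>l<d. of_int (p j l i * x i) * \<beta> ^ l) - (\<Sum>l<d. of_int (q j l i * x (M + i)) * \<beta> ^ l))"
    proof (intro sum.cong refl arg_cong2[of _ _ _ _ minus])
      fix i assume "i \<in> {..<M}"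
      then have "i - j \<le> M" "i - j + 1 \<le> M" by auto
      then show "of_int (x i) * of_nat (i choose j) * (?a ^ M * \<beta> ^ (i - j)) = (\<Sum>l<d. of_int (p j l i * x i) * \<beta> ^ l)"
        "of_int (x (M + i)) * of_nat (i choose j) * (?a ^ M * \<beta> ^ (i - j + 1)) = (\<Sum>l<d. of_int (q j l i * x (M + i)) * \<beta> ^ l)"
        by (simp_all only: red p_def q_def) (simp_all add: sum_distrib_left mult_ac)
    qed
    also have "\<dots> = (\<Sum>l<d. (\<Sum>i<M. of_int (p j l i * x i) * \<beta> ^ l) - (\<Sum>i<M. of_int (q j l i * x (M + i)) * \<beta> ^ l))"
      unfolding sum_subtractf by (subst sum.swap, subst (2) sum.swap) (rule refl)
    also have "\<dots> = (\<Sum>l<d. of_int (\<Sum>u<2 * M. B (j * d + l) u * x u) * \<beta> ^ l)"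
    proof (intro sum.cong refl)
      fix l assume l: "l \<in> {..<d}"
      have "(\<Sum>u<2 * M. B (j * d + l) u * x u) = (\<Sum>u<M + M. B (j * d + l) u * x u)" by (simp add: mult_2)
      also have "\<dots> = (\<Sum>u<M. B (j * d + l) u * x u) + (\<Sum>i<M. B (j * d + l) (M + i) * x (M + i))"
        using sum.atLeastLessThan_concat[of 0 M "M + M" "\<lambda>u. B (j * d + l) u * x u"]
          sum.shift_bounds_nat_ivl[of "\<lambda>u. B (j * d + l) u * x u" 0 M M]
        by (simp add: atLeast0LessThan add.commute)
      also have "\<dots> = (\<Sum>i<M. p j l i * x i) - (\<Sum>i<M. q j l i * x (M + i))"
        using l by (simp add: B_def sum_negf)
      finally show "(\<Sum>i<M. of_int (p j l i * x i) * \<beta> ^ l) - (\<Sum>i<M. of_int (q j l i * x (M + i)) * \<beta> ^ l) =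
          of_int (\<Sum>u<2 * M. B (j * d + l) u * x u) * \<beta> ^ l"
        by (simp add: sum_distrib_right left_diff_distrib)
    qed
    also have "\<dots> = 0"
    proof (intro sum.neutral ballI)
      fix l assume l: "l \<in> {..<d}"
      have "j * d + l < E"
      proof -
        have "j * d + l < (j + 1) * d" using l by simp
        also have "\<dots> \<le> 8 * h * d" using j by (intro mult_right_mono) auto
        finally show ?thesis by (simp add: E_def)
      qed
      then show "of_int (\<Sum>u<2 * M. B (j * d + l) u * x u) * \<beta> ^ l = 0" using x(3) by simp
    qed
    finally show "coeff (pcompose ?G [:\<beta>, 1:]) j = 0" using a0 by simp
  qed
  moreover have "\<bar>coeff P i\<bar> \<le> int X" "\<bar>coeff Q i\<bar> \<le> int X" for i using x(2) by (simp_all add: cP cQ)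
  ultimately show ?thesis using degPQ by blast
qed

lemma mult_card_le_degree:
  fixes R :: "'a :: idom poly"
  assumes "R \<noteq> 0" "finite S" "\<And>\<beta>. \<beta> \<in> S \<Longrightarrow> [:- \<beta>, 1:] ^ n dvd R"
  shows "n * card S \<le> degree R"
proof (cases "n = 0")
  case False
  have "n * card S = (\<Sum>\<beta>\<in>S. n)" by simp
  also have "\<dots> \<le> (\<Sum>\<beta>\<in>S. order \<beta> R)"
    using assms by (intro sum_mono) (simp add: order_divides)
  also have "\<dots> \<le> (\<Sum>\<beta> | poly R \<beta> = 0. order \<beta> R)"
  proof (rule sum_mono2)
    show "finite {\<beta>. poly R \<beta> = 0}" using assms(1) by (rule poly_roots_finite)
    show "S \<subseteq> {\<beta>. poly R \<beta> = 0}"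
    proof
      fix \<beta> assume "\<beta> \<in> S"
      then have "[:- \<beta>, 1:] ^ 1 dvd R" using assms(3)[of \<beta>] False by (metis dvd_trans le_imp_power_dvd less_one not_le)
      then show "\<beta> \<in> {\<beta>. poly R \<beta> = 0}" by (simp add: poly_eq_0_iff_dvd)
    qed
  qed simp
  also have "\<dots> \<le> degree R" using assms(1) by (rule sum_order_le_degree)
  finally show ?thesis .
qed simp

text \<open>If the Wronskian vanishes and Q does not, then P = cQ, so P - \<beta>Q = (c - \<beta>)Q
  and Q vanishes to order 8h at each of the at least d - 1 roots other than c. This gives 8(d - 1)
  \<le> 4d + 2, which fails for d \<ge> 3. If Q = 0, the same count applies to P.\<close>

lemma thue_wronskian_nonzero:
  fixes f P Q :: "int poly"
  assumes d: "d \<ge> 3" and roots: "card {\<beta>. poly (cpoly f) \<beta> = 0} = d" and h: "h > 0"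
    and PQ: "P \<noteq> 0 \<or> Q \<noteq> 0" "degree P \<le> h * (4 * d + 2)" "degree Q \<le> h * (4 * d + 2)"
    and dvd: "\<And>\<beta>. poly (cpoly f) \<beta> = 0 \<Longrightarrow> [:- \<beta>, 1:] ^ (8 * h) dvd cpoly P - smult \<beta> (cpoly Q)"
  shows "pderiv P * Q - P * pderiv Q \<noteq> 0"
proof
  assume W: "pderiv P * Q - P * pderiv Q = 0"
  let ?Z = "{\<beta>. poly (cpoly f) \<beta> = 0}"
  have fin: "finite ?Z" using roots d by (metis card.infinite not_numeral_le_zero)
  have "\<exists>R c. R \<noteq> 0 \<and> degree R \<le> h * (4 * d + 2) \<and> (\<forall>\<beta>\<in>?Z - {c}. [:- \<beta>, 1:] ^ (8 * h) dvd R)"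
  proof (cases "Q = 0")
    case True
    then show ?thesis using PQ dvd by (intro exI[of _ "cpoly P"]) auto
  next
    case False
    have "pderiv (cpoly P) * cpoly Q = cpoly P * pderiv (cpoly Q)"
      using arg_cong[OF W, of cpoly]
      by (simp add: of_int_poly_hom.hom_mult of_int_poly_hom.hom_minus of_int_hom.map_poly_pderiv)
    then obtain c where c: "cpoly P = smult c (cpoly Q)"
      using wronskian_eq_0_imp[of "cpoly P" "cpoly Q"] False by auto
    have "[:- \<beta>, 1:] ^ (8 * h) dvd cpoly Q" if "\<beta> \<in> ?Z - {c}" for \<beta>
    proof -
      have "[:- \<beta>, 1:] ^ (8 * h) dvd smult (c - \<beta>) (cpoly Q)"
        using dvd[of \<beta>] that by (simp add: c smult_diff_left)
      then show ?thesis by (rule dvd_smult_cancel) (use that in auto)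
    qed
    then show ?thesis using False PQ by (intro exI[of _ "cpoly Q"] exI[of _ c]) auto
  qed
  then obtain R c where R: "R \<noteq> 0" "degree R \<le> h * (4 * d + 2)"
    "\<And>\<beta>. \<beta> \<in> ?Z - {c} \<Longrightarrow> [:- \<beta>, 1:] ^ (8 * h) dvd R" by blast
  have "8 * h * card (?Z - {c}) \<le> h * (4 * d + 2)"
  proof (rule order.trans[OF mult_card_le_degree R(2)])
    show "finite (?Z - {c})" using fin by simp
  qed (use R in blast)+
  then have "h * (8 * card (?Z - {c})) \<le> h * (4 * d + 2)" by (simp only: mult_ac)
  then have "8 * card (?Z - {c}) \<le> 4 * d + 2" using h by (simp only: nat_mult_le_cancel1)
  moreover have "d - 1 \<le> card (?Z - {c})" using roots fin by (simp add: card_Diff_singleton_if)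
  ultimately show False using d by linarith
qed

section \<open>Sizes and denominators of Taylor coefficients\<close>

lemma norm_coeff_pcompose_shift_le:
  fixes G :: "complex poly"
  assumes "degree G \<le> N" "\<And>i. norm (coeff G i) \<le> C" "norm x \<le> 2"
  shows "norm (coeff (pcompose G [:x, 1:]) j) \<le> real (N + 1) * C * 4 ^ N"
proof -
  have C: "0 \<le> C" using assms(2)[of 0] norm_ge_zero order.trans by blast
  have "norm (coeff (pcompose G [:x, 1:]) j) \<le> (\<Sum>i\<le>N. norm (coeff G i * (of_nat (i choose j) * x ^ (i - j))))"
    unfolding coeff_pcompose_shift[OF assms(1)] by (rule norm_sum)
  also have "\<dots> \<le> (\<Sum>i\<le>N. C * (2 ^ N * 2 ^ N))"
  proof (rule sum_mono)
    fix i assume i: "i \<in> {..N}"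
    have "i choose j \<le> 2 ^ i" by (rule binomial_le_pow2)
    also have "\<dots> \<le> 2 ^ N" using i by (intro power_increasing) auto
    finally have "real (i choose j) \<le> real (2 ^ N)" by (rule of_nat_mono)
    moreover have "norm x ^ (i - j) \<le> 2 ^ N"
    proof -
      have "norm x ^ (i - j) \<le> 2 ^ (i - j)" using assms(3) by (intro power_mono) auto
      also have "(2 :: real) ^ (i - j) \<le> 2 ^ N" using i by (intro power_increasing) auto
      finally show ?thesis .
    qed
    ultimately show "norm (coeff G i * (of_nat (i choose j) * x ^ (i - j))) \<le> C * (2 ^ N * 2 ^ N)"
      unfolding norm_mult norm_power norm_of_nat using assms(2) C by (intro mult_mono) auto
  qed
  also have "(2 :: real) ^ N * 2 ^ N = 4 ^ N" by (subst power_mult_distrib[symmetric]) simp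
  finally show ?thesis by simp
qed

text \<open>The expansion at \<beta> has only terms of degree i \<ge> n, and re-expanding it at x
  gives each of them a factor (x - \<beta>)^(i-j). Expanding at \<beta> costs 4^N and re-expanding
  costs 2^N, besides one factor N + 1 each.\<close>

lemma norm_coeff_pcompose_near_root_le:
  fixes G :: "complex poly"
  assumes G: "degree G \<le> N" "\<And>i. norm (coeff G i) \<le> C" and dvd: "[:- \<beta>, 1:] ^ n dvd G"
    and \<beta>: "norm \<beta> \<le> 1" and x: "norm (x - \<beta>) \<le> \<tau>" "\<tau> \<le> 1" and j: "j \<le> n"
  shows "norm (coeff (pcompose G [:x, 1:]) j) \<le> (real (N + 1))\<^sup>2 * C * 8 ^ N * \<tau> ^ (n - j)"
proof -
  have C: "0 \<le> C" using G(2)[of 0] norm_ge_zero order.trans by blast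
  have \<tau>: "0 \<le> \<tau>" using x(1) norm_ge_zero order.trans by blast
  define H where "H = pcompose G [:\<beta>, 1:]"
  have "pcompose [:\<beta>, 1:] [:x - \<beta>, 1:] = [:x, 1:]" by (simp add: pcompose_pCons)
  then have GH: "pcompose G [:x, 1:] = pcompose H [:x - \<beta>, 1:]"
    by (simp add: H_def flip: pcompose_assoc)
  have degH: "degree H \<le> N" using G(1) by (simp add: H_def degree_pcompose)
  have H0: "coeff H i = 0" if "i < n" for i
    using dvd that unfolding linear_power_dvd_iff_coeff_pcompose H_def by blast
  have Hle: "norm (coeff H i) \<le> real (N + 1) * C * 4 ^ N" for i
    unfolding H_def using G \<beta> by (intro norm_coeff_pcompose_shift_le) auto
  have "norm (coeff (pcompose G [:x, 1:]) j) \<le> (\<Sum>i\<le>N. norm (coeff H i * (of_nat (i choose j) * (x - \<beta>) ^ (i - j))))"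
    unfolding GH coeff_pcompose_shift[OF degH] by (rule norm_sum)
  also have "\<dots> \<le> (\<Sum>i\<le>N. (real (N + 1) * C * 4 ^ N) * (2 ^ N * \<tau> ^ (n - j)))"
  proof (rule sum_mono)
    fix i assume i: "i \<in> {..N}"
    show "norm (coeff H i * (of_nat (i choose j) * (x - \<beta>) ^ (i - j))) \<le> (real (N + 1) * C * 4 ^ N) * (2 ^ N * \<tau> ^ (n - j))"
    proof (cases "i < n")
      case True
      then show ?thesis using C \<tau> by (simp add: H0)
    next
      case False
      have "i choose j \<le> 2 ^ i" by (rule binomial_le_pow2)
      also have "\<dots> \<le> 2 ^ N" using i by (intro power_increasing) auto
      finally have "real (i choose j) \<le> real (2 ^ N)" by (rule of_nat_mono)
      moreover have "norm (x - \<beta>) ^ (i - j) \<le> \<tau> ^ (i - j)" using x(1) by (intro power_mono) auto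
      moreover have "\<tau> ^ (i - j) \<le> \<tau> ^ (n - j)" using False x \<tau> by (intro power_decreasing) auto
      ultimately show ?thesis
        unfolding norm_mult norm_power norm_of_nat using Hle[of i] C \<tau> by (intro mult_mono) auto
    qed
  qed
  also have "\<dots> = (real (N + 1))\<^sup>2 * C * (4 ^ N * 2 ^ N) * \<tau> ^ (n - j)"
    by (simp add: power2_eq_square algebra_simps)
  also have "(4 :: real) ^ N * 2 ^ N = 8 ^ N" by (subst power_mult_distrib[symmetric]) simp
  finally show ?thesis .
qed

lemma power_mult_coeff_pcompose_Ints:
  fixes P :: "int poly"
  assumes "degree P \<le> N" "q \<noteq> 0"
  shows "of_nat q ^ N * coeff (pcompose (cpoly P) [:of_int p / of_nat q, 1:]) j \<in> \<int>"
proof -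
  have eq: "of_nat q ^ N * (coeff (cpoly P) i * (of_nat (i choose j) * (of_int p / of_nat q) ^ (i - j)))
      = of_int (int q ^ (N - (i - j)) * coeff P i * int (i choose j) * p ^ (i - j))" if "i \<le> N" for i
  proof -
    have "(of_nat q :: complex) ^ N = of_nat q ^ (N - (i - j)) * of_nat q ^ (i - j)"
      using that by (simp flip: power_add)
    then show ?thesis using assms(2) by (simp add: coeff_map_poly power_divide)
  qed
  have "degree (cpoly P) \<le> N" using assms(1) by simp
  then have "of_nat q ^ N * coeff (pcompose (cpoly P) [:of_int p / of_nat q, 1:]) j =
      (\<Sum>i\<le>N. of_nat q ^ N * (coeff (cpoly P) i * (of_nat (i choose j) * (of_int p / of_nat q) ^ (i - j))))"
    by (simp only: coeff_pcompose_shift sum_distrib_left)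
  also have "\<dots> = (\<Sum>i\<le>N. of_int (int q ^ (N - (i - j)) * coeff P i * int (i choose j) * p ^ (i - j)))"
    by (intro sum.cong refl eq) simp
  finally show ?thesis by (simp only: Ints_sum Ints_of_int)
qed

lemma abs_coeff_mult_le:
  fixes p q :: "int poly"
  assumes "degree p \<le> N" "\<And>i. \<bar>coeff p i\<bar> \<le> A" "\<And>i. \<bar>coeff q i\<bar> \<le> B"
  shows "\<bar>coeff (p * q) i\<bar> \<le> int (N + 1) * (A * B)"
proof -
  have AB: "0 \<le> A" "0 \<le> B" using assms(2,3)[of 0] by auto
  have "\<bar>coeff (p * q) i\<bar> \<le> (\<Sum>l\<le>i. \<bar>coeff p l * coeff q (i - l)\<bar>)"
    unfolding coeff_mult by (rule sum_abs)
  also have "\<dots> \<le> (\<Sum>l\<le>i. if l \<le> N then A * B else 0)"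
    using assms AB by (intro sum_mono) (auto simp: abs_mult coeff_eq_0 intro!: mult_mono)
  also have "\<dots> = (\<Sum>l\<in>{..i} \<inter> {..N}. A * B)"
    by (subst sum.inter_restrict) (auto intro: sum.cong)
  also have "\<dots> \<le> int (N + 1) * (A * B)"
  proof -
    have "card ({..i} \<inter> {..N}) \<le> card {..N}" by (intro card_mono) auto
    then have "int (card ({..i} \<inter> {..N})) \<le> int (N + 1)" by simp
    then show ?thesis using AB by (simp only: sum_constant) (intro mult_right_mono, auto)
  qed
  finally show ?thesis .
qed

lemma abs_coeff_pderiv_le:
  fixes p :: "int poly"
  assumes "degree p \<le> N" "\<And>i. \<bar>coeff p i\<bar> \<le> A"
  shows "\<bar>coeff (pderiv p) i\<bar> \<le> int (N + 1) * A"
proof (cases "Suc i \<le> N")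
  case True
  then show ?thesis using assms(2)[of "Suc i"] by (auto simp: coeff_pderiv abs_mult intro!: mult_mono)
next
  case False
  then have "coeff p (Suc i) = 0" using assms(1) by (intro coeff_eq_0) auto
  then show ?thesis using assms(2)[of 0] by (simp add: coeff_pderiv)
qed


text \<open>Otherwise (q1 X - p1)^(J+1) divides q2 P - p2 Q. Since q2 times the Wronskian of P and Q
  is the Wronskian of q2 P - p2 Q and Q, and differentiation lowers the order by one, (q1 X - p1)^J
  divides the fixed nonzero Wronskian. Its leading coefficient is then at least q1^J in absolute
  value, too large for the given bound.\<close>

lemma thue_coeff_nonzero:
  fixes P Q :: "int poly" and p1 p2 :: int and q1 q2 J :: nat
  assumes N: "degree P \<le> N" "degree Q \<le> N"
    and X: "\<And>i. \<bar>coeff P i\<bar> \<le> int X" "\<And>i. \<bar>coeff Q i\<bar> \<le> int X"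
    and W: "pderiv P * Q - P * pderiv Q \<noteq> 0"
    and q: "q1 > 0" "q2 > 0" "coprime p1 (int q1)"
    and big: "2 * (N + 1)\<^sup>2 * X\<^sup>2 < q1 ^ J"
  shows "\<exists>j\<le>J. coeff (pcompose (cpoly P - smult (of_int p2 / of_nat q2) (cpoly Q)) [:of_int p1 / of_nat q1, 1:]) j \<noteq> 0"
proof (rule ccontr)
  let ?l = "[:- p1, int q1:]"
  assume "\<not> ?thesis"
  then have "[:- (of_int p1 / of_int (int q1)), 1:] ^ Suc J dvd cpoly P - smult (of_int p2 / of_nat q2) (cpoly Q)"
    by (subst linear_power_dvd_iff_coeff_pcompose) (auto simp: less_Suc_eq_le)
  then have "[:- (of_int p1 / of_int (int q1)), 1:] ^ Suc J dvd
      smult (of_nat q2) (cpoly P - smult (of_int p2 / of_nat q2) (cpoly Q))"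
    by (rule dvd_smult)
  also have "smult (of_nat q2) (cpoly P - smult (of_int p2 / of_nat q2) (cpoly Q)) =
      cpoly (smult (int q2) P - smult p2 Q)"
    using q by (intro poly_eqI) (simp add: coeff_map_poly field_simps)
  finally have "?l ^ Suc J dvd smult (int q2) P - smult p2 Q"
    using q by (intro primitive_linear_power_dvd) auto
  then obtain r where r: "smult (int q2) P - smult p2 Q = ?l ^ Suc J * r" ..
  have "smult (int q2) (pderiv P * Q - P * pderiv Q) =
      pderiv (smult (int q2) P - smult p2 Q) * Q - (smult (int q2) P - smult p2 Q) * pderiv Q"
    by (simp add: pderiv_diff pderiv_smult algebra_simps smult_diff_right)
  also have "\<dots> = ?l ^ J * ((smult (of_nat (Suc J)) (pderiv ?l) * r + ?l * pderiv r) * Q - ?l * r * pderiv Q)"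
    unfolding r pderiv_mult pderiv_power_Suc by (simp only: power_Suc algebra_simps mult_smult_left mult_smult_right)
  finally have "?l ^ J dvd smult (int q2) (pderiv P * Q - P * pderiv Q)" by (rule dvdI)
  then have dv: "?l ^ J dvd pderiv P * Q - P * pderiv Q"
  proof (rule primitive_dvd_smult_cancel[rotated 2])
    show "content (?l ^ J) = 1" using q by (intro content_linear_power) simp_all
    show "int q2 \<noteq> 0" using q by simp
  qed
  have bd: "\<bar>coeff (pderiv P * Q - P * pderiv Q) i\<bar> \<le> int (2 * (N + 1)\<^sup>2 * X\<^sup>2)" for i
  proof -
    have "degree (pderiv P) \<le> N" using N by (simp add: degree_pderiv)
    then have "\<bar>coeff (pderiv P * Q) i\<bar> \<le> int (N + 1) * ((int (N + 1) * int X) * int X)"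
      using abs_coeff_pderiv_le[OF N(1) X(1)] X by (intro abs_coeff_mult_le) auto
    moreover have "\<bar>coeff (P * pderiv Q) i\<bar> \<le> int (N + 1) * (int X * (int (N + 1) * int X))"
      using abs_coeff_pderiv_le[OF N(2) X(2)] X N by (intro abs_coeff_mult_le) auto
    ultimately show ?thesis by (simp add: power2_eq_square algebra_simps)
  qed
  have "int q1 > 0" using q by simp
  then have "int q1 ^ J \<le> int (2 * (N + 1)\<^sup>2 * X\<^sup>2)"
    by (rule lead_coeff_dvd_bound[OF W dv _ bd])
  then have "int (q1 ^ J) \<le> int (2 * (N + 1)\<^sup>2 * X\<^sup>2)" by simp
  then show False using big by (simp only: of_nat_le_iff)
qed

text \<open>A nonzero rational number is at least the reciprocal of a denominator: q1^N clears the
  Taylor coefficients of P and Q, and q2 the multiplier p2/q2.\<close>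

lemma thue_coeff_lower_bound:
  fixes P Q :: "int poly" and p1 p2 :: int and q1 q2 :: nat
  assumes N: "degree P \<le> N" "degree Q \<le> N" and q: "q1 > 0" "q2 > 0"
    and nz: "coeff (pcompose (cpoly P - smult (of_int p2 / of_nat q2) (cpoly Q)) [:of_int p1 / of_nat q1, 1:]) j \<noteq> 0"
  shows "1 \<le> real q1 ^ N * real q2 *
    norm (coeff (pcompose (cpoly P - smult (of_int p2 / of_nat q2) (cpoly Q)) [:of_int p1 / of_nat q1, 1:]) j)"
proof -
  let ?T = "coeff (pcompose (cpoly P - smult (of_int p2 / of_nat q2) (cpoly Q)) [:of_int p1 / of_nat q1, 1:]) j"
  let ?c = "\<lambda>P. coeff (pcompose (cpoly P) [:of_int p1 / of_nat q1 :: complex, 1:]) j"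
  define z where "z = (of_nat q1 ^ N * of_nat q2) * ?T"
  have "z = of_nat q2 * (of_nat q1 ^ N * ?c P) - of_int p2 * (of_nat q1 ^ N * ?c Q)"
    using q by (simp add: z_def pcompose_diff pcompose_smult field_simps)
  moreover have "of_nat q1 ^ N * ?c P \<in> \<int>" "of_nat q1 ^ N * ?c Q \<in> \<int>"
    using power_mult_coeff_pcompose_Ints N q by auto
  ultimately have "z \<in> \<int>" by simp
  moreover have "z \<noteq> 0" using q nz by (simp add: z_def)
  ultimately have "1 \<le> norm z" by (metis Ints_cases norm_of_int_ge_1 of_int_0)
  also have "norm z = real q1 ^ N * real q2 * norm ?T" by (simp add: z_def norm_mult norm_power)
  finally show ?thesis .
qed

text \<open>
  The base \<open>64 (8A)\<^sup>2\<^sup>d\<close> collects the height of the auxiliary polynomials, the binomial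
  coefficients of their Taylor expansions and the height of the Wronskian.
\<close>

definition thue_base :: "nat \<Rightarrow> nat \<Rightarrow> nat" where
  "thue_base d A = 64 * (8 * A) ^ (2 * d)"

text \<open>With h chosen so that q2 is about q1^(8h), a nonzero Taylor coefficient \<open>T\<close>
  of P - (p2/q2) Q at p1/q1 of low order j is at least 1 / (q1^N q2). On the other hand P -
  \<alpha>Q vanishes to order 8h at \<alpha> and p2/q2 is close to \<alpha>, which makes
  \<open>T\<close> smaller than that by a factor of order q1^h. All other quantities are h-th powers
  up to constants in the exponent, so taking h-th roots bounds q1.\<close>

lemma thue_no_two_good_approximations:
  fixes f :: "int poly" and \<alpha> :: complex and K :: real and p1 p2 :: int and q1 q2 :: nat
  assumes d: "d \<ge> 3" "degree f = d" and roots: "card {\<beta>. poly (cpoly f) \<beta> = 0} = d"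
    and A: "\<And>i. \<bar>coeff f i\<bar> \<le> int A" "A \<ge> 1" and K: "K \<ge> 1"
    and \<alpha>: "poly (cpoly f) \<alpha> = 0" "norm \<alpha> \<le> 1"
    and q: "q1 > 0" "q2 > 0" "coprime p1 (int q1)"
    and big1: "real q1 > 2 * real (thue_base d A) ^ (8 * d * (4 * d + 3)) * K ^ 8"
    and big2: "q2 \<ge> q1 ^ (8 * (16 + 2 * d))"
    and app1: "norm (of_int p1 - \<alpha> * of_nat q1) \<le> K / real q1 ^ (d - 1)"
    and app2: "norm (of_int p2 - \<alpha> * of_nat q2) \<le> K / real q2 ^ (d - 1)"
  shows False
proof -
  define Z where "Z = thue_base d A"
  define b where "b = real q1"
  have Z1: "Z \<ge> 1" using A by (simp add: Z_def thue_base_def)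
  have Zr: "real Z \<ge> 1" using Z1 by simp
  have bigb: "b > 2 * real Z ^ (8 * d * (4 * d + 3)) * K ^ 8" using big1 by (simp add: b_def Z_def)
  have Zpow: "1 \<le> real Z ^ n" for n using Zr by (rule one_le_power)
  have Kpow: "1 \<le> K ^ n" for n using K by (rule one_le_power)
  have bZ: "b > real Z ^ (8 * d * (4 * d + 3))"
  proof -
    have "real Z ^ (8 * d * (4 * d + 3)) * 1 \<le> real Z ^ (8 * d * (4 * d + 3)) * (2 * K ^ 8)"
      using Kpow[of 8] by (intro mult_left_mono) auto
    then show ?thesis using bigb by simp
  qed
  have bZK: "b > real Z ^ (4 * d + 3) * (2 * K ^ 8)"
  proof -
    have "real Z ^ (4 * d + 3) * (2 * K ^ 8) \<le> real Z ^ (8 * d * (4 * d + 3)) * (2 * K ^ 8)"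
      using Zr Kpow[of 8] d by (intro mult_right_mono power_increasing) auto
    then show ?thesis using bigb by simp
  qed
  have b2: "b \<ge> 2"
  proof -
    have "1 * (2 * 1) \<le> real Z ^ (4 * d + 3) * (2 * K ^ 8)"
      using Zpow Kpow by (intro mult_mono) auto
    then show ?thesis using bZK by simp
  qed
  have bK: "b \<ge> K"
  proof -
    have "1 * (1 * K) \<le> real Z ^ (4 * d + 3) * (2 * K ^ 8)"
      using Zpow K self_le_power[of K 8] by (intro mult_mono) auto
    then show ?thesis using bZK by simp
  qed
  have q12: "q1 \<ge> 2" using b2 by (simp add: b_def)
  \<comment> \<open>The bound h \<ge> 16 pays for the rounding offset 8 in the exponent of q1, and h
    \<ge> 2d makes \<open>J\<close> positive.\<close>
  obtain h where h: "q1 ^ (8 * h) \<le> q2" "q2 < q1 ^ (8 * h + 8)" "h \<ge> 16 + 2 * d"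
  proof -
    have "2 \<le> q1 ^ 8" using q12 self_le_power[of q1 8] by linarith
    then obtain h where h: "(q1 ^ 8) ^ h \<le> q2" "q2 < (q1 ^ 8) ^ (h + 1)"
      using ex_power_ivl1[of "q1 ^ 8" q2] q by auto
    have 1: "q1 ^ (8 * h) \<le> q2" "q2 < q1 ^ (8 * h + 8)"
      using h by (simp_all only: power_mult[symmetric] distrib_left mult_1_right)
    have "q1 ^ (8 * (16 + 2 * d)) < q1 ^ (8 * h + 8)" using 1 big2 by linarith
    then have "8 * (16 + 2 * d) < 8 * h + 8" using q12 by (metis power_strict_increasing_iff Suc_1 Suc_le_lessD)
    then show thesis using 1 that by simp
  qed
  define N where "N = h * (4 * d + 2)"
  define M where "M = N + 1"
  define X where "X = (8 * A) ^ (2 * d * (N + 1))"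
  \<comment> \<open>\<open>J\<close> must be small, since order j costs d*j \<le> h/2 in the
    exponent of q1. It must also be large enough for q1^J to exceed the height Z^(2M) of the
    Wronskian. As h \<le> 4dJ and M \<le> h(4d + 3), the latter holds once q1 > Z^(8d(4d+3)), the
    source of that exponent in the hypothesis.\<close>
  define J where "J = h div (2 * d)"
  obtain P Q where PQ: "P \<noteq> 0 \<or> Q \<noteq> 0" "degree P \<le> N" "degree Q \<le> N"
    "\<And>i. \<bar>coeff P i\<bar> \<le> int X" "\<And>i. \<bar>coeff Q i\<bar> \<le> int X"
    and dvd: "\<And>\<beta>. poly (cpoly f) \<beta> = 0 \<Longrightarrow> [:- \<beta>, 1:] ^ (8 * h) dvd cpoly P - smult \<beta> (cpoly Q)"
    using thue_auxiliary_polynomials[OF d(2) _ A, of h] d unfolding N_def X_def by auto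
  have W: "pderiv P * Q - P * pderiv Q \<noteq> 0"
    using thue_wronskian_nonzero[OF d(1) roots _ PQ(1), of h] PQ dvd h unfolding N_def by auto
  have Mh: "M \<le> h * (4 * d + 3)" using h by (simp add: M_def N_def algebra_simps)
  have two_pow: "n \<le> 2 ^ n" for n :: nat using less_exp[of n] by simp
  have M1: "M \<ge> 1" by (simp add: M_def)
  have XZ: "64 ^ M * X = Z ^ M"
    by (simp only: Z_def thue_base_def X_def M_def power_mult_distrib power_mult)
  have J: "2 * (d * J) \<le> h" "h \<le> 4 * d * J"
  proof -
    have "2 * d * J \<le> h" by (simp add: J_def)
    then show "2 * (d * J) \<le> h" by (simp only: mult.assoc)
    have "1 \<le> J" using h d unfolding J_def by (subst less_eq_div_iff_mult_less_eq) auto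
    then have 1: "d \<le> d * J" by simp
    have "h < 2 * d * J + 2 * d"
      using d unfolding J_def by (metis dividend_less_times_div mult_pos_pos zero_less_numeral less_le_trans add.commute)
    then have "h < 2 * (d * J) + 2 * d" by (simp only: mult.assoc)
    with 1 have "h \<le> 4 * (d * J)" by linarith
    then show "h \<le> 4 * d * J" by (simp only: mult.assoc)
  qed
  have "2 * M\<^sup>2 * X\<^sup>2 < q1 ^ J"
  proof (rule ccontr)
    assume "\<not> ?thesis"
    then have "q1 ^ J \<le> 2 * M\<^sup>2 * X\<^sup>2" by simp
    also have "\<dots> \<le> (64 ^ M * X)\<^sup>2"
    proof -
      have "2 * M\<^sup>2 \<le> 2 ^ M * (2 ^ M)\<^sup>2"
        using M1 two_pow[of M] self_le_power[of "2::nat" M] by (intro mult_mono power_mono) auto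
      also have "\<dots> = 8 ^ M" by (simp add: power2_eq_square flip: power_mult_distrib)
      also have "\<dots> \<le> (64 ^ M)\<^sup>2" by (simp add: power2_eq_square power_mono flip: power_mult_distrib)
      finally have "2 * M\<^sup>2 * X\<^sup>2 \<le> (64 ^ M)\<^sup>2 * X\<^sup>2" by (rule mult_right_mono) simp
      then show ?thesis by (simp only: power_mult_distrib)
    qed
    also have "\<dots> = Z ^ (2 * M)" unfolding XZ by (simp only: power_mult[symmetric] mult.commute)
    finally have qJ: "q1 ^ J \<le> Z ^ (2 * M)" .
    have "q1 ^ h \<le> q1 ^ (J * (4 * d))" using J q12 by (intro power_increasing) (auto simp: mult_ac)
    also have "\<dots> = (q1 ^ J) ^ (4 * d)" by (rule power_mult)
    also have "\<dots> \<le> (Z ^ (2 * M)) ^ (4 * d)" using qJ by (rule power_mono) simp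
    also have "\<dots> = Z ^ (8 * d * M)"
    proof -
      have "2 * M * (4 * d) = 8 * d * M" by simp
      then show ?thesis by (simp only: power_mult[symmetric])
    qed
    also have "\<dots> \<le> Z ^ (8 * d * (h * (4 * d + 3)))"
      using Z1 Mh by (intro power_increasing mult_le_mono2) auto
    also have "\<dots> = (Z ^ (8 * d * (4 * d + 3))) ^ h" by (simp only: power_mult[symmetric] mult_ac)
    finally have "q1 \<le> Z ^ (8 * d * (4 * d + 3))"
      using h by (metis power_mono_iff zero_le add_gr_0 less_le_trans zero_less_numeral)
    then have "real q1 \<le> real (Z ^ (8 * d * (4 * d + 3)))" by (rule of_nat_mono)
    then show False using bZ by (simp add: b_def)
  qed
  then obtain j where j: "j \<le> J" and
    nz: "coeff (pcompose (cpoly P - smult (of_int p2 / of_nat q2) (cpoly Q)) [:of_int p1 / of_nat q1, 1:]) j \<noteq> 0"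
    using thue_coeff_nonzero[OF PQ(2-5) W q(1,2,3), of J p2] unfolding M_def by auto
  define x1 x2 :: complex where "x1 = of_int p1 / of_nat q1" and "x2 = of_int p2 / of_nat q2"
  define G where "G = cpoly P - smult \<alpha> (cpoly Q)"
  define T where "T = coeff (pcompose (cpoly P - smult x2 (cpoly Q)) [:x1, 1:]) j"
  define \<tau>1 where "\<tau>1 = K / b ^ d"
  define \<tau>2 where "\<tau>2 = K / real q2 ^ d"
  have dist: "norm (of_int p / of_nat q - \<alpha>) \<le> K / real q ^ d"
    if "norm (of_int p - \<alpha> * of_nat q) \<le> K / real q ^ (d - 1)" "q > 0" for p q
  proof -
    have "of_int p / of_nat q - \<alpha> = (of_int p - \<alpha> * of_nat q) / of_nat q"
      using that by (simp add: field_simps)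
    then have "norm (of_int p / of_nat q - \<alpha>) = norm (of_int p - \<alpha> * of_nat q) / real q"
      by (simp add: norm_divide)
    also have "\<dots> \<le> K / real q ^ (d - 1) / real q" using that by (intro divide_right_mono) auto
    also have "\<dots> = K / real q ^ d" using d by (cases d) simp_all
    finally show ?thesis .
  qed
  have \<tau>: "norm (x1 - \<alpha>) \<le> \<tau>1" "norm (x2 - \<alpha>) \<le> \<tau>2"
    using dist[OF app1 q(1)] dist[OF app2 q(2)] by (simp_all add: x1_def x2_def \<tau>1_def \<tau>2_def b_def)
  have \<tau>1: "\<tau>1 \<le> 1" "0 \<le> \<tau>1" and \<tau>2: "0 \<le> \<tau>2"
  proof -
    have "b \<le> b ^ d" using b2 d by (intro self_le_power) auto
    then show "\<tau>1 \<le> 1" using bK b2 by (simp add: \<tau>1_def divide_le_eq)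
    show "0 \<le> \<tau>1" "0 \<le> \<tau>2" using K b2 by (simp_all add: \<tau>1_def \<tau>2_def)
  qed
  have x1: "norm x1 \<le> 2"
    using norm_triangle_ineq[of "x1 - \<alpha>" \<alpha>] \<tau>(1) \<tau>1(1) \<alpha>(2) by simp
  have jn: "j \<le> 8 * h"
  proof -
    have "J \<le> h" by (simp add: J_def)
    then show ?thesis using j by simp
  qed
  \<comment> \<open>The substitution P - x2 Q = (P - \<alpha>Q) - (x2 - \<alpha>) Q separates the
    two sources of smallness: closeness of x1 and closeness of x2 to \<alpha>.\<close>
  have "T = coeff (pcompose G [:x1, 1:]) j - (x2 - \<alpha>) * coeff (pcompose (cpoly Q) [:x1, 1:]) j"
    by (simp add: T_def G_def pcompose_diff pcompose_smult algebra_simps)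
  then have "norm T \<le> norm (coeff (pcompose G [:x1, 1:]) j) + norm (x2 - \<alpha>) * norm (coeff (pcompose (cpoly Q) [:x1, 1:]) j)"
    by (metis norm_mult norm_triangle_ineq4)
  also have "\<dots> \<le> (real M)\<^sup>2 * (2 * real X) * 8 ^ N * \<tau>1 ^ (8 * h - j) + \<tau>2 * (real M * real X * 4 ^ N)"
  proof (intro add_mono mult_mono)
    have cle: "norm (coeff (cpoly R) i) \<le> real X" if "\<bar>coeff R i\<bar> \<le> int X" for R i
    proof -
      have "norm (coeff (cpoly R) i) = real_of_int \<bar>coeff R i\<bar>" by (simp add: coeff_map_poly)
      then show ?thesis using that by linarith
    qed
    show "norm (coeff (pcompose G [:x1, 1:]) j) \<le> (real M)\<^sup>2 * (2 * real X) * 8 ^ N * \<tau>1 ^ (8 * h - j)"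
      unfolding M_def
    proof (rule norm_coeff_pcompose_near_root_le)
      show "degree G \<le> N"
        using PQ unfolding G_def by (intro degree_diff_le) (auto intro: order_trans[OF degree_smult_le])
      show "norm (coeff G i) \<le> 2 * real X" for i
      proof -
        have "norm (coeff G i) \<le> norm (coeff (cpoly P) i) + norm \<alpha> * norm (coeff (cpoly Q) i)"
          unfolding G_def coeff_diff coeff_smult by (metis norm_mult norm_triangle_ineq4)
        also have "\<dots> \<le> real X + 1 * real X"
          using cle[OF PQ(4)] cle[OF PQ(5)] \<alpha> by (intro add_mono mult_mono) auto
        finally show ?thesis by simp
      qed
      show "[:- \<alpha>, 1:] ^ (8 * h) dvd G" unfolding G_def using \<alpha> by (intro dvd)
    qed (use \<alpha> \<tau> \<tau>1 jn in auto)
    show "norm (coeff (pcompose (cpoly Q) [:x1, 1:]) j) \<le> real M * real X * 4 ^ N"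
      unfolding M_def using PQ x1 cle[OF PQ(5)] by (intro norm_coeff_pcompose_shift_le) auto
  qed (use \<tau> \<tau>2 in auto)
  also have "\<dots> \<le> real Z ^ M * \<tau>1 ^ (8 * h - j) + \<tau>2 * real Z ^ M"
  proof (intro add_mono mult_right_mono mult_left_mono)
    have Mr: "real M \<le> 2 ^ M" using two_pow[of M] by (metis of_nat_le_iff of_nat_numeral of_nat_power)
    have ZM: "real Z ^ M = 64 ^ M * real X" using XZ by (metis of_nat_mult of_nat_numeral of_nat_power)
    have "(real M)\<^sup>2 * (2 * real X) * 8 ^ N \<le> (2 ^ M)\<^sup>2 * (2 ^ M * real X) * 8 ^ M"
      using Mr M1 self_le_power[of "2::real" M] by (intro mult_mono power_mono power_increasing) (auto simp: M_def)
    also have "\<dots> = ((2 * 2 * 2 * 8) ^ M) * real X" by (simp only: power_mult_distrib power2_eq_square mult_ac)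
    also have "\<dots> = real Z ^ M" by (simp add: ZM)
    finally show "(real M)\<^sup>2 * (2 * real X) * 8 ^ N \<le> real Z ^ M" .
    have "real M * real X * 4 ^ N \<le> 2 ^ M * real X * 4 ^ M"
      using Mr by (intro mult_mono power_increasing) (auto simp: M_def)
    also have "\<dots> = (2 * 4) ^ M * real X" by (simp only: power_mult_distrib mult_ac)
    also have "\<dots> \<le> 64 ^ M * real X" by (intro mult_right_mono power_mono) auto
    finally show "real M * real X * 4 ^ N \<le> real Z ^ M" by (simp only: ZM)
  qed (use \<tau>1 \<tau>2 in auto)
  finally have Tle: "norm T \<le> real Z ^ M * (\<tau>1 ^ (8 * h - j) + \<tau>2)" by (simp add: algebra_simps)
  have one: "1 \<le> b ^ N * real q2 * norm T"
    unfolding T_def b_def x1_def x2_def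
    using thue_coeff_lower_bound[OF PQ(2,3) q(1,2) nz] .
  have dh: "3 * h \<le> d * h" using d by simp
  have N4: "N = 4 * (d * h) + 2 * h" by (simp add: N_def algebra_simps)
  have dj: "2 * (d * j) \<le> h" using J(1) j by (meson mult_le_mono2 order_trans)
  have q2r: "real q2 \<le> b ^ (8 * h + 8)" "b ^ (8 * h) \<le> real q2"
    using h(1,2) unfolding b_def by (metis less_imp_le of_nat_le_iff of_nat_power)+
  \<comment> \<open>Exponents of b: 4dh + 11h + 8 is needed, and d(8h - j) \<ge> 8dh - h/2 is
    available. For d = 3 these compare as required exactly from h = 16 on.\<close>
  have A: "b ^ N * real q2 * \<tau>1 ^ (8 * h - j) \<le> K ^ (8 * h) / b ^ h"
  proof -
    have "b ^ N * real q2 * \<tau>1 ^ (8 * h - j) \<le> b ^ N * b ^ (8 * h + 8) * \<tau>1 ^ (8 * h - j)"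
      using q2r b2 \<tau>1 by (intro mult_right_mono mult_left_mono) auto
    also have "\<dots> = b ^ (N + (8 * h + 8)) * (K ^ (8 * h - j) / b ^ (d * (8 * h - j)))"
      by (simp only: \<tau>1_def power_divide power_add power_mult)
    also have "\<dots> \<le> b ^ (N + (8 * h + 8)) * (K ^ (8 * h) / b ^ (N + (8 * h + 8) + h))"
    proof (intro mult_left_mono frac_le)
      show "K ^ (8 * h - j) \<le> K ^ (8 * h)" using K by (intro power_increasing) auto
      have "N + (8 * h + 8) + h \<le> d * (8 * h - j)"
      proof -
        have "d * (8 * h - j) = 8 * (d * h) - d * j" by (simp add: diff_mult_distrib2)
        then show ?thesis using dh dj h(3) N4 by linarith
      qed
      then show "b ^ (N + (8 * h + 8) + h) \<le> b ^ (d * (8 * h - j))" using b2 by (intro power_increasing) auto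
    qed (use K b2 in auto)
    also have "\<dots> = K ^ (8 * h) / b ^ h"
      unfolding power_add[of b "N + (8 * h + 8)" h] using b2 by simp
    finally show ?thesis .
  qed
  \<comment> \<open>Here N + h = 4dh + 3h must not exceed 8h(d - 1), that is, 11 \<le> 4d.\<close>
  have B: "b ^ N * real q2 * \<tau>2 \<le> K ^ (8 * h) / b ^ h"
  proof -
    have "b ^ N * real q2 * \<tau>2 = b ^ N * (K / real q2 ^ (d - 1))"
      using d q by (cases d) (simp_all add: \<tau>2_def)
    also have "\<dots> \<le> b ^ N * (K ^ (8 * h) / b ^ (N + h))"
    proof (intro mult_left_mono frac_le)
      show "K \<le> K ^ (8 * h)" using K h by (intro self_le_power) auto
      have "N + h \<le> 8 * h * (d - 1)"
      proof -
        have "8 * h * (d - 1) = 8 * (d * h) - 8 * h"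
          by (simp add: diff_mult_distrib2 mult.assoc mult.commute[of h])
        then show ?thesis using dh N4 by linarith
      qed
      then have "b ^ (N + h) \<le> b ^ (8 * h * (d - 1))" using b2 by (intro power_increasing) auto
      also have "\<dots> = (b ^ (8 * h)) ^ (d - 1)" by (rule power_mult)
      also have "\<dots> \<le> real q2 ^ (d - 1)" using q2r b2 by (intro power_mono) simp_all
      finally show "b ^ (N + h) \<le> real q2 ^ (d - 1)" .
    qed (use K b2 in auto)
    also have "\<dots> = K ^ (8 * h) / b ^ h"
      unfolding power_add[of b N h] using b2 by simp
    finally show ?thesis .
  qed
  have "b ^ N * real q2 * norm T \<le> b ^ N * real q2 * (real Z ^ M * (\<tau>1 ^ (8 * h - j) + \<tau>2))"
    by (rule mult_left_mono[OF Tle]) (use b2 in simp)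
  with one have "1 \<le> b ^ N * real q2 * (real Z ^ M * (\<tau>1 ^ (8 * h - j) + \<tau>2))" by (rule order_trans)
  also have "\<dots> = real Z ^ M * (b ^ N * real q2 * \<tau>1 ^ (8 * h - j) + b ^ N * real q2 * \<tau>2)"
    by (simp add: algebra_simps)
  also have "\<dots> \<le> real Z ^ M * (K ^ (8 * h) / b ^ h + K ^ (8 * h) / b ^ h)"
    using A B by (intro mult_left_mono add_mono) auto
  finally have "b ^ h \<le> real Z ^ M * (2 * K ^ (8 * h))"
    using b2 by (simp add: field_simps)
  also have "\<dots> \<le> real Z ^ (h * (4 * d + 3)) * (2 ^ h * K ^ (8 * h))"
    using Zr Mh K h(3) self_le_power[of "2::real" h] by (intro mult_mono power_increasing) auto
  also have "\<dots> = (real Z ^ (4 * d + 3) * (2 * K ^ 8)) ^ h"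
    by (simp only: power_mult_distrib power_mult[symmetric] mult.commute[of h])
  finally have le: "b ^ h \<le> (real Z ^ (4 * d + 3) * (2 * K ^ 8)) ^ h" .
  obtain n where "h = Suc n" using h(3) by (cases h) auto
  then have "b ^ Suc n \<le> (real Z ^ (4 * d + 3) * (2 * K ^ 8)) ^ Suc n" using le by simp
  then have "b \<le> real Z ^ (4 * d + 3) * (2 * K ^ 8)"
    by (rule power_le_imp_le_base) (use K Zr in simp)
  then show False using bZK by simp
qed

section \<open>Counting rational approximations\<close>

lemma card_separated_reals_le:
  fixes R :: "real set"
  assumes sep: "\<And>r s. r \<in> R \<Longrightarrow> s \<in> R \<Longrightarrow> r \<noteq> s \<Longrightarrow> \<delta> \<le> \<bar>r - s\<bar>" and \<delta>: "\<delta> > 0"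
    and R: "R \<subseteq> {c - w..c + w}" and w: "w \<ge> 0"
  shows "finite R \<and> real (card R) \<le> 1 + 2 * w / \<delta>"
proof -
  define g where "g r = nat \<lfloor>(r - (c - w)) / \<delta>\<rfloor>" for r
  have nonneg: "0 \<le> (r - (c - w)) / \<delta>" if "r \<in> R" for r using that R \<delta> by auto
  have "inj_on g R"
  proof (rule inj_onI, rule ccontr)
    fix r s assume rs: "r \<in> R" "s \<in> R" "g r = g s" "r \<noteq> s"
    then have "\<lfloor>(r - (c - w)) / \<delta>\<rfloor> = \<lfloor>(s - (c - w)) / \<delta>\<rfloor>"
      using nonneg by (simp add: g_def eq_nat_nat_iff)
    then have "\<bar>(r - (c - w)) / \<delta> - (s - (c - w)) / \<delta>\<bar> < 1" by linarith
    then have "\<bar>r - s\<bar> / \<delta> < 1"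
      using \<delta> by (simp add: diff_divide_distrib[symmetric] abs_divide)
    then show False using sep[of r s] rs \<delta> by (simp add: divide_less_eq)
  qed
  moreover have sub: "g ` R \<subseteq> {..nat \<lfloor>2 * w / \<delta>\<rfloor>}"
  proof
    fix y assume "y \<in> g ` R"
    then obtain r where r: "r \<in> R" "y = g r" by blast
    then have "(r - (c - w)) / \<delta> \<le> 2 * w / \<delta>" using R \<delta> by (intro divide_right_mono) auto
    then show "y \<in> {..nat \<lfloor>2 * w / \<delta>\<rfloor>}" unfolding r g_def by (auto intro: nat_mono floor_mono)
  qed
  ultimately have fin: "finite R"
    by (auto intro: inj_on_finite)
  have "card R \<le> card {..nat \<lfloor>2 * w / \<delta>\<rfloor>}"
    using \<open>inj_on g R\<close> sub by (rule card_inj_on_le) simp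
  then have "real (card R) \<le> 1 + real (nat \<lfloor>2 * w / \<delta>\<rfloor>)" by simp
  also have "real (nat \<lfloor>2 * w / \<delta>\<rfloor>) = of_int \<lfloor>2 * w / \<delta>\<rfloor>" using w \<delta> by simp
  also have "\<dots> \<le> 2 * w / \<delta>" by (rule of_int_floor_le)
  finally show ?thesis using fin by simp
qed

text \<open>The primitive lattice points of a cusp up to sign. The root is complex, so real and
  nonreal roots need no separate treatment; coprimality makes distinct pairs distinct
  fractions.\<close>

definition approximations :: "nat \<Rightarrow> complex \<Rightarrow> real \<Rightarrow> (int \<times> nat) set" where
  "approximations d \<alpha> \<kappa> =
     {(p, q). 0 < q \<and> coprime p (int q) \<and> norm (of_int p - \<alpha> * of_nat q) \<le> \<kappa> / real q ^ (d - 1)}"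

lemma approximations_mono: "\<kappa> \<le> K \<Longrightarrow> approximations d \<alpha> \<kappa> \<subseteq> approximations d \<alpha> K"
  by (auto simp: approximations_def elim!: order_trans intro!: divide_right_mono)

lemma primitive_cross_ne:
  fixes p p' :: int and q q' :: nat
  assumes "coprime p (int q)" "coprime p' (int q')" "q > 0" "q' > 0" "(p, q) \<noteq> (p', q')"
  shows "p * int q' - p' * int q \<noteq> 0"
proof
  assume eq: "p * int q' - p' * int q = 0"
  then have e: "p * int q' = p' * int q" by simp
  then have "int q dvd p * int q'" by simp
  then have "int q dvd int q'" using assms(1) by (metis coprime_commute coprime_dvd_mult_right_iff)
  moreover have "int q' dvd p' * int q" using e by (metis dvd_triv_right)
  then have "int q' dvd int q" using assms(2) by (metis coprime_commute coprime_dvd_mult_right_iff)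
  ultimately have "q = q'" by (simp add: dvd_antisym)
  then show False using e assms by simp
qed

text \<open>Distinct fractions with denominators below 2T differ by at least 1 / (4T^2), and all lie
  within \<kappa> / T^d of the real part of \<alpha>. The number of cells of that length is the area
  term, and the summand 1 is the unavoidable boundary cell.\<close>

lemma card_approximations_shell_le:
  fixes T \<kappa> :: real and \<alpha> :: complex
  assumes d: "d \<ge> 2" and T: "T > 0" and \<kappa>: "\<kappa> \<ge> 0"
  defines "S \<equiv> {x \<in> approximations d \<alpha> \<kappa>. T \<le> real (snd x) \<and> real (snd x) < 2 * T}"
  shows "finite S \<and> real (card S) \<le> 1 + 8 * \<kappa> / T ^ (d - 2)"
proof -
  define g where "g = (\<lambda>(p, q). of_int p / real q :: real)"
  define w where "w = \<kappa> / T ^ d"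
  define \<delta> where "\<delta> = 1 / (4 * T\<^sup>2)"
  have sep: "\<delta> \<le> \<bar>g x - g y\<bar>" if xy: "x \<in> S" "y \<in> S" "x \<noteq> y" for x y
  proof -
    obtain p q p' q' where x: "x = (p, q)" "y = (p', q')" by (cases x, cases y) auto
    have q: "q > 0" "q' > 0" "coprime p (int q)" "coprime p' (int q')" "real q < 2 * T" "real q' < 2 * T"
      using xy by (auto simp: x S_def approximations_def)
    have "1 \<le> \<bar>p * int q' - p' * int q\<bar>"
      using primitive_cross_ne[of p q p' q'] q xy(3) x by (simp add: int_one_le_iff_zero_less)
    then have "real_of_int 1 \<le> of_int \<bar>p * int q' - p' * int q\<bar>" by (simp only: of_int_le_iff)
    then have cross: "1 \<le> \<bar>of_int p * real q' - of_int p' * real q\<bar>" by simp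
    have "real q * real q' \<le> (2 * T) * (2 * T)" using q T by (intro mult_mono) auto
    then have "\<delta> \<le> 1 / (real q * real q')"
      using q T unfolding \<delta>_def by (intro divide_left_mono) (auto simp: power2_eq_square)
    also have "\<dots> \<le> \<bar>of_int p * real q' - of_int p' * real q\<bar> / (real q * real q')"
      using cross q by (intro divide_right_mono) auto
    also have "\<dots> = \<bar>(of_int p * real q' - of_int p' * real q) / (real q * real q')\<bar>"
      using q by (simp add: abs_divide)
    also have "(of_int p * real q' - of_int p' * real q) / (real q * real q') = g x - g y"
      using q by (simp add: x g_def field_simps)
    finally show ?thesis .
  qed
  have \<delta>: "\<delta> > 0" using T by (simp add: \<delta>_def)
  have "inj_on g S" using sep \<delta> by (intro inj_onI) force
  moreover have "finite (g ` S) \<and> real (card (g ` S)) \<le> 1 + 2 * w / \<delta>"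
  proof (rule card_separated_reals_le[where c = "Re \<alpha>"])
    show "\<delta> \<le> \<bar>r - s\<bar>" if "r \<in> g ` S" "s \<in> g ` S" "r \<noteq> s" for r s using that sep by blast
    show "w \<ge> 0" using \<kappa> T by (simp add: w_def)
    show "g ` S \<subseteq> {Re \<alpha> - w..Re \<alpha> + w}"
    proof
      fix y assume "y \<in> g ` S"
      then obtain p q where y: "y = of_int p / real q" and S: "(p, q) \<in> S" by (auto simp: g_def)
      then have q: "q > 0" "T \<le> real q" "norm (of_int p - \<alpha> * of_nat q) \<le> \<kappa> / real q ^ (d - 1)"
        by (auto simp: S_def approximations_def)
      have "\<bar>of_int p - Re \<alpha> * real q\<bar> \<le> \<kappa> / real q ^ (d - 1)"
        using abs_Re_le_cmod[of "of_int p - \<alpha> * of_nat q"] q(3) by simp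
      then have "\<bar>of_int p - Re \<alpha> * real q\<bar> / real q \<le> \<kappa> / real q ^ (d - 1) / real q"
        by (rule divide_right_mono) simp
      also have "\<kappa> / real q ^ (d - 1) / real q = \<kappa> / real q ^ d" using d by (cases d) simp_all
      also have "\<dots> \<le> w" unfolding w_def using q T \<kappa> by (intro divide_left_mono power_mono) auto
      also have "\<bar>of_int p - Re \<alpha> * real q\<bar> / real q = \<bar>y - Re \<alpha>\<bar>"
      proof -
        have "y - Re \<alpha> = (of_int p - Re \<alpha> * real q) / real q" using q by (simp add: y field_simps)
        then show ?thesis by (simp add: abs_divide)
      qed
      finally show "y \<in> {Re \<alpha> - w..Re \<alpha> + w}" by auto
    qed
  qed (rule \<delta>)
  moreover have "2 * w / \<delta> = 8 * \<kappa> / T ^ (d - 2)"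
  proof -
    obtain e where "d = Suc (Suc e)" using d by (metis add_2_eq_Suc le_Suc_ex)
    then show ?thesis using T by (simp add: w_def \<delta>_def power2_eq_square)
  qed
  ultimately show ?thesis by (metis card_image finite_imageD)
qed

text \<open>For d \<ge> 3 the area terms of successive shells decrease at least geometrically with
  ratio 1/2; \<open>2 - 2 / 2 ^ n\<close> is the partial sum of that series. The boundary cells add
  up to \<open>n\<close>.\<close>

lemma card_approximations_dyadic_le:
  fixes T \<kappa> :: real and \<alpha> :: complex
  assumes d: "d \<ge> 3" and T: "T > 0" and \<kappa>: "\<kappa> \<ge> 0"
  shows "finite {x \<in> approximations d \<alpha> \<kappa>. T \<le> real (snd x) \<and> real (snd x) < 2 ^ n * T}
    \<and> real (card {x \<in> approximations d \<alpha> \<kappa>. T \<le> real (snd x) \<and> real (snd x) < 2 ^ n * T})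
      \<le> real n + 8 * \<kappa> / T ^ (d - 2) * (2 - 2 / 2 ^ n)"
proof (induction n)
  case 0
  have "{x \<in> approximations d \<alpha> \<kappa>. T \<le> real (snd x) \<and> real (snd x) < 2 ^ 0 * T} = {}" by auto
  then show ?case by (simp only: card.empty finite.emptyI) simp
next
  case (Suc n)
  define A B where "A = {x \<in> approximations d \<alpha> \<kappa>. T \<le> real (snd x) \<and> real (snd x) < 2 ^ n * T}"
    and "B = {x \<in> approximations d \<alpha> \<kappa>. 2 ^ n * T \<le> real (snd x) \<and> real (snd x) < 2 * (2 ^ n * T)}"
  define C where "C = {x \<in> approximations d \<alpha> \<kappa>. T \<le> real (snd x) \<and> real (snd x) < 2 ^ Suc n * T}"
  define c where "c = 8 * \<kappa> / T ^ (d - 2)"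
  have sub: "C \<subseteq> A \<union> B" by (auto simp: A_def B_def C_def)
  have B: "finite B" "real (card B) \<le> 1 + 8 * \<kappa> / (2 ^ n * T) ^ (d - 2)"
    using card_approximations_shell_le[of d "2 ^ n * T" \<kappa> \<alpha>] d T \<kappa> by (auto simp: B_def)
  have shell: "8 * \<kappa> / (2 ^ n * T) ^ (d - 2) \<le> c * (1 / 2 ^ n)"
  proof -
    have "(2 :: real) ^ n \<le> (2 ^ n) ^ (d - 2)" using d by (intro self_le_power) auto
    then have "8 * \<kappa> / ((2 ^ n) ^ (d - 2) * T ^ (d - 2)) \<le> 8 * \<kappa> / (2 ^ n * T ^ (d - 2))"
      using \<kappa> T by (intro divide_left_mono mult_right_mono) auto
    then show ?thesis by (simp add: c_def power_mult_distrib mult.commute)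
  qed
  have A: "finite A" "real (card A) \<le> real n + c * (2 - 2 / 2 ^ n)"
    using Suc.IH by (auto simp: A_def c_def)
  have "card C \<le> card A + card B"
    using order_trans[OF card_mono[OF _ sub] card_Un_le] A B by simp
  then have "real (card C) \<le> real (card A) + real (card B)" by linarith
  also have "\<dots> \<le> (real n + c * (2 - 2 / 2 ^ n)) + (1 + c * (1 / 2 ^ n))"
    using A(2) B(2) shell by linarith
  also have "\<dots> = real (Suc n) + c * (2 - 2 / 2 ^ n + 1 / 2 ^ n)"
    by (simp only: of_nat_Suc distrib_left add_ac)
  also have "2 - 2 / 2 ^ n + 1 / 2 ^ n = (2 - 2 / 2 ^ Suc n :: real)" by (simp add: field_simps)
  finally have "real (card C) \<le> real (Suc n) + c * (2 - 2 / 2 ^ Suc n)" .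
  moreover have "finite C" using finite_subset[OF sub] A B by simp
  ultimately show ?case by (simp only: C_def c_def)
qed

section \<open>The gap principle and the number of large approximations\<close>

lemma gap_Min_Max:
  fixes T :: "nat set"
  assumes "finite T" "T \<noteq> {}" "\<And>q q'. q \<in> T \<Longrightarrow> q' \<in> T \<Longrightarrow> q < q' \<Longrightarrow> q ^ 3 \<le> q'\<^sup>2"
  shows "Min T ^ (3 ^ (card T - 1)) \<le> Max T ^ (2 ^ (card T - 1))"
  using assms
proof (induction T rule: finite_linorder_max_induct)
  case (insert m T)
  show ?case
  proof (cases "T = {}")
    case False
    have IH: "Min T ^ (3 ^ (card T - 1)) \<le> Max T ^ (2 ^ (card T - 1))"
      using insert False by auto
    have mm: "Min (insert m T) = Min T" "Max (insert m T) = m"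
    proof -
      have "Min T < m" "Max T < m" using insert False by auto
      then show "Min (insert m T) = Min T" "Max (insert m T) = m" using insert False by simp_all
    qed
    have c: "card T = Suc (card T - 1)" using insert False by (simp add: card_gt_0_iff)
    have "m \<notin> T" using insert by auto
    then have c': "card (insert m T) - 1 = Suc (card T - 1)" using insert c by simp
    have gap: "Max T ^ 3 \<le> m\<^sup>2" using insert False by (intro insert.prems(2)) auto
    have "Min T ^ (3 ^ Suc (card T - 1)) = (Min T ^ (3 ^ (card T - 1))) ^ 3"
      by (simp only: power_Suc2 power_mult)
    also have "\<dots> \<le> (Max T ^ (2 ^ (card T - 1))) ^ 3" using IH by (rule power_mono) simp
    also have "\<dots> = (Max T ^ 3) ^ (2 ^ (card T - 1))" by (simp only: power_mult[symmetric] mult.commute)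
    also have "\<dots> \<le> (m\<^sup>2) ^ (2 ^ (card T - 1))" using gap by (rule power_mono) simp
    also have "\<dots> = m ^ (2 ^ Suc (card T - 1))" by (simp only: power_Suc power_mult)
    finally show ?thesis unfolding mm c' .
  qed simp
qed simp

text \<open>Among k elements the gap q' \<ge> q^(3/2) makes the largest at least the smallest to the
  power (3/2)^(k-1). This contradicts \<open>bound\<close> as soon as that exponent reaches
  \<open>E\<close>. Clearing the exponents to integer powers of 3 and 2 keeps everything in the
  natural numbers.\<close>

lemma card_gap_le:
  fixes T :: "nat set"
  assumes gap: "\<And>q q'. q \<in> T \<Longrightarrow> q' \<in> T \<Longrightarrow> q < q' \<Longrightarrow> q ^ 3 \<le> q'\<^sup>2"
    and bound: "\<And>q q'. q \<in> T \<Longrightarrow> q' \<in> T \<Longrightarrow> q' < q ^ E" and E: "E * 2 ^ n \<le> 3 ^ n"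
    and T: "\<And>q. q \<in> T \<Longrightarrow> q \<ge> 1"
  shows "finite T \<and> card T \<le> n"
proof (rule ccontr)
  assume "\<not> (finite T \<and> card T \<le> n)"
  then obtain U where U: "U \<subseteq> T" "card U = Suc n" "finite U"
    by (metis infinite_arbitrarily_large not_less_eq_eq obtain_subset_with_card_n)
  then have ne: "U \<noteq> {}" by auto
  have "Min U \<in> T" "Max U \<in> T" using Min_in[OF U(3) ne] Max_in[OF U(3) ne] U(1) by blast+
  then have "Max U < Min U ^ E" "Min U \<ge> 1" using bound T by auto
  then have "Max U ^ (2 ^ n) < (Min U ^ E) ^ (2 ^ n)" by (intro power_strict_mono) auto
  also have "\<dots> = Min U ^ (E * 2 ^ n)" by (simp only: power_mult)
  also have "\<dots> \<le> Min U ^ (3 ^ n)" using E \<open>Min U \<ge> 1\<close> by (intro power_increasing) auto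
  also have "\<dots> \<le> Max U ^ (2 ^ n)"
    using gap_Min_Max[OF U(3) ne] gap U by (auto simp: subset_iff)
  finally show False by simp
qed

text \<open>The power of \<open>thue_base\<close> makes q1^J exceed the height of the Wronskian; the
  factor 2 K^8 comes from the h-th root of the constants in the final comparison of Thue's
  argument.\<close>

definition thue_threshold :: "nat \<Rightarrow> nat \<Rightarrow> real \<Rightarrow> real" where
  "thue_threshold d A K = 2 * real (thue_base d A) ^ (8 * d * (4 * d + 3)) * K ^ 8"

text \<open>The determinant of two distinct primitive points is a nonzero integer, and expressing it
  through the two linear forms gives q^(d-1) \<le> 2K q'. As d - 1 \<ge> 2, squaring gives q^4 \<le>
  4K^2 q'^2, and one factor q \<ge> 4K^2 is cancelled.\<close>

lemma approximations_gap:
  fixes K :: real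
  assumes d: "d \<ge> 3" and K: "K \<ge> 1" and x: "(p, q) \<in> approximations d \<alpha> K" "(p', q') \<in> approximations d \<alpha> K"
    and ne: "(p, q) \<noteq> (p', q')" and le: "q \<le> q'" and big: "4 * K\<^sup>2 \<le> real q"
  shows "q ^ 3 \<le> q'\<^sup>2"
proof -
  have q: "q > 0" "q' > 0" "coprime p (int q)" "coprime p' (int q')"
    "norm (of_int p - \<alpha> * of_nat q) \<le> K / real q ^ (d - 1)"
    "norm (of_int p' - \<alpha> * of_nat q') \<le> K / real q' ^ (d - 1)"
    using x by (auto simp: approximations_def)
  have "1 \<le> norm (of_int (p * int q' - p' * int q) :: complex)"
    using primitive_cross_ne[of p q p' q'] q ne by (intro norm_of_int_ge_1) auto
  also have "of_int (p * int q' - p' * int q) =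
      (of_int p - \<alpha> * of_nat q) * of_nat q' - (of_int p' - \<alpha> * of_nat q') * of_nat q"
    by (simp add: algebra_simps)
  also have "norm \<dots> \<le> norm (of_int p - \<alpha> * of_nat q) * real q' + norm (of_int p' - \<alpha> * of_nat q') * real q"
    by (rule order_trans[OF norm_triangle_ineq4]) (simp add: norm_mult)
  also have "\<dots> \<le> K / real q ^ (d - 1) * real q' + K / real q ^ (d - 1) * real q'"
  proof (intro add_mono mult_mono)
    show "norm (of_int p' - \<alpha> * of_nat q') \<le> K / real q ^ (d - 1)"
      using q(6) by (rule order_trans) (use K le q in \<open>intro divide_left_mono power_mono; simp\<close>)
  qed (use q K le in auto)
  finally have "real q ^ (d - 1) \<le> 2 * K * real q'" using q by (simp add: field_simps)
  moreover have "real q ^ 2 \<le> real q ^ (d - 1)" using q d by (intro power_increasing) auto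
  ultimately have "(real q ^ 2)\<^sup>2 \<le> (2 * K * real q')\<^sup>2" by (intro power_mono) auto
  also have "\<dots> = 4 * K\<^sup>2 * real q' ^ 2" by (simp add: power2_eq_square)
  also have "\<dots> \<le> real q * real q' ^ 2" using big by (intro mult_right_mono) auto
  finally have "real q * real q ^ 3 \<le> real q * real q' ^ 2" by (simp add: power2_eq_square power3_eq_cube mult.assoc)
  then have "real q ^ 3 \<le> real q' ^ 2" using q by simp
  then have "real (q ^ 3) \<le> real (q' ^ 2)" by simp
  then show ?thesis by (simp only: of_nat_le_iff)
qed

text \<open>The input that Thue's argument needs from the form. The polynomial is existentially
  quantified because it need not be the dehomogenised form: any integer polynomial of degree d with
  d distinct roots will do, possibly one with an extra root.\<close>

definition bounded_root :: "nat \<Rightarrow> nat \<Rightarrow> complex \<Rightarrow> bool" where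
  "bounded_root d A \<alpha> \<longleftrightarrow> norm \<alpha> \<le> 1 \<and> (\<exists>f. degree f = d \<and> card {\<beta>. poly (cpoly f) \<beta> = 0} = d \<and>
     (\<forall>i. \<bar>coeff f i\<bar> \<le> int A) \<and> poly (cpoly f) \<alpha> = 0)"

lemma card_large_approximations_le:
  assumes d: "d \<ge> 3"
  shows "\<exists>n. \<forall>\<alpha> A K. bounded_root d A \<alpha> \<longrightarrow> A \<ge> 1 \<longrightarrow> K \<ge> 1 \<longrightarrow>
    finite {x \<in> approximations d \<alpha> K. thue_threshold d A K < real (snd x)}
    \<and> card {x \<in> approximations d \<alpha> K. thue_threshold d A K < real (snd x)} \<le> n"
proof -
  \<comment> \<open>Thue's theorem forbids q' \<ge> q^E for two large denominators, so
    \<open>n\<close> gap steps with (3/2)^n > E suffice; both numbers depend on \<open>d\<close>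
    only.\<close>
  define E where "E = 8 * (16 + 2 * d)"
  obtain n where "real E < (3 / 2) ^ n" using real_arch_pow[of "3/2" "real E"] by auto
  then have "real E * 2 ^ n \<le> 3 ^ n" by (simp add: power_divide field_simps)
  then have "real (E * 2 ^ n) \<le> real (3 ^ n)" by simp
  then have n: "E * 2 ^ n \<le> 3 ^ n" by (simp only: of_nat_le_iff)
  show ?thesis
  proof (intro exI[of _ n] allI impI)
    fix \<alpha> A K
    assume "bounded_root d A \<alpha>" and A: "A \<ge> 1" and K: "K \<ge> (1 :: real)"
    then obtain f where f: "degree f = d" "card {\<beta>. poly (cpoly f) \<beta> = 0} = d" "\<forall>i. \<bar>coeff f i\<bar> \<le> int A"
      and \<alpha>: "poly (cpoly f) \<alpha> = 0" "norm \<alpha> \<le> 1"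
      by (auto simp: bounded_root_def)
    define S where "S = {x \<in> approximations d \<alpha> K. thue_threshold d A K < real (snd x)}"
    have big: "4 * K\<^sup>2 \<le> real (snd x)" if "x \<in> S" for x
    proof -
      define W where "W = real (thue_base d A) ^ (8 * d * (4 * d + 3))"
      have b64: "64 * 1 \<le> 64 * (8 * A) ^ (2 * d)" using A by (intro mult_le_mono) auto
      then have b: "real 64 \<le> real (thue_base d A)" unfolding thue_base_def by (intro of_nat_mono) simp
      moreover have "real (thue_base d A) \<le> W" unfolding W_def using b d by (intro self_le_power) auto
      ultimately have "4 \<le> 2 * W" by simp
      moreover have "K\<^sup>2 \<le> K ^ 8" using K by (intro power_increasing) auto
      ultimately have "4 * K\<^sup>2 \<le> (2 * W) * K ^ 8" by (intro mult_mono) auto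
      also have "(2 * W) * K ^ 8 < real (snd x)"
        using that unfolding S_def thue_threshold_def W_def by simp
      finally show ?thesis by simp
    qed
    have gap: "q ^ 3 \<le> q'\<^sup>2" if "(p, q) \<in> S" "(p', q') \<in> S" "(p, q) \<noteq> (p', q')" "q \<le> q'" for p q p' q'
      using that approximations_gap[OF d K, of p q \<alpha> p' q'] big[of "(p, q)"] by (simp add: S_def)
    have q2: "q \<ge> 2" if "(p, q) \<in> S" for p q
    proof -
      have "1 \<le> K\<^sup>2" using K by (rule one_le_power)
      then show ?thesis using big[OF that] by simp
    qed
    \<comment> \<open>For equal denominators the gap would read q^3 \<le> q^2, so a large
      approximation is determined by its denominator and it suffices to count denominators.\<close>
    have "inj_on snd S"
    proof (rule inj_onI, rule ccontr)
      fix x y assume xy: "x \<in> S" "y \<in> S" "snd x = snd y" "x \<noteq> y"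
      then obtain p q p' where pq: "x = (p, q)" "y = (p', q)" by (cases x, cases y) auto
      then have "q ^ 3 \<le> q\<^sup>2" using gap[of p q p' q] xy by simp
      moreover have "q \<ge> 2" using q2[of p q] xy pq by simp
      ultimately show False using power_strict_increasing_iff[of q 2 3] by simp
    qed
    moreover have "finite (snd ` S) \<and> card (snd ` S) \<le> n"
    proof (rule card_gap_le[OF _ _ n])
      show "q ^ 3 \<le> q'\<^sup>2" if "q \<in> snd ` S" "q' \<in> snd ` S" "q < q'" for q q'
        using that gap by fastforce
      show "q \<ge> 1" if "q \<in> snd ` S" for q using that q2 by fastforce
      show "q' < q ^ E" if qq: "q \<in> snd ` S" "q' \<in> snd ` S" for q q'
      proof (rule ccontr)
        assume nle: "\<not> q' < q ^ E"
        obtain p p' where "(p, q) \<in> S" "(p', q') \<in> S" using qq by force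
        then show False
          using thue_no_two_good_approximations[OF d f(1,2) _ A K \<alpha>, of q q' p p'] f(3) nle
          by (auto simp: S_def approximations_def thue_threshold_def E_def)
      qed
    qed
    ultimately have "finite S \<and> card S \<le> n" by (metis card_image finite_imageD)
    then show "finite {x \<in> approximations d \<alpha> K. thue_threshold d A K < real (snd x)}
      \<and> card {x \<in> approximations d \<alpha> K. thue_threshold d A K < real (snd x)} \<le> n"
      by (simp only: S_def)
  qed
qed

text \<open>Two constants are needed. Points that are t times a primitive one lead to \<kappa> = K /
  t^d, which may be below 1, whereas the threshold is taken for the single K \<ge> 1 common to all
  t.\<close>

lemma card_approximations_le:
  assumes d: "d \<ge> 3"
  shows "\<exists>c. \<forall>\<alpha> A K \<kappa> T n. bounded_root d A \<alpha> \<longrightarrow> A \<ge> 1 \<longrightarrow> K \<ge> 1 \<longrightarrow>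
    0 \<le> \<kappa> \<longrightarrow> \<kappa> \<le> K \<longrightarrow> 1 \<le> T \<longrightarrow> thue_threshold d A K < 2 ^ n \<longrightarrow>
    finite {x \<in> approximations d \<alpha> \<kappa>. T \<le> real (snd x)}
    \<and> real (card {x \<in> approximations d \<alpha> \<kappa>. T \<le> real (snd x)}) \<le> real (n + c) + 16 * \<kappa> / T ^ (d - 2)"
proof -
  from card_large_approximations_le[OF d] obtain c where c: "\<forall>\<alpha> A K. bounded_root d A \<alpha> \<longrightarrow> A \<ge> 1 \<longrightarrow> K \<ge> 1 \<longrightarrow>
    finite {x \<in> approximations d \<alpha> K. thue_threshold d A K < real (snd x)}
    \<and> card {x \<in> approximations d \<alpha> K. thue_threshold d A K < real (snd x)} \<le> c" ..
  show ?thesis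
  proof (intro exI[of _ c] allI impI)
    fix \<alpha> A K \<kappa> T n
    assume \<alpha>: "bounded_root d A \<alpha>" "A \<ge> 1" and K: "K \<ge> (1 :: real)"
      and \<kappa>: "(0 :: real) \<le> \<kappa>" "\<kappa> \<le> K" and T: "(1 :: real) \<le> T" and n: "thue_threshold d A K < 2 ^ n"
    define U where "U = {x \<in> approximations d \<alpha> \<kappa>. T \<le> real (snd x) \<and> real (snd x) < 2 ^ n * T}"
    define V where "V = {x \<in> approximations d \<alpha> K. thue_threshold d A K < real (snd x)}"
    define S where "S = {x \<in> approximations d \<alpha> \<kappa>. T \<le> real (snd x)}"
    have V: "finite V" "card V \<le> c" using c[rule_format, OF \<alpha> K] unfolding V_def by blast+
    have U: "finite U" "real (card U) \<le> real n + 8 * \<kappa> / T ^ (d - 2) * (2 - 2 / 2 ^ n)"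
      using card_approximations_dyadic_le[OF d _ \<kappa>(1), of T \<alpha> n] T by (auto simp: U_def)
    have sub: "S \<subseteq> U \<union> V"
    proof
      fix x assume x: "x \<in> S"
      have "2 ^ n * 1 \<le> 2 ^ n * T" using T by (intro mult_left_mono) auto
      then have "thue_threshold d A K < real (snd x)" if "2 ^ n * T \<le> real (snd x)"
        using that n by linarith
      then show "x \<in> U \<union> V"
        using x approximations_mono[OF \<kappa>(2)] by (fastforce simp: S_def U_def V_def not_less)
    qed
    have "card S \<le> card U + card V"
      using order_trans[OF card_mono[OF _ sub] card_Un_le] U V by simp
    then have "real (card S) \<le> real (card U) + real c" using V by linarith
    moreover have "8 * \<kappa> / T ^ (d - 2) * (2 - 2 / 2 ^ n) \<le> 8 * \<kappa> / T ^ (d - 2) * 2"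
      using \<kappa> T by (intro mult_left_mono) auto
    ultimately have "real (card S) \<le> real (n + c) + 16 * \<kappa> / T ^ (d - 2)" using U by simp
    moreover have "finite S" using finite_subset[OF sub] U V by simp
    ultimately show "finite {x \<in> approximations d \<alpha> \<kappa>. T \<le> real (snd x)}
      \<and> real (card {x \<in> approximations d \<alpha> \<kappa>. T \<le> real (snd x)}) \<le> real (n + c) + 16 * \<kappa> / T ^ (d - 2)"
      by (simp only: S_def)
  qed
qed

section \<open>Lattice points in a square\<close>

text \<open>
  On a unit interval \<open>[n, n+1)\<close> free of solutions of \<open>p = \<plusminus>m\<close> the condition \<open>\<bar>p\<bar> \<le> m\<close> is constant, so only
  the at most \<open>2d\<close> remaining intervals contribute to the discrepancy.
\<close>

lemma poly_slice_discrepancy: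
  fixes p :: "real poly" and m :: real and R :: nat
  assumes deg: "degree p \<le> d"
  defines "S \<equiv> {t. \<bar>poly p t\<bar> \<le> m}"
  shows "\<bar>real (card {n \<in> {- int R..<int R}. of_int n \<in> S}) - measure lborel (S \<inter> {- real R..<real R})\<bar> \<le> 2 * real d"
proof (cases "degree p = 0")
  \<comment> \<open>A constant \<open>p\<close> may equal \<open>m\<close> or \<open>-m\<close>
    identically, and then it has infinitely many boundary points; but its slice is everything or
    empty.\<close>
  case True
  then obtain c where "p = [:c:]" by (rule degree_eq_zeroE)
  then consider "S = UNIV" | "S = {}" by (cases "\<bar>c\<bar> \<le> m") (auto simp: S_def)
  then show ?thesis
  proof cases
    case 1
    then have "{n \<in> {- int R..<int R}. of_int n \<in> S} = {- int R..<int R}" by auto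
    then show ?thesis using 1 by simp
  qed simp
next
  case False
  define q1 q2 where "q1 = p - [:m:]" and "q2 = p + [:m:]"
  define Z where "Z = {t. poly q1 t = 0} \<union> {t. poly q2 t = 0}"
  define I where "I = {- int R..<int R}"
  define \<mu> where "\<mu> n = measure lborel (S \<inter> {of_int n..<of_int n + 1 :: real})" for n :: int
  have dq: "degree q1 = degree p" "degree q2 = degree p"
    using False by (simp_all add: q1_def q2_def degree_add_eq_left diff_conv_add_uminus del: add_uminus_conv_diff)
  then have q0: "q1 \<noteq> 0" "q2 \<noteq> 0" using False by auto
  have finZ: "finite Z" using q0 by (simp add: Z_def poly_roots_finite)
  have cardZ: "card Z \<le> 2 * d"
    using card_Un_le[of "{t. poly q1 t = 0}" "{t. poly q2 t = 0}"]
      card_poly_roots_bound[OF q0(1)] card_poly_roots_bound[OF q0(2)] dq deg unfolding Z_def by linarith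
  have "closed S" unfolding S_def by (intro closed_Collect_le continuous_intros)
  then have [measurable]: "S \<in> sets borel" by (rule borel_closed)
  have const: "s \<in> S \<longleftrightarrow> t \<in> S" if st: "of_int n \<le> s" "s \<le> t" "t < of_int n + 1" and n: "n \<notin> floor ` Z" for n :: int and s t
  proof (rule ccontr)
    assume neq: "\<not> (s \<in> S \<longleftrightarrow> t \<in> S)"
    have cont: "continuous_on {s..t} (\<lambda>x. \<bar>poly p x\<bar>)" by (intro continuous_intros)
    have "\<exists>x. s \<le> x \<and> x \<le> t \<and> \<bar>poly p x\<bar> = m"
    proof (cases "s \<in> S")
      case True
      then have "\<bar>poly p s\<bar> \<le> m" "m \<le> \<bar>poly p t\<bar>" using neq by (auto simp: S_def)
      then show ?thesis using IVT'[of "\<lambda>x. \<bar>poly p x\<bar>" s m t] st cont by auto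
    next
      case False
      then have "\<bar>poly p t\<bar> \<le> m" "m \<le> \<bar>poly p s\<bar>" using neq by (auto simp: S_def)
      then show ?thesis using IVT2'[of "\<lambda>x. \<bar>poly p x\<bar>" t m s] st cont by auto
    qed
    then obtain x where x: "s \<le> x" "x \<le> t" "\<bar>poly p x\<bar> = m" by blast
    then have "x \<in> Z" by (auto simp: Z_def q1_def q2_def abs_if split: if_splits)
    moreover have "\<lfloor>x\<rfloor> = n" using x st by (intro floor_unique) auto
    ultimately show False using n by blast
  qed
  have \<mu>: "\<bar>of_bool (of_int n \<in> S) - \<mu> n\<bar> \<le> of_bool (n \<in> floor ` Z)" for n
  proof (cases "n \<in> floor ` Z")
    case True
    have "0 \<le> \<mu> n" by (simp add: \<mu>_def)
    moreover have "\<mu> n \<le> measure lborel {of_int n..<of_int n + 1 :: real}"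
      unfolding \<mu>_def by (intro measure_mono_fmeasurable) (auto simp: fmeasurable_def)
    ultimately show ?thesis using True by (auto simp: of_bool_def)
  next
    case False
    have "S \<inter> {of_int n..<of_int n + 1} = (if of_int n \<in> S then {of_int n..<of_int n + 1} else {})"
      using const[of n "of_int n", OF _ _ _ False] by auto
    then show ?thesis using False by (simp add: \<mu>_def of_bool_def)
  qed
  have union: "S \<inter> {- real R..<real R} = (\<Union>n\<in>I. S \<inter> {of_int n..<of_int n + 1})"
  proof (intro equalityI subsetI)
    fix x assume "x \<in> S \<inter> {- real R..<real R}"
    moreover from this have "\<lfloor>x\<rfloor> \<in> I" by (auto simp: I_def le_floor_iff floor_less_iff)
    ultimately show "x \<in> (\<Union>n\<in>I. S \<inter> {of_int n..<of_int n + 1})"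
      by (intro UN_I[of "\<lfloor>x\<rfloor>"]) auto
  next
    fix x assume "x \<in> (\<Union>n\<in>I. S \<inter> {of_int n..<of_int n + 1})"
    then obtain n where n: "n \<in> I" "x \<in> S" "of_int n \<le> x" "x < of_int n + 1" by auto
    then have "- real R \<le> of_int n" "of_int n + 1 \<le> real R" unfolding I_def by auto
    then show "x \<in> S \<inter> {- real R..<real R}" using n by auto
  qed
  have meas: "measure lborel (S \<inter> {- real R..<real R}) = (\<Sum>n\<in>I. \<mu> n)"
    unfolding union \<mu>_def
  proof (rule measure_finite_Union)
    show "finite I" by (simp add: I_def)
    show "disjoint_family_on (\<lambda>n. S \<inter> {of_int n..<of_int n + 1}) I"
    proof (unfold disjoint_family_on_def, intro ballI impI)
      fix a b :: int assume "a \<noteq> b"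
      then show "S \<inter> {of_int a..<of_int a + 1} \<inter> (S \<inter> {of_int b..<of_int b + 1}) = {}"
        by (auto simp: order.strict_iff_not)
    qed
    show "emeasure lborel (S \<inter> {of_int n..<of_int n + 1}) \<noteq> \<infinity>" for n :: int
    proof -
      have "emeasure lborel (S \<inter> {of_int n..<of_int n + 1}) \<le> emeasure lborel {of_int n..<of_int n + 1 :: real}"
        by (intro emeasure_mono) auto
      also have "\<dots> < \<infinity>" by simp
      finally show ?thesis by simp
    qed
  qed auto
  have "real (card {n \<in> I. of_int n \<in> S}) = (\<Sum>n\<in>I. of_bool (of_int n \<in> S))"
    by (simp add: sum.If_cases of_bool_def I_def Int_def)
  then have "\<bar>real (card {n \<in> I. of_int n \<in> S}) - measure lborel (S \<inter> {- real R..<real R})\<bar>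
      = \<bar>\<Sum>n\<in>I. of_bool (of_int n \<in> S) - \<mu> n\<bar>"
    by (simp add: meas sum_subtractf)
  also have "\<dots> \<le> (\<Sum>n\<in>I. of_bool (n \<in> floor ` Z))"
    by (rule order_trans[OF sum_abs]) (intro sum_mono \<mu>)
  also have "\<dots> = real (card (I \<inter> floor ` Z))"
    by (simp add: sum.If_cases of_bool_def I_def Int_def)
  also have "\<dots> \<le> real (card (floor ` Z))" using finZ by (intro of_nat_mono card_mono) auto
  also have "\<dots> \<le> real (card Z)" using finZ by (intro of_nat_mono card_image_le)
  also have "\<dots> \<le> 2 * real d" using cardZ by linarith
  finally show ?thesis by (simp only: I_def)
qed

text \<open>The count is compared with the area through an intermediate quantity, the total length
  of the horizontal slices at integer heights. Integrating \<open>hx\<close> over all real x relates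
  it to the area, and summing \<open>hy\<close> over the integer rows relates it to the count. Each
  comparison costs 2R times k, and no regularity of the boundary enters beyond the slices.\<close>

lemma lattice_discrepancy_square:
  fixes D :: "(real \<times> real) set" and k :: real and R :: nat
  assumes D: "closed D" and k: "k \<ge> 0"
    and hx: "\<And>x. \<bar>real (card {n \<in> {- int R..<int R}. (x, of_int n) \<in> D})
                   - measure lborel ({y. (x, y) \<in> D} \<inter> {- real R..<real R})\<bar> \<le> k"
    and hy: "\<And>y. \<bar>real (card {n \<in> {- int R..<int R}. (of_int n, y) \<in> D})
                   - measure lborel ({x. (x, y) \<in> D} \<inter> {- real R..<real R})\<bar> \<le> k"
  shows "\<bar>real (card {(a, b). a \<in> {- int R..<int R} \<and> b \<in> {- int R..<int R} \<and> (of_int a, of_int b) \<in> D})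
          - measure lborel (D \<inter> {- real R..<real R} \<times> {- real R..<real R})\<bar> \<le> 4 * real R * k"
proof -
  define J where "J = {- real R..<real R}"
  define I where "I = {- int R..<int R}"
  define B where "B = D \<inter> J \<times> J"
  have IJ: "of_int n \<in> J" if "n \<in> I" for n using that by (auto simp: I_def J_def)
  have [measurable]: "D \<in> sets (borel \<Otimes>\<^sub>M borel)" using borel_closed[OF D] by (metis borel_prod)
  have B[measurable]: "B \<in> sets (lborel \<Otimes>\<^sub>M lborel)"
    unfolding B_def J_def by measurable
  have "B \<subseteq> cbox (- real R, - real R) (real R, real R)" by (auto simp: B_def J_def cbox_Pair_eq)
  then have "emeasure lborel B \<le> emeasure lborel (cbox (- real R, - real R) (real R, real R))"
    by (intro emeasure_mono) auto
  also have "\<dots> < \<infinity>" by (intro emeasure_bounded_finite) simp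
  finally have Bfin: "emeasure (lborel \<Otimes>\<^sub>M lborel) B < \<infinity>" by (simp add: lborel_prod)
  have int: "integrable (lborel \<Otimes>\<^sub>M lborel) (indicator B :: real \<times> real \<Rightarrow> real)"
    by (rule integrable_real_indicator[OF B Bfin])
  define lam where "lam x = measure lborel ({y. (x, y) \<in> B})" for x
  define N where "N x = (\<Sum>n\<in>I. indicator B (x, of_int n) :: real)" for x :: real
  have slice: "{y. (x, y) \<in> B} \<in> sets lborel" "{y. (y, x) \<in> B} \<in> sets lborel" for x
    using sets_Pair1[OF B, of x] sets_Pair2[OF B, of x] by (simp_all add: vimage_def)
  have slice_int: "(\<integral>y. indicator B (x, y) \<partial>lborel) = lam x" for x
  proof -
    have "(\<lambda>y. indicator B (x, y) :: real) = indicator {y. (x, y) \<in> B}" by (auto simp: indicator_def)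
    then show ?thesis using slice by (simp add: lam_def)
  qed
  have "measure lborel B = (\<integral>z. indicator B z \<partial>(lborel \<Otimes>\<^sub>M lborel))" using B by (simp add: lborel_prod)
  also have "\<dots> = (\<integral>x. (\<integral>y. indicator B (x, y) \<partial>lborel) \<partial>lborel)"
    by (rule lborel_pair.integral_fst'[OF int, symmetric])
  finally have measB: "measure lborel B = (\<integral>x. lam x \<partial>lborel)" by (simp only: slice_int)
  have intlam: "integrable lborel lam"
    using lborel_pair.integrable_fst'[OF int] by (simp only: slice_int)
  have col: "integrable lborel (\<lambda>x. indicator B (x, y) :: real)"
    "(\<integral>x. indicator B (x, y) \<partial>lborel) = measure lborel {x. (x, y) \<in> B}" for y
  proof -
    have eq: "(\<lambda>x. indicator B (x, y) :: real) = indicator {x. (x, y) \<in> B}" by (auto simp: indicator_def)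
    have "emeasure lborel {x. (x, y) \<in> B} \<le> emeasure lborel J"
      by (intro emeasure_mono) (auto simp: B_def J_def)
    also have "\<dots> < \<infinity>" by (simp add: J_def)
    finally show "integrable lborel (\<lambda>x. indicator B (x, y) :: real)"
      using slice unfolding eq by (intro integrable_real_indicator) auto
    show "(\<integral>x. indicator B (x, y) \<partial>lborel) = measure lborel {x. (x, y) \<in> B}"
      using slice unfolding eq by simp
  qed
  have intN: "integrable lborel N" "(\<integral>x. N x \<partial>lborel) = (\<Sum>n\<in>I. measure lborel {x. (x, of_int n) \<in> B})"
    unfolding N_def using col by (auto simp: Bochner_Integration.integral_sum)
  have "\<bar>lam x - N x\<bar> \<le> k * indicator J x" for x
  proof (cases "x \<in> J")
    case True
    then have "{y. (x, y) \<in> B} = {y. (x, y) \<in> D} \<inter> J" by (auto simp: B_def)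
    moreover have "N x = real (card {n \<in> I. (x, of_int n) \<in> D})"
      using True IJ by (auto simp: N_def indicator_def B_def sum.If_cases I_def Int_def intro!: arg_cong[of _ _ card])
    ultimately show ?thesis using hx[of x] True by (simp add: lam_def J_def I_def abs_minus_commute)
  next
    case False
    then have "{y. (x, y) \<in> B} = {}" by (auto simp: B_def)
    then show ?thesis using False by (simp add: lam_def N_def indicator_def B_def)
  qed
  then have "\<bar>\<integral>x. lam x - N x \<partial>lborel\<bar> \<le> (\<integral>x. k * indicator J x \<partial>lborel)"
    using intlam intN by (intro order_trans[OF integral_abs_bound] integral_mono) (auto simp: J_def)
  also have "\<dots> = 2 * real R * k" by (simp add: J_def)
  finally have 1: "\<bar>measure lborel B - (\<Sum>n\<in>I. measure lborel {x. (x, of_int n) \<in> B})\<bar> \<le> 2 * real R * k"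
    using intlam intN by (simp add: measB)
  have "\<bar>real (card {a \<in> I. (of_int a, of_int n) \<in> D}) - measure lborel {x. (x, of_int n) \<in> B}\<bar> \<le> k" if "n \<in> I" for n
  proof -
    have "{x. (x, of_int n) \<in> B} = {x. (x, of_int n) \<in> D} \<inter> J" using IJ that by (auto simp: B_def)
    then show ?thesis using hy[of "of_int n"] by (simp add: I_def J_def)
  qed
  then have "\<bar>(\<Sum>n\<in>I. real (card {a \<in> I. (of_int a, of_int n) \<in> D}) - measure lborel {x. (x, of_int n) \<in> B})\<bar> \<le> (\<Sum>n\<in>I. k)"
    by (intro order_trans[OF sum_abs] sum_mono)
  also have "\<dots> = 2 * real R * k" by (simp add: I_def)
  finally have 2: "\<bar>(\<Sum>n\<in>I. real (card {a \<in> I. (of_int a, of_int n) \<in> D})) - (\<Sum>n\<in>I. measure lborel {x. (x, of_int n) \<in> B})\<bar> \<le> 2 * real R * k"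
    by (simp add: sum_subtractf)
  have "card {(a, b). a \<in> I \<and> b \<in> I \<and> (of_int a, of_int b) \<in> D} =
      card (SIGMA n:I. {a \<in> I. (of_int a, of_int n) \<in> D})"
    by (rule bij_betw_same_card[of prod.swap]) (auto simp: bij_betw_def inj_on_def image_def)
  also have "\<dots> = (\<Sum>n\<in>I. card {a \<in> I. (of_int a, of_int n) \<in> D})"
  proof (rule card_SigmaI)
    show "finite I" by (simp add: I_def)
    then show "\<forall>n\<in>I. finite {a \<in> I. (of_int a, of_int n) \<in> D}" by simp
  qed
  finally have "real (card {(a, b). a \<in> I \<and> b \<in> I \<and> (of_int a, of_int b) \<in> D}) =
      (\<Sum>n\<in>I. real (card {a \<in> I. (of_int a, of_int n) \<in> D}))" by simp
  then have "\<bar>real (card {(a, b). a \<in> I \<and> b \<in> I \<and> (of_int a, of_int b) \<in> D}) - measure lborel B\<bar> \<le> 4 * real R * k"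
    using 1 2 by linarith
  then show ?thesis by (simp only: B_def I_def J_def)
qed

section \<open>Geometry of the linear factors\<close>

text \<open>\<open>form_eval\<close> with its two arguments separated, which suits slicing, Fubini
  and the exchange of the variables.\<close>

definition bform :: "nat \<Rightarrow> (nat \<Rightarrow> int) \<Rightarrow> 'a :: comm_ring_1 \<Rightarrow> 'a \<Rightarrow> 'a" where
  "bform d a x y = (\<Sum>i\<le>d. of_int (a i) * x ^ i * y ^ (d - i))"

lemma bform_swap: "bform d (\<lambda>i. a (d - i)) x y = bform d a y x"
  unfolding bform_def
  by (rule sum.reindex_bij_witness[of _ "\<lambda>i. d - i" "\<lambda>i. d - i"]) (auto simp: mult_ac)

lemma bform_scale: "bform d a (t * x) (t * y) = t ^ d * bform d a x y"
proof -
  have "t ^ d = t ^ i * t ^ (d - i)" if "i \<le> d" for i using that by (simp flip: power_add)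
  then show ?thesis
    unfolding bform_def sum_distrib_left by (intro sum.cong refl) (simp add: power_mult_distrib mult_ac)
qed

lemma of_int_bform: "bform d a (of_int x) (of_int y) = of_int (bform d a x y)"
  by (simp add: bform_def)

lemma of_real_bform: "bform d a (of_real x) (of_real y) = (of_real (bform d a x y) :: complex)"
  by (simp add: bform_def)

lemma bform_poly_fst: "bform d a x y = poly (\<Sum>i\<le>d. monom (of_int (a i) * y ^ (d - i)) i) x"
  by (simp add: bform_def poly_sum poly_monom mult_ac)

lemma bform_poly_snd: "bform d a x y = poly (\<Sum>i\<le>d. monom (of_int (a i) * x ^ i) (d - i)) y"
  by (simp add: bform_def poly_sum poly_monom mult_ac)

text \<open>The factorization is a parameter, not the chosen \<open>linear_factors\<close>, so that
  the whole context can be instantiated a second time with the variables exchanged. This gives the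
  chart for roots of modulus greater than 1, including infinity.\<close>

locale factored_form =
  fixes d :: nat and a :: "nat \<Rightarrow> int" and u v :: "nat \<Rightarrow> complex"
  assumes d: "d \<ge> 3"
    and factorization: "\<And>x y. bform d a x y = (\<Prod>i<d. u i * x + v i * y)"
    and separable: "\<And>i j. i < d \<Longrightarrow> j < d \<Longrightarrow> i \<noteq> j \<Longrightarrow> u i * v j - u j * v i \<noteq> 0"
begin

definition len :: "nat \<Rightarrow> real" where "len i = sqrt ((norm (u i))\<^sup>2 + (norm (v i))\<^sup>2)"

definition height :: real where "height = (\<Prod>i<d. len i)"

definition dehom :: "int poly" where "dehom = (\<Sum>i\<le>d. monom (a i) i)"

lemma swapped: "factored_form d (\<lambda>i. a (d - i)) v u"
proof
  show "bform d (\<lambda>i. a (d - i)) x y = (\<Prod>i<d. v i * x + u i * y)" for x y :: complex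
    unfolding bform_swap factorization by (simp add: add.commute)
  show "v i * u j - v j * u i \<noteq> 0" if "i < d" "j < d" "i \<noteq> j" for i j
    using separable[OF that] by (auto simp: mult.commute)
qed (rule d)

lemma swapped_height: "factored_form.height d v u = height"
  unfolding factored_form.height_def[OF swapped] height_def factored_form.len_def[OF swapped] len_def
  by (simp add: add.commute)

lemma cpoly_dehom: "cpoly dehom = (\<Prod>i<d. [:v i, u i:])"
proof -
  have "poly (cpoly dehom) x = poly (\<Prod>i<d. [:v i, u i:]) x" for x
  proof -
    have "cpoly dehom = (\<Sum>i\<le>d. monom (of_int (a i)) i)"
      unfolding dehom_def by (intro poly_eqI) (simp add: coeff_map_poly coeff_sum)
    then have "poly (cpoly dehom) x = bform d a x 1"
      by (simp add: bform_def poly_sum poly_monom)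
    then show ?thesis by (simp add: factorization poly_prod mult.commute add.commute)
  qed
  then show ?thesis by (simp add: poly_eq_poly_eq_iff[symmetric] fun_eq_iff)
qed

lemma norm_le_len: "norm (u i) \<le> len i" "norm (v i) \<le> len i"
  by (auto simp: len_def intro!: real_le_rsqrt)

lemma len_pos: "i < d \<Longrightarrow> len i > 0"
proof -
  assume i: "i < d"
  define j where "j = (if i = 0 then 1 else 0 :: nat)"
  have "j < d" "i \<noteq> j" using d by (auto simp: j_def)
  then have "u i \<noteq> 0 \<or> v i \<noteq> 0" using separable[of i j] i by auto
  then show ?thesis by (auto simp: len_def add_pos_nonneg add_nonneg_pos)
qed

lemma norm_det_le: "norm (u i * v j - u j * v i) \<le> len i * len j"
proof -
  define p q r s where "p = norm (u i)" and "q = norm (v i)" and "r = norm (u j)" and "s = norm (v j)"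
  have "norm (u i * v j - u j * v i) \<le> p * s + r * q"
    by (rule order_trans[OF norm_triangle_ineq4]) (simp add: norm_mult p_def q_def r_def s_def)
  also have "\<dots> \<le> sqrt ((p\<^sup>2 + q\<^sup>2) * (r\<^sup>2 + s\<^sup>2))"
  proof (rule real_le_rsqrt)
    have "(p\<^sup>2 + q\<^sup>2) * (r\<^sup>2 + s\<^sup>2) - (p * s + r * q)\<^sup>2 = (p * r - q * s)\<^sup>2"
      by (simp add: power2_eq_square algebra_simps)
    then show "(p * s + r * q)\<^sup>2 \<le> (p\<^sup>2 + q\<^sup>2) * (r\<^sup>2 + s\<^sup>2)"
      by (metis diff_ge_0_iff_ge zero_le_power2)
  qed
  finally show ?thesis by (simp add: len_def real_sqrt_mult p_def q_def r_def s_def)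
qed

definition sine :: "nat \<Rightarrow> nat \<Rightarrow> real" where
  "sine i j = norm (u i * v j - u j * v i) / (len i * len j)"

lemma sine_commute: "sine i j = sine j i"
  by (simp add: sine_def norm_minus_commute mult.commute)

lemma sine_bounds: "i < d \<Longrightarrow> j < d \<Longrightarrow> 0 \<le> sine i j \<and> sine i j \<le> 1"
  using norm_det_le[of i j] len_pos[of i] len_pos[of j] by (simp add: sine_def)

lemma height_pos: "height > 0"
  unfolding height_def by (intro prod_pos) (auto simp: len_pos)

lemma discriminant_ge_1: "1 \<le> (\<Prod>i<d. \<Prod>j\<in>{..<d} - {i}. norm (u i * v j - u j * v i))"
  using d by (intro form_discriminant_ge_1[OF _ cpoly_dehom] separable) auto

lemma prod_len_offdiag: "(\<Prod>i<d. \<Prod>j\<in>{..<d} - {i}. len i * len j) = height ^ (2 * (d - 1))"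
  using prod_offdiag_mult[of "{..<d}" len] len_pos by (force simp: height_def)

text \<open>Each determinant is at most the product of two lengths, so the discriminant, which is at
  least 1 in absolute value, is at most \<open>height ^ (2 * (d - 1))\<close>.\<close>

lemma height_ge_1: "height \<ge> 1"
proof (rule ccontr)
  assume "\<not> height \<ge> 1"
  then have "height ^ (2 * (d - 1)) < 1 ^ (2 * (d - 1))"
    using height_pos d by (intro power_strict_mono) auto
  then have "height ^ (2 * (d - 1)) < 1" by simp
  moreover have "1 \<le> (\<Prod>i<d. \<Prod>j\<in>{..<d} - {i}. len i * len j)"
    by (rule order_trans[OF discriminant_ge_1]) (intro prod_mono conjI prod_nonneg norm_det_le; simp)
  ultimately show False by (simp add: prod_len_offdiag)
qed

text \<open>In the product over ordered pairs the index i occurs in a row and in a column, each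
  giving the same product P; the remaining sines are at most 1. Hence P^2 is bounded below by the
  normalised discriminant, and the square root halves the exponent of the height.\<close>

lemma prod_sine_ge:
  assumes i: "i < d"
  shows "1 \<le> height ^ (d - 1) * (\<Prod>j\<in>{..<d} - {i}. sine i j)"
proof -
  define P where "P = (\<Prod>j\<in>{..<d} - {i}. sine i j)"
  have P0: "0 \<le> P" unfolding P_def using i by (intro prod_nonneg) (auto simp: sine_bounds)
  have "1 / height ^ (2 * (d - 1)) \<le>
      (\<Prod>k<d. \<Prod>j\<in>{..<d} - {k}. norm (u k * v j - u j * v k)) / height ^ (2 * (d - 1))"
    using discriminant_ge_1 height_pos by (intro divide_right_mono) auto
  also have "\<dots> = (\<Prod>k<d. \<Prod>j\<in>{..<d} - {k}. sine k j)"
    unfolding prod_len_offdiag[symmetric] sine_def by (simp only: prod_dividef)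
  also have "\<dots> = P * (\<Prod>k\<in>{..<d} - {i}. \<Prod>j\<in>{..<d} - {k}. sine k j)"
    unfolding P_def using i by (subst prod.remove[of _ i]) auto
  also have "\<dots> \<le> P * (\<Prod>k\<in>{..<d} - {i}. sine k i)"
  proof (intro mult_left_mono prod_mono conjI prod_nonneg P0)
    fix k assume k: "k \<in> {..<d} - {i}"
    show "0 \<le> sine k j" if "j \<in> {..<d} - {k}" for j using that k sine_bounds by auto
    have "(\<Prod>j\<in>{..<d} - {k}. sine k j) = sine k i * (\<Prod>j\<in>{..<d} - {k} - {i}. sine k j)"
      using k i by (subst prod.remove[of _ i]) auto
    also have "\<dots> \<le> sine k i * 1"
      using k i sine_bounds by (intro mult_left_mono prod_le_1) auto
    finally show "(\<Prod>j\<in>{..<d} - {k}. sine k j) \<le> sine k i" by simp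
  qed
  also have "(\<Prod>k\<in>{..<d} - {i}. sine k i) = P"
    unfolding P_def by (intro prod.cong refl sine_commute)
  finally have "1 / height ^ (2 * (d - 1)) \<le> P * P" .
  then have "1 \<le> (P * P) * height ^ (2 * (d - 1))" using height_pos by (simp add: divide_le_eq)
  also have "\<dots> = (height ^ (d - 1) * P)\<^sup>2"
  proof -
    have "height ^ (2 * (d - 1)) = height ^ (d - 1) * height ^ (d - 1)" by (simp only: mult_2 power_add)
    then show ?thesis by (simp only: power2_eq_square mult_ac)
  qed
  finally have "1\<^sup>2 \<le> (height ^ (d - 1) * P)\<^sup>2" by simp
  then have "1 \<le> height ^ (d - 1) * P"
    using P0 height_pos by (intro power2_le_imp_le[of 1]) auto
  then show ?thesis by (simp only: P_def)
qed

text \<open>Cramer's rule recovers both coordinates from the values of two linear forms, so both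
  values can be small only at a short vector or for a small angle.\<close>

lemma sine_max_le:
  fixes x y :: real
  assumes ij: "i < d" "j < d"
  shows "sine i j * max \<bar>x\<bar> \<bar>y\<bar> \<le> norm (u i * x + v i * y) / len i + norm (u j * x + v j * y) / len j"
proof -
  let ?l = "\<lambda>i. u i * x + v i * y" and ?D = "u i * v j - u j * v i"
  have "norm ?D * \<bar>x\<bar> = norm (?l i * v j - ?l j * v i)"
  proof -
    have "?l i * v j - ?l j * v i = of_real x * ?D" by (simp add: algebra_simps)
    then show ?thesis by (simp only: norm_mult norm_of_real mult.commute)
  qed
  also have "\<dots> \<le> norm (?l i) * norm (v j) + norm (?l j) * norm (v i)"
    by (rule order_trans[OF norm_triangle_ineq4]) (simp add: norm_mult)
  also have "\<dots> \<le> norm (?l i) * len j + norm (?l j) * len i"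
    by (intro add_mono mult_left_mono norm_le_len) auto
  finally have 1: "norm ?D * \<bar>x\<bar> \<le> norm (?l i) * len j + norm (?l j) * len i" .
  have "norm ?D * \<bar>y\<bar> = norm (?l j * u i - ?l i * u j)"
  proof -
    have "?l j * u i - ?l i * u j = of_real y * ?D" by (simp add: algebra_simps)
    then show ?thesis by (simp only: norm_mult norm_of_real mult.commute)
  qed
  also have "\<dots> \<le> norm (?l j) * norm (u i) + norm (?l i) * norm (u j)"
    by (rule order_trans[OF norm_triangle_ineq4]) (simp add: norm_mult)
  also have "\<dots> \<le> norm (?l j) * len i + norm (?l i) * len j"
    by (intro add_mono mult_left_mono norm_le_len) auto
  finally have 2: "norm ?D * \<bar>y\<bar> \<le> norm (?l i) * len j + norm (?l j) * len i"
    by (simp only: add.commute)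
  have "max \<bar>x\<bar> \<bar>y\<bar> = \<bar>x\<bar> \<or> max \<bar>x\<bar> \<bar>y\<bar> = \<bar>y\<bar>" by (auto simp: max_def)
  then have "norm ?D * max \<bar>x\<bar> \<bar>y\<bar> \<le> norm (?l i) * len j + norm (?l j) * len i"
    using 1 2 by (elim disjE) (simp_all only:)
  then have "norm ?D * max \<bar>x\<bar> \<bar>y\<bar> / (len i * len j) \<le> (norm (?l i) * len j + norm (?l j) * len i) / (len i * len j)"
    using len_pos ij by (intro divide_right_mono) (auto intro: less_imp_le)
  also have "\<dots> = norm (?l i) / len i + norm (?l j) / len j"
    using len_pos[of i] len_pos[of j] ij by (simp add: field_simps)
  finally show ?thesis by (simp add: sine_def)
qed

text \<open>
  Let \<open>i\<close> minimise the normalised value of the \<open>i\<close>-th linear form at \<open>(x, y)\<close>.  Every other form is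
  then bounded below by the sine of its angle to the \<open>i\<close>-th one, and the discriminant bounds the
  product of these sines from below; this is the origin of the exponent \<open>d - 2\<close>.
\<close>

lemma exists_small_linear_form:
  fixes x y :: real
  shows "\<exists>i<d. norm (u i * x + v i * y) / len i * max \<bar>x\<bar> \<bar>y\<bar> ^ (d - 1)
           \<le> 2 ^ (d - 1) * height ^ (d - 2) * \<bar>bform d a x y\<bar>"
proof -
  define g where "g i = norm (u i * x + v i * y) / len i" for i
  define r where "r = max \<bar>x\<bar> \<bar>y\<bar>"
  have r0: "r \<ge> 0" by (auto simp: r_def)
  have g0: "g i \<ge> 0" if "i < d" for i using that len_pos[of i] by (simp add: g_def)
  have "\<exists>i\<in>{..<d}. \<forall>j\<in>{..<d}. g i \<le> g j"
    using d by (intro bexI[of _ "arg_min_on g {..<d}"] ballI arg_min_least arg_min_if_finite) (auto simp: lessThan_empty_iff)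
  then obtain i where i: "i < d" "\<And>j. j < d \<Longrightarrow> g i \<le> g j" by auto
  define P where "P = (\<Prod>j\<in>{..<d} - {i}. sine i j)"
  define G where "G = (\<Prod>j\<in>{..<d} - {i}. g j)"
  have "P * r ^ (d - 1) = (\<Prod>j\<in>{..<d} - {i}. sine i j * r)"
    using i by (simp add: P_def prod.distrib)
  also have "\<dots> \<le> (\<Prod>j\<in>{..<d} - {i}. 2 * g j)"
  proof (intro prod_mono conjI)
    fix j assume j: "j \<in> {..<d} - {i}"
    then show "0 \<le> sine i j * r" using sine_bounds[of i j] i r0 by simp
    have "sine i j * r \<le> g i + g j" using sine_max_le[of i j x y] i j by (simp add: g_def r_def)
    then show "sine i j * r \<le> 2 * g j" using i(2)[of j] j by simp
  qed
  also have "\<dots> = 2 ^ (d - 1) * G" using i by (simp add: G_def prod.distrib)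
  finally have Pr: "P * r ^ (d - 1) \<le> 2 ^ (d - 1) * G" .
  have norm_form: "\<bar>bform d a x y\<bar> = height * (g i * G)"
  proof -
    have "\<bar>bform d a x y\<bar> = norm (bform d a (complex_of_real x) (complex_of_real y))"
      by (simp only: of_real_bform norm_of_real)
    also have "\<dots> = (\<Prod>j<d. norm (u j * x + v j * y))" by (simp add: factorization prod_norm)
    also have "\<dots> = (\<Prod>j<d. len j * g j)"
    proof (intro prod.cong refl)
      fix j assume "j \<in> {..<d}"
      then have "len j \<noteq> 0" using len_pos[of j] by simp
      then show "norm (u j * x + v j * y) = len j * g j" by (simp add: g_def)
    qed
    also have "\<dots> = height * (\<Prod>j<d. g j)" by (simp add: prod.distrib height_def)
    also have "(\<Prod>j<d. g j) = g i * G" unfolding G_def using i by (subst prod.remove[of _ i]) auto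
    finally show ?thesis .
  qed
  have "g i * r ^ (d - 1) * 1 \<le> g i * r ^ (d - 1) * (height ^ (d - 1) * P)"
    using prod_sine_ge[OF i(1)] g0[OF i(1)] r0 unfolding P_def by (intro mult_left_mono) auto
  also have "\<dots> = g i * height ^ (d - 1) * (P * r ^ (d - 1))" by (simp only: mult_ac)
  also have "\<dots> \<le> g i * height ^ (d - 1) * (2 ^ (d - 1) * G)"
    using Pr g0[OF i(1)] height_pos by (intro mult_left_mono) auto
  \<comment> \<open>One factor \<open>height\<close> is spent on passing from the normalised factors
    back to the value of the form in \<open>norm_form\<close>, which leaves the exponent d -
    2.\<close>
  also have "height ^ (d - 1) = height ^ (d - 2) * height"
  proof -
    obtain e where "d = Suc (Suc e)" using d by (metis add_2_eq_Suc le_Suc_ex Suc_leD numeral_3_eq_3 numeral_2_eq_2)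
    then show ?thesis by simp
  qed
  finally have "g i * r ^ (d - 1) \<le> 2 ^ (d - 1) * height ^ (d - 2) * (height * (g i * G))"
    by (simp only: mult_ac mult_1_right)
  then have "g i * r ^ (d - 1) \<le> 2 ^ (d - 1) * height ^ (d - 2) * \<bar>bform d a x y\<bar>"
    by (simp only: norm_form)
  then show ?thesis using i(1) unfolding g_def r_def by (intro exI[of _ i] conjI)
qed

section \<open>Integer polynomials of bounded height with the required roots\<close>

lemma abs_coeff_dehom_le: "\<bar>coeff dehom k\<bar> \<le> 2 ^ d * height"
proof -
  have "norm (coeff (\<Prod>i<n. [:v i, u i:]) k) \<le> (\<Prod>i<n. 2 * len i)" for n k
  proof (induction n arbitrary: k)
    case (Suc n)
    have "coeff (\<Prod>i<Suc n. [:v i, u i:]) k =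
        v n * coeff (\<Prod>i<n. [:v i, u i:]) k + u n * (if k = 0 then 0 else coeff (\<Prod>i<n. [:v i, u i:]) (k - 1))"
      by (cases k) (simp_all add: coeff_pCons mult.commute[of _ "[:v n, u n:]"])
    also have "norm \<dots> \<le> norm (v n) * norm (coeff (\<Prod>i<n. [:v i, u i:]) k)
        + norm (u n) * norm (if k = 0 then 0 else coeff (\<Prod>i<n. [:v i, u i:]) (k - 1))"
      by (rule order_trans[OF norm_triangle_ineq]) (simp add: norm_mult)
    also have "\<dots> \<le> len n * (\<Prod>i<n. 2 * len i) + len n * (\<Prod>i<n. 2 * len i)"
      using Suc.IH by (intro add_mono mult_mono norm_le_len) (auto simp: len_def intro!: prod_nonneg)
    also have "\<dots> = (\<Prod>i<Suc n. 2 * len i)" by simp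
    finally show ?case .
  qed (simp add: coeff_pCons split: nat.split)
  from this[of d k] have "norm (coeff (cpoly dehom) k) \<le> 2 ^ d * height"
    by (simp add: cpoly_dehom height_def prod.distrib)
  then show ?thesis by (simp add: coeff_map_poly)
qed

text \<open>
  A root at infinity drops the degree of the dehomogenised form to \<open>d - 1\<close>; it is replaced by an
  integer root.
\<close>

lemma exists_separable_poly:
  assumes i: "i < d" "u i \<noteq> 0"
  shows "\<exists>f. degree f = d \<and> card {\<beta>. poly (cpoly f) \<beta> = 0} = d \<and> poly (cpoly f) (- v i / u i) = 0
    \<and> (\<forall>k. \<bar>coeff f k\<bar> \<le> real (d + 1) * 2 ^ d * height)"
proof -
  define I where "I = {j. j < d \<and> u j \<noteq> 0}"
  define \<alpha> where "\<alpha> j = - v j / u j" for j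
  have finI: "finite I" by (simp add: I_def)
  have inj: "inj_on \<alpha> I"
  proof (rule inj_onI, rule ccontr)
    fix j k assume jk: "j \<in> I" "k \<in> I" "\<alpha> j = \<alpha> k" "j \<noteq> k"
    then have "u j * v k - u k * v j = 0" by (simp add: \<alpha>_def I_def field_simps)
    then show False using jk separable[of j k] by (simp add: I_def)
  qed
  have root_iff: "poly (cpoly dehom) \<beta> = 0 \<longleftrightarrow> \<beta> \<in> \<alpha> ` I" for \<beta>
  proof -
    have "poly (cpoly dehom) \<beta> = 0 \<longleftrightarrow> (\<exists>j<d. v j + \<beta> * u j = 0)"
      by (auto simp: cpoly_dehom poly_prod)
    also have "\<dots> \<longleftrightarrow> (\<exists>j\<in>I. \<beta> = \<alpha> j)"
    proof
      assume "\<exists>j<d. v j + \<beta> * u j = 0"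
      then obtain j where j: "j < d" "v j + \<beta> * u j = 0" by blast
      have "u j \<noteq> 0" using j len_pos[of j] by (auto simp: len_def)
      then show "\<exists>j\<in>I. \<beta> = \<alpha> j" using j by (intro bexI[of _ j]) (auto simp: I_def \<alpha>_def field_simps add_eq_0_iff)
    qed (auto simp: I_def \<alpha>_def)
    finally show ?thesis by auto
  qed
  have roots: "{\<beta>. poly (cpoly dehom) \<beta> = 0} = \<alpha> ` I" using root_iff by blast
  have cardI: "card (\<alpha> ` I) = card I" using inj by (rule card_image)
  have coef: "\<bar>coeff dehom k\<bar> \<le> 2 ^ d * height" for k by (rule abs_coeff_dehom_le)
  have degree: "degree dehom = card I"
  proof -
    have "[:v j, u j:] \<noteq> 0" if "j < d" for j using len_pos[OF that] by (auto simp: len_def)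
    then have "degree (cpoly dehom) = (\<Sum>j<d. degree [:v j, u j:])"
      unfolding cpoly_dehom by (intro degree_prod_eq_sum_degree) auto
    also have "\<dots> = (\<Sum>j<d. if u j \<noteq> 0 then 1 else 0)" by (intro sum.cong) auto
    also have "\<dots> = card I" by (simp add: sum.If_cases I_def Int_def)
    finally show ?thesis by simp
  qed
  show ?thesis
  proof (cases "\<exists>k<d. u k = 0")
    case False
    then have "I = {..<d}" by (auto simp: I_def)
    moreover have "poly (cpoly dehom) (- v i / u i) = 0"
      unfolding root_iff using i by (auto simp: I_def \<alpha>_def)
    moreover have "\<bar>coeff dehom k\<bar> \<le> real (d + 1) * 2 ^ d * height" for k
    proof -
      have "1 * (2 ^ d * height) \<le> real (d + 1) * (2 ^ d * height)"
        using height_pos by (intro mult_right_mono) auto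
      then show ?thesis using coef[of k] by (simp only: mult.assoc mult_1)
    qed
    ultimately show ?thesis
      using degree cardI roots by (intro exI[of _ dehom]) simp
  next
    case True
    then obtain k where k: "k < d" "u k = 0" by blast
    have "I = {..<d} - {k}"
    proof -
      have "u j \<noteq> 0" if "j < d" "j \<noteq> k" for j using separable[of k j] k that by auto
      then show ?thesis using k by (auto simp: I_def)
    qed
    then have cI: "card I = d - 1" using k by simp
    \<comment> \<open>Among the d + 1 integers from 0 to d some are not among the d - 1 finite
      roots. Multiplying by X - t with t \<le> d enlarges the coefficient bound by a factor of at
      most d + 1.\<close>
    have "\<exists>t\<le>d. (of_nat t :: complex) \<notin> \<alpha> ` I"
    proof (rule ccontr)
      assume "\<not> ?thesis"
      then have "of_nat ` {..d} \<subseteq> \<alpha> ` I" by auto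
      then have "card (of_nat ` {..d} :: complex set) \<le> card (\<alpha> ` I)" using finI by (intro card_mono) auto
      then show False using cI cardI by (simp add: card_image inj_on_def)
    qed
    then obtain t where t: "t \<le> d" "(of_nat t :: complex) \<notin> \<alpha> ` I" by blast
    define f where "f = [:- int t, 1:] * dehom"
    have cf: "cpoly f = [:- of_nat t, 1:] * cpoly dehom"
      by (simp only: f_def of_int_poly_hom.hom_mult) (simp add: cpoly_pCons)
    have "poly (cpoly f) \<beta> = 0 \<longleftrightarrow> \<beta> \<in> insert (of_nat t) (\<alpha> ` I)" for \<beta>
      unfolding cf poly_mult mult_eq_0_iff root_iff by auto
    then have "{\<beta>. poly (cpoly f) \<beta> = 0} = insert (of_nat t) (\<alpha> ` I)" by blast
    then have "card {\<beta>. poly (cpoly f) \<beta> = 0} = d" using t finI cI cardI d by simp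
    moreover have "degree f = d"
    proof -
      have "dehom \<noteq> 0" using degree cI d by auto
      then show ?thesis using degree cI d unfolding f_def by (subst degree_mult_eq) auto
    qed
    moreover have "poly (cpoly f) (- v i / u i) = 0"
      unfolding cf poly_mult mult_eq_0_iff root_iff using i by (auto simp: I_def \<alpha>_def)
    moreover have "\<bar>coeff f n\<bar> \<le> real (d + 1) * 2 ^ d * height" for n
    proof -
      define C where "C = 2 ^ d * height"
      have C: "\<bar>coeff dehom n\<bar> \<le> C" for n using coef by (simp add: C_def)
      have "coeff f n = (if n = 0 then 0 else coeff dehom (n - 1)) - int t * coeff dehom n"
        by (cases n) (simp_all add: f_def coeff_pCons)
      then have "\<bar>coeff f n\<bar> \<le> \<bar>if n = 0 then 0 else coeff dehom (n - 1)\<bar> + \<bar>int t * coeff dehom n\<bar>"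
        by linarith
      then have "real_of_int \<bar>coeff f n\<bar> \<le> of_int (\<bar>if n = 0 then 0 else coeff dehom (n - 1)\<bar> + \<bar>int t * coeff dehom n\<bar>)"
        by (simp only: of_int_le_iff)
      also have "\<dots> \<le> C + real d * C"
      proof -
        have "real t * \<bar>of_int (coeff dehom n)\<bar> \<le> real d * C"
          using t C[of n] by (intro mult_mono) auto
        moreover have "\<bar>of_int (if n = 0 then 0 else coeff dehom (n - 1))\<bar> \<le> C"
          using C[of "n - 1"] C[of 0] by auto
        ultimately show ?thesis by (simp add: abs_mult)
      qed
      finally show ?thesis by (simp add: C_def algebra_simps)
    qed
    ultimately show ?thesis by blast
  qed
qed

lemma bounded_root:
  assumes i: "i < d" "norm (v i) \<le> norm (u i)" and A: "real (d + 1) * 2 ^ d * height \<le> real A"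
  shows "bounded_root d A (- v i / u i)"
proof -
  have u0: "u i \<noteq> 0" using len_pos[OF i(1)] i(2) by (auto simp: len_def)
  then have "norm (- v i / u i) \<le> 1" using i by (simp add: norm_divide divide_le_eq_1)
  moreover obtain f where f: "degree f = d" "card {\<beta>. poly (cpoly f) \<beta> = 0} = d" "poly (cpoly f) (- v i / u i) = 0"
    and cf: "\<forall>k. \<bar>coeff f k\<bar> \<le> real (d + 1) * 2 ^ d * height"
    using exists_separable_poly[OF i(1) u0] by blast
  moreover have "\<bar>coeff f k\<bar> \<le> int A" for k
  proof -
    have "real_of_int \<bar>coeff f k\<bar> \<le> real_of_int (int A)" using cf A by (auto intro: order_trans)
    then show ?thesis by (simp only: of_int_le_iff)
  qed
  ultimately show ?thesis unfolding bounded_root_def by blast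
qed

end

section \<open>Area of the cusps\<close>

definition cusp :: "nat \<Rightarrow> complex \<Rightarrow> real \<Rightarrow> real \<Rightarrow> real \<Rightarrow> bool" where
  "cusp d \<alpha> K x y \<longleftrightarrow> norm (of_real x - \<alpha> * of_real y) * max \<bar>x\<bar> \<bar>y\<bar> ^ (d - 1) \<le> K"

text \<open>The bound on K makes the linear form at most 1 in modulus, so \<bar>x\<bar> \<le>
  \<bar>y\<bar> + 1. Far out, y is therefore comparable to the maximum and can replace it as the
  parameter along the cusp.\<close>

lemma cusp_far:
  assumes \<alpha>: "norm \<alpha> \<le> 1" and K: "K \<ge> 0" "K \<le> R ^ (d - 1)" and R: "R \<ge> 2"
    and c: "cusp d \<alpha> K x y" "R \<le> max \<bar>x\<bar> \<bar>y\<bar>"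
  shows "R / 2 \<le> \<bar>y\<bar>" "norm (of_real x - \<alpha> * of_real y) \<le> K / \<bar>y\<bar> ^ (d - 1)"
proof -
  define r where "r = max \<bar>x\<bar> \<bar>y\<bar>"
  have r: "r \<ge> R" "\<bar>y\<bar> \<le> r" "r = \<bar>x\<bar> \<or> r = \<bar>y\<bar>" using c by (auto simp: r_def max_def)
  have rp: "0 < r ^ (d - 1)" using r R by (intro zero_less_power) simp
  have 1: "norm (of_real x - \<alpha> * of_real y) \<le> K / r ^ (d - 1)"
    using c rp by (simp add: cusp_def r_def pos_le_divide_eq)
  also have "\<dots> \<le> 1"
  proof -
    have "R ^ (d - 1) \<le> r ^ (d - 1)" using r R by (intro power_mono) auto
    then show ?thesis using K rp by simp
  qed
  finally have "norm (of_real x - \<alpha> * of_real y) \<le> 1" .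
  moreover have "\<bar>x\<bar> \<le> norm (of_real x - \<alpha> * of_real y) + norm \<alpha> * \<bar>y\<bar>"
    using norm_triangle_ineq[of "of_real x - \<alpha> * of_real y" "\<alpha> * of_real y"] by (simp add: norm_mult)
  moreover have "norm \<alpha> * \<bar>y\<bar> \<le> 1 * \<bar>y\<bar>" using \<alpha> by (intro mult_right_mono) auto
  ultimately have "\<bar>x\<bar> \<le> 1 + \<bar>y\<bar>" by linarith
  then show y: "R / 2 \<le> \<bar>y\<bar>" using r R by auto
  have "K / r ^ (d - 1) \<le> K / \<bar>y\<bar> ^ (d - 1)"
    using y R r K by (intro divide_left_mono power_mono mult_pos_pos zero_less_power) auto
  then show "norm (of_real x - \<alpha> * of_real y) \<le> K / \<bar>y\<bar> ^ (d - 1)" using 1 by linarith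
qed

lemma nn_integral_inverse_square:
  fixes C s :: real
  assumes "C \<ge> 0" "s > 0"
  shows "(\<integral>\<^sup>+y. ennreal (C / y\<^sup>2) * indicator {s..} y \<partial>lborel) = ennreal (C / s)"
proof -
  have "(\<integral>\<^sup>+y. ennreal (C / y\<^sup>2) * indicator {s..} y \<partial>lborel) = ennreal (0 - (- (C / s)))"
  proof (rule nn_integral_FTC_atLeast)
    show "((\<lambda>y. - (C / y)) has_real_derivative C / y\<^sup>2) (at y)" if "s \<le> y" for y
      using that assms by (auto intro!: derivative_eq_intros simp: power2_eq_square)
    show "((\<lambda>y. - (C / y)) \<longlongrightarrow> 0) at_top" by real_asymp
  qed (use assms in auto)
  then show ?thesis by simp
qed

lemma emeasure_cusp_tail_le:
  fixes \<beta> K s :: real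
  assumes d: "d \<ge> 3" and K: "K \<ge> 0" and s: "s > 0"
  shows "{(x, y). s \<le> \<bar>y\<bar> \<and> \<bar>x - \<beta> * y\<bar> \<le> K / \<bar>y\<bar> ^ (d - 1)} \<in> sets borel"
    and "emeasure lborel {(x, y). s \<le> \<bar>y\<bar> \<and> \<bar>x - \<beta> * y\<bar> \<le> K / \<bar>y\<bar> ^ (d - 1)} \<le> ennreal (4 * K / s ^ (d - 2))"
proof -
  define T where "T = {(x, y). s \<le> \<bar>y\<bar> \<and> \<bar>x - \<beta> * y\<bar> \<le> K / \<bar>y\<bar> ^ (d - 1)}"
  \<comment> \<open>On \<bar>y\<bar> \<ge> s the slice length 2K / \<bar>y\<bar>^(d-1) is at most C
    / y^2, so the same integral serves for every d \<ge> 3.\<close>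
  define C where "C = 2 * K / s ^ (d - 3)"
  have T_eq: "T = {z \<in> space (borel \<Otimes>\<^sub>M borel). s \<le> \<bar>snd z\<bar> \<and> \<bar>fst z - \<beta> * snd z\<bar> \<le> K / \<bar>snd z\<bar> ^ (d - 1)}"
    by (auto simp: T_def space_pair_measure)
  have T: "T \<in> sets (borel \<Otimes>\<^sub>M borel)" unfolding T_eq by measurable
  then show "{(x, y). s \<le> \<bar>y\<bar> \<and> \<bar>x - \<beta> * y\<bar> \<le> K / \<bar>y\<bar> ^ (d - 1)} \<in> sets borel"
    unfolding T_def borel_prod .
  have T': "T \<in> sets (lborel \<Otimes>\<^sub>M lborel)" using T by (simp cong: sets_pair_measure_cong)
  have "emeasure lborel T = emeasure (lborel \<Otimes>\<^sub>M lborel) T" by (simp add: lborel_prod)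
  also have "\<dots> = (\<integral>\<^sup>+y. emeasure lborel ((\<lambda>x. (x, y)) -` T) \<partial>lborel)"
    by (rule lborel_pair.emeasure_pair_measure_alt2[OF T'])
  also have "\<dots> \<le> (\<integral>\<^sup>+y. ennreal (C / y\<^sup>2) * indicator {s..} y + ennreal (C / (- y)\<^sup>2) * indicator {s..} (- y) \<partial>lborel)"
  proof (rule nn_integral_mono)
    fix y :: real
    show "emeasure lborel ((\<lambda>x. (x, y)) -` T) \<le> ennreal (C / y\<^sup>2) * indicator {s..} y + ennreal (C / (- y)\<^sup>2) * indicator {s..} (- y)"
    proof (cases "s \<le> \<bar>y\<bar>")
      case True
      have "K / \<bar>y\<bar> ^ (d - 1) \<le> (K / s ^ (d - 3)) / \<bar>y\<bar>\<^sup>2"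
      proof -
        obtain e where e: "d = e + 3" using d by (metis add.commute le_Suc_ex)
        have "s ^ e * \<bar>y\<bar>\<^sup>2 \<le> \<bar>y\<bar> ^ e * \<bar>y\<bar>\<^sup>2" using True s by (intro mult_right_mono power_mono) auto
        then have "K / (\<bar>y\<bar> ^ e * \<bar>y\<bar>\<^sup>2) \<le> K / (s ^ e * \<bar>y\<bar>\<^sup>2)"
          using K s True by (intro divide_left_mono mult_pos_pos zero_less_power) auto
        moreover have ee: "d - 1 = e + 2" "d - 3 = e" by (simp_all add: e)
        ultimately show ?thesis unfolding ee power_add by (simp only: divide_divide_eq_left)
      qed
      then have KC: "2 * (K / \<bar>y\<bar> ^ (d - 1)) \<le> C / y\<^sup>2" by (simp add: C_def)
      have "(\<lambda>x. (x, y)) -` T \<subseteq> {\<beta> * y - K / \<bar>y\<bar> ^ (d - 1)..\<beta> * y + K / \<bar>y\<bar> ^ (d - 1)}"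
        by (auto simp: T_def)
      then have "emeasure lborel ((\<lambda>x. (x, y)) -` T) \<le> emeasure lborel {\<beta> * y - K / \<bar>y\<bar> ^ (d - 1)..\<beta> * y + K / \<bar>y\<bar> ^ (d - 1)}"
        by (intro emeasure_mono) auto
      also have "\<dots> = ennreal (2 * (K / \<bar>y\<bar> ^ (d - 1)))" using K by simp
      also have "\<dots> \<le> ennreal (C / y\<^sup>2)" using KC by (rule ennreal_leI)
      also have "\<dots> \<le> ennreal (C / y\<^sup>2) * indicator {s..} y + ennreal (C / (- y)\<^sup>2) * indicator {s..} (- y)"
        using True by (auto simp: indicator_def abs_if split: if_splits)
      finally show ?thesis .
    next
      case False
      then have "(\<lambda>x. (x, y)) -` T = {}" by (auto simp: T_def)
      then show ?thesis by simp
    qed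
  qed
  also have "\<dots> = (\<integral>\<^sup>+y. ennreal (C / y\<^sup>2) * indicator {s..} y \<partial>lborel) +
      (\<integral>\<^sup>+y. ennreal (C / (- y)\<^sup>2) * indicator {s..} (- y) \<partial>lborel)"
    by (rule nn_integral_add) measurable
  also have "(\<integral>\<^sup>+y. ennreal (C / (- y)\<^sup>2) * indicator {s..} (- y) \<partial>lborel) =
      (\<integral>\<^sup>+y. ennreal (C / y\<^sup>2) * indicator {s..} y \<partial>lborel)"
    using nn_integral_real_affine[of "\<lambda>y. ennreal (C / y\<^sup>2) * indicator {s..} y" "-1" 0] by simp
  also have "(\<integral>\<^sup>+y. ennreal (C / y\<^sup>2) * indicator {s..} y \<partial>lborel) = ennreal (C / s)"
    using K s by (intro nn_integral_inverse_square) (auto simp: C_def)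
  also have "ennreal (C / s) + ennreal (C / s) = ennreal (C / s + C / s)"
    using K s by (intro ennreal_plus[symmetric]) (auto simp: C_def)
  also have "C / s + C / s = 4 * K / s ^ (d - 2)"
  proof -
    obtain e where e: "d = e + 3" using d by (metis add.commute le_Suc_ex)
    have "d - 2 = Suc e" "d - 3 = e" by (simp_all add: e)
    then show ?thesis by (simp add: C_def mult.commute)
  qed
  finally show "emeasure lborel {(x, y). s \<le> \<bar>y\<bar> \<and> \<bar>x - \<beta> * y\<bar> \<le> K / \<bar>y\<bar> ^ (d - 1)} \<le> ennreal (4 * K / s ^ (d - 2))"
    by (simp only: T_def)
qed

section \<open>Planar measure under exchange of coordinates, and on pairs versus vectors\<close>

lemma emeasure_lborel_swap:
  fixes T :: "(real \<times> real) set"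
  assumes "T \<in> sets borel"
  shows "{(x, y). (y, x) \<in> T} \<in> sets borel" "emeasure lborel {(x, y). (y, x) \<in> T} = emeasure lborel T"
proof -
  have T: "T \<in> sets (lborel \<Otimes>\<^sub>M lborel)" unfolding lborel_prod using assms by simp
  have eq: "{(x, y). (y, x) \<in> T} = (\<lambda>(x, y). (y, x)) -` T \<inter> space (lborel \<Otimes>\<^sub>M lborel)"
    by (auto simp: space_pair_measure)
  have m: "(\<lambda>(x, y). (y, x)) \<in> measurable (lborel \<Otimes>\<^sub>M lborel) (lborel \<Otimes>\<^sub>M lborel :: (real \<times> real) measure)"
    by (rule measurable_pair_swap')
  have "{(x, y). (y, x) \<in> T} \<in> sets (lborel \<Otimes>\<^sub>M lborel)" unfolding eq by (rule measurable_sets[OF m T])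
  then show "{(x, y). (y, x) \<in> T} \<in> sets borel" unfolding lborel_prod by simp
  have "emeasure (lborel \<Otimes>\<^sub>M lborel) T = emeasure (distr (lborel \<Otimes>\<^sub>M lborel) (lborel \<Otimes>\<^sub>M lborel) (\<lambda>(x, y). (y, x))) T"
    by (subst (1) lborel_pair.distr_pair_swap) (rule refl)
  also have "\<dots> = emeasure (lborel \<Otimes>\<^sub>M lborel) {(x, y). (y, x) \<in> T}"
    unfolding eq by (rule emeasure_distr[OF m T])
  finally show "emeasure lborel {(x, y). (y, x) \<in> T} = emeasure lborel T" by (simp add: lborel_prod)
qed

lemma measurable_vector_2: "(\<lambda>(x, y). vector [x, y] :: real ^ 2) \<in> borel_measurable lborel"
proof -
  have eq: "(\<lambda>(x, y). vector [x, y] :: real ^ 2) = (\<lambda>z. fst z *\<^sub>R axis 1 1 + snd z *\<^sub>R axis 2 1)"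
    by (auto simp: fun_eq_iff Finite_Cartesian_Product.vec_eq_iff forall_2 axis_def vector_2)
  have "continuous_on UNIV (\<lambda>z :: real \<times> real. fst z *\<^sub>R (axis 1 1 :: real ^ 2) + snd z *\<^sub>R axis 2 1)"
    by (intro continuous_intros)
  then show ?thesis unfolding eq by (simp add: borel_measurable_continuous_onI)
qed

lemma distr_vector_lborel: "distr lborel borel (\<lambda>(x, y). vector [x, y] :: real ^ 2) = lborel"
proof (rule lborel_eqI[symmetric])
  fix l u :: "real ^ 2"
  assume lu: "\<And>b. b \<in> Basis \<Longrightarrow> l \<bullet> b \<le> u \<bullet> b"
  have ax: "axis i (1 :: real) \<in> Basis" for i :: 2 by (simp add: axis_in_Basis_iff)
  have le: "l $ i \<le> u $ i" for i using lu[OF ax[of i]] by (simp add: inner_axis)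
  have box: "(\<lambda>(x, y). vector [x, y] :: real ^ 2) -` box l u = box (l $ 1) (u $ 1) \<times> box (l $ 2) (u $ 2)"
    by (auto simp: mem_box_cart forall_2 vector_2)
  have "emeasure (distr lborel borel (\<lambda>(x, y). vector [x, y] :: real ^ 2)) (box l u) =
      emeasure (lborel \<Otimes>\<^sub>M lborel) (box (l $ 1) (u $ 1) \<times> box (l $ 2) (u $ 2))"
    unfolding box[symmetric] lborel_prod using measurable_vector_2 by (subst emeasure_distr) simp_all
  also have "\<dots> = emeasure lborel (box (l $ 1) (u $ 1)) * emeasure lborel (box (l $ 2) (u $ 2))"
    by (rule lborel.emeasure_pair_measure_Times) simp_all
  also have "\<dots> = ennreal (u $ 1 - l $ 1) * ennreal (u $ 2 - l $ 2)"
    using le by simp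
  also have "\<dots> = ennreal ((u $ 1 - l $ 1) * (u $ 2 - l $ 2))"
    using le by (simp add: ennreal_mult)
  also have "(u $ 1 - l $ 1) * (u $ 2 - l $ 2) = (\<Prod>b\<in>Basis. (u - l) \<bullet> b)"
  proof -
    have B: "(Basis :: (real ^ 2) set) = range (\<lambda>i. axis i 1)" by (auto simp: Basis_vec_def)
    have inj: "inj (\<lambda>i :: 2. axis i (1 :: real))" by (auto simp: inj_on_def axis_eq_axis)
    have "(\<Prod>b\<in>Basis. (u - l) \<bullet> b) = (\<Prod>i\<in>UNIV. (u - l) \<bullet> axis i 1)"
      unfolding B by (subst prod.reindex[OF inj]) (simp only: o_def)
    then show ?thesis by (simp add: UNIV_2 inner_axis)
  qed
  finally show "emeasure (distr lborel borel (\<lambda>(x, y). vector [x, y] :: real ^ 2)) (box l u) = (\<Prod>b\<in>Basis. (u - l) \<bullet> b)" .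
qed simp

lemma emeasure_lborel_vec2:
  fixes S :: "(real ^ 2) set"
  assumes "S \<in> sets borel"
  shows "emeasure lborel S = emeasure lborel {(x, y). vector [x, y] \<in> S}"
proof -
  have "emeasure lborel S = emeasure (distr lborel borel (\<lambda>(x, y). vector [x, y] :: real ^ 2)) S"
    by (simp only: distr_vector_lborel)
  also have "\<dots> = emeasure lborel ((\<lambda>(x, y). vector [x, y] :: real ^ 2) -` S)"
    using measurable_vector_2 assms by (simp add: emeasure_distr)
  also have "(\<lambda>(x, y). vector [x, y] :: real ^ 2) -` S = {(x, y). vector [x, y] \<in> S}" by auto
  finally show ?thesis .
qed

context factored_form
begin

text \<open>The larger of the two coefficients of the small linear form decides the chart. Dividing
  by its modulus in place of the length costs a factor of at most 2, which raises 2^(d-1) to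
  2^d.\<close>

lemma exists_cusp:
  assumes K: "2 ^ d * height ^ (d - 2) * \<bar>bform d a x y\<bar> \<le> K"
  shows "\<exists>i<d. norm (v i) \<le> norm (u i) \<and> cusp d (- v i / u i) K x y
             \<or> norm (u i) \<le> norm (v i) \<and> cusp d (- u i / v i) K y x"
proof -
  obtain i where i: "i < d" and le: "norm (u i * x + v i * y) / len i * max \<bar>x\<bar> \<bar>y\<bar> ^ (d - 1)
      \<le> 2 ^ (d - 1) * height ^ (d - 2) * \<bar>bform d a x y\<bar>"
    using exists_small_linear_form by blast
  define r where "r = max \<bar>x\<bar> \<bar>y\<bar> ^ (d - 1)"
  define B where "B = height ^ (d - 2) * \<bar>bform d a x y\<bar>"
  have r: "0 \<le> r" by (simp add: r_def max_def)
  have two: "2 * (2 ^ (d - 1) * B) \<le> K"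
  proof -
    have "(2 :: real) ^ d = 2 * 2 ^ (d - 1)" using d by (cases d) auto
    then show ?thesis using K by (simp add: B_def mult.assoc)
  qed
  have le': "norm (u i * x + v i * y) / len i * r \<le> 2 ^ (d - 1) * B"
    using le by (simp add: r_def B_def mult.assoc)
  have len: "len i \<le> 2 * M" if M: "norm (u i) \<le> M" "norm (v i) \<le> M" for M
  proof -
    have "(norm (u i))\<^sup>2 + (norm (v i))\<^sup>2 \<le> M\<^sup>2 + M\<^sup>2"
      using M by (intro add_mono power_mono) auto
    also have "\<dots> \<le> (2 * M)\<^sup>2" by (simp add: power2_eq_square)
    finally have "(norm (u i))\<^sup>2 + (norm (v i))\<^sup>2 \<le> (2 * M)\<^sup>2" .
    moreover have "0 \<le> M" using norm_ge_zero M(1) by (rule order_trans)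
    ultimately show ?thesis unfolding len_def by (intro real_le_lsqrt) auto
  qed
  have bound: "norm l / w * r \<le> K" if l: "norm l = norm (u i * x + v i * y)" and w: "0 < w" "len i \<le> 2 * w" for l :: complex and w
  proof -
    have "norm l / w \<le> 2 * (norm l / len i)"
    proof -
      have "norm l / w \<le> norm l / (len i / 2)"
        using w len_pos[OF i] by (intro divide_left_mono) auto
      then show ?thesis by (simp add: mult.commute)
    qed
    then have "norm l / w * r \<le> 2 * (norm l / len i) * r" using r by (rule mult_right_mono)
    also have "\<dots> \<le> 2 * (2 ^ (d - 1) * B)" using le' unfolding l by simp
    finally show ?thesis using two by linarith
  qed
  show ?thesis
  proof (cases "norm (v i) \<le> norm (u i)")
    case True
    then have "u i \<noteq> 0" using len_pos[OF i] by (auto simp: len_def)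
    moreover from this have "norm (of_real x - - v i / u i * of_real y) = norm (u i * x + v i * y) / norm (u i)"
      by (simp add: norm_divide[symmetric] field_simps)
    ultimately have "cusp d (- v i / u i) K x y"
      using bound[of "u i * x + v i * y" "norm (u i)"] len[of "norm (u i)"] True
      by (simp add: cusp_def r_def)
    then show ?thesis using True i by blast
  next
    case False
    then have "v i \<noteq> 0" by auto
    moreover from this have "norm (of_real y - - u i / v i * of_real x) = norm (u i * x + v i * y) / norm (v i)"
      by (simp add: norm_divide[symmetric] field_simps)
    ultimately have "cusp d (- u i / v i) K y x"
      using bound[of "u i * x + v i * y" "norm (v i)"] len[of "norm (v i)"] False
      by (simp add: cusp_def r_def max.commute)
    then show ?thesis using False i by (intro exI[of _ i]) auto
  qed
qed

end

section \<open>Lattice points in the cusps\<close>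

lemma sum_inverse_squares_le:
  assumes "finite T" "0 \<notin> T"
  shows "(\<Sum>t\<in>T. 1 / (real t)\<^sup>2) \<le> 2"
proof -
  have tele: "(\<Sum>t\<in>{1..Suc n}. 1 / (real t)\<^sup>2) \<le> 2 - 1 / (real n + 1)" for n
  proof (induction n)
    case (Suc n)
    have "1 / (real n + 2)\<^sup>2 \<le> 1 / ((real n + 1) * (real n + 2))"
      by (intro divide_left_mono) (auto simp: power2_eq_square)
    also have "\<dots> = 1 / (real n + 1) - 1 / (real n + 2)" by (simp add: field_simps)
    finally have "1 / (real n + 2)\<^sup>2 \<le> 1 / (real n + 1) - 1 / (real n + 2)" .
    moreover have "(\<Sum>t\<in>{1..Suc (Suc n)}. 1 / (real t)\<^sup>2) = (\<Sum>t\<in>{1..Suc n}. 1 / (real t)\<^sup>2) + 1 / (real n + 2)\<^sup>2"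
      by (subst sum.nat_ivl_Suc') (simp_all add: add.commute)
    moreover have e: "real (Suc n) + 1 = real n + 2" by simp
    ultimately show ?case using Suc.IH unfolding e by linarith
  qed simp
  obtain n where "\<forall>t\<in>T. t < n" using assms(1) by (auto simp: finite_nat_set_iff_bounded)
  have "T \<subseteq> {1..Suc n}"
  proof
    fix t assume "t \<in> T"
    then have "t < n" "t \<noteq> 0" using \<open>\<forall>t\<in>T. t < n\<close> assms(2) by (blast, metis)
    then show "t \<in> {1..Suc n}" by simp
  qed
  then have "(\<Sum>t\<in>T. 1 / (real t)\<^sup>2) \<le> (\<Sum>t\<in>{1..Suc n}. 1 / (real t)\<^sup>2)" by (intro sum_mono2) auto
  also have "\<dots> \<le> 2 - 1 / (real n + 1)" by (rule tele)
  also have "\<dots> \<le> 2" by simp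
  finally show ?thesis .
qed

context factored_form
begin

text \<open>A point is written as sign times gcd t times a primitive point (p, q) with q > 0. The
  form is a nonzero integer at (p, q), hence t^d \<le> m; without the condition on zeros a rational
  line could contribute infinitely many points. The hypothesis \<open>RT\<close> keeps the lower
  bound R / (2t) for q at least 1.\<close>

lemma finite_card_far_points:
  fixes K R C :: real and m :: nat
  assumes \<alpha>: "norm \<alpha> \<le> 1" and K: "0 \<le> K" "K \<le> R ^ (d - 1)" and R: "R \<ge> 2"
    and m: "m \<ge> 1" and RT: "\<And>t. t ^ d \<le> m \<Longrightarrow> 2 * real t \<le> R"
    and approx: "\<And>\<kappa> T. 0 \<le> \<kappa> \<Longrightarrow> \<kappa> \<le> K \<Longrightarrow> 1 \<le> T \<Longrightarrow>
       finite {x \<in> approximations d \<alpha> \<kappa>. T \<le> real (snd x)} \<and>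
       real (card {x \<in> approximations d \<alpha> \<kappa>. T \<le> real (snd x)}) \<le> C + 16 * \<kappa> / T ^ (d - 2)"
  defines "S \<equiv> {(x :: int, y :: int). bform d a x y \<noteq> 0 \<and> \<bar>bform d a x y\<bar> \<le> int m \<and>
       cusp d \<alpha> K (of_int x) (of_int y) \<and> R \<le> max \<bar>of_int x\<bar> \<bar>of_int y\<bar>}"
  shows "finite S \<and> real (card S) \<le> 2 * (real (card {t. 1 \<le> t \<and> t ^ d \<le> m}) * C + 32 * K / (R / 2) ^ (d - 2))"
proof -
  define Ts where "Ts = {t :: nat. 1 \<le> t \<and> t ^ d \<le> m}"
  \<comment> \<open>With y = tq up to sign, the cusp bound divided by t becomes (K / t^d) / q^(d-1),
    and \<bar>y\<bar> \<ge> R/2 becomes the bound on q. The area term is then its value for t = 1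
    divided by t^2, so summing over t costs only a factor of 2.\<close>
  define Ap where "Ap t = {x \<in> approximations d \<alpha> (K / real t ^ d). R / (2 * real t) \<le> real (snd x)}" for t
  define g where "g = (\<lambda>(s, t, p, q). (s * int t * p, s * int t * int q))"
  have "Ts \<subseteq> {1..m}"
  proof
    fix t assume t: "t \<in> Ts"
    then have "t \<le> t ^ d" using d by (intro self_le_power) (auto simp: Ts_def)
    then show "t \<in> {1..m}" using t by (auto simp: Ts_def)
  qed
  then have finT: "finite Ts" by (rule finite_subset) simp
  have Ap: "finite (Ap t) \<and> real (card (Ap t)) \<le> C + 16 * (K / (R / 2) ^ (d - 2)) * (1 / (real t)\<^sup>2)" if t: "t \<in> Ts" for t
  proof -
    have t1: "real t \<ge> 1" using t by (simp add: Ts_def)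
    have "K / real t ^ d \<le> K / 1" using K t1 by (intro divide_left_mono) (auto simp: one_le_power)
    moreover have "1 \<le> R / (2 * real t)" using RT[of t] t t1 by (simp add: Ts_def)
    ultimately have "finite (Ap t) \<and> real (card (Ap t)) \<le> C + 16 * (K / real t ^ d) / (R / (2 * real t)) ^ (d - 2)"
      using approx[of "K / real t ^ d" "R / (2 * real t)"] K t1 by (simp add: Ap_def)
    moreover have "16 * (K / real t ^ d) / (R / (2 * real t)) ^ (d - 2) = 16 * (K / (R / 2) ^ (d - 2)) * (1 / (real t)\<^sup>2)"
    proof -
      obtain e where e: "d = e + 2" using d by (metis add.commute le_Suc_ex numeral_2_eq_2 numeral_3_eq_3 Suc_leD)
      have "R / (2 * real t) = R / 2 / real t" by simp
      then show ?thesis using t1 R by (simp add: e power_add power_divide power2_eq_square)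
    qed
    ultimately show ?thesis by (simp only:)
  qed
  have sub: "S \<subseteq> g ` ({1, -1} \<times> Sigma Ts Ap)"
  proof
    fix z assume "z \<in> S"
    then obtain x y where z: "z = (x, y)" and S: "bform d a x y \<noteq> 0" "\<bar>bform d a x y\<bar> \<le> int m"
      "cusp d \<alpha> K (of_int x) (of_int y)" "R \<le> max \<bar>of_int x\<bar> \<bar>of_int y\<bar>"
      by (auto simp: S_def)
    note far = cusp_far[OF \<alpha> K R S(3,4)]
    have y0: "y \<noteq> 0" using far(1) R by auto
    define t where "t = nat (gcd x y)"
    have t: "int t = gcd x y" by (simp add: t_def)
    have g0: "gcd x y \<noteq> 0" using y0 by simp
    obtain x' y' where xy: "x = x' * gcd x y" "y = y' * gcd x y" "coprime x' y'"
      using gcd_coprime_exists[OF g0] by blast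
    define s p q where "s = sgn y'" and "p = s * x'" and "q = nat \<bar>y'\<bar>"
    have y'0: "y' \<noteq> 0" using xy(2) y0 by auto
    have s: "s = 1 \<or> s = -1" using y'0 by (auto simp: s_def sgn_if)
    have ss: "s * s = 1" using s by auto
    have q: "int q = s * y'" using y'0 by (auto simp: q_def s_def sgn_if)
    have xs: "x' = s * p" "y' = s * int q" unfolding p_def q by (simp_all add: ss flip: mult.assoc)
    have x: "x = s * int t * p" "y = s * int t * int q"
      unfolding t using xy(1,2) xs by (simp_all add: mult_ac)
    have t1: "t \<ge> 1" using g0 t by (metis One_nat_def Suc_leI gr0I of_nat_0)
    have q0: "q > 0" using y'0 by (simp add: q_def)
    have "coprime p (int q)" using xy(3) s unfolding q p_def by auto
    have bf: "bform d a x y = (s * int t) ^ d * bform d a p (int q)"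
      unfolding x by (rule bform_scale)
    have "t ^ d \<le> m"
    proof -
      have "bform d a p (int q) \<noteq> 0" using S(1) bf by auto
      then have "1 \<le> \<bar>bform d a p (int q)\<bar>" by simp
      then have "int t ^ d * 1 \<le> int t ^ d * \<bar>bform d a p (int q)\<bar>" by (intro mult_left_mono) auto
      also have "\<dots> = \<bar>bform d a x y\<bar>" using s unfolding bf by (auto simp: abs_mult power_abs power_mult_distrib)
      finally have "int t ^ d \<le> int m" using S(2) by linarith
      then show ?thesis by simp
    qed
    then have "t \<in> Ts" using t1 by (simp add: Ts_def)
    moreover have "(p, q) \<in> Ap t"
    proof -
      have absy: "\<bar>of_int y\<bar> = real t * real q"
        using s unfolding x by (auto simp: abs_mult)
      have "R / 2 \<le> real t * real q" using far(1) absy by simp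
      then have 1: "R / (2 * real t) \<le> real q" using t1 by (simp add: field_simps)
      have eq: "of_real (of_int x) - \<alpha> * of_real (of_int y) = of_int s * (of_nat t * (of_int p - \<alpha> * of_nat q))"
        unfolding x by (simp add: algebra_simps)
      have "norm (of_int s :: complex) = 1" using s by auto
      then have "norm (of_real (of_int x) - \<alpha> * of_real (of_int y)) = real t * norm (of_int p - \<alpha> * of_nat q)"
        unfolding eq by (simp add: norm_mult)
      then have "real t * norm (of_int p - \<alpha> * of_nat q) \<le> K / (real t * real q) ^ (d - 1)"
        using far(2) absy by simp
      then have le: "norm (of_int p - \<alpha> * of_nat q) * real t \<le> K / (real t * real q) ^ (d - 1)"
        by (subst mult.commute)
      have "0 < real t" using t1 by simp
      from this le have "norm (of_int p - \<alpha> * of_nat q) \<le> K / (real t * real q) ^ (d - 1) / real t"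
        by (rule mult_imp_le_div_pos)
      also have "\<dots> = (K / real t ^ d) / real q ^ (d - 1)"
        using d by (cases d) (simp_all add: power_mult_distrib mult_ac)
      finally show ?thesis using 1 q0 \<open>coprime p (int q)\<close> by (simp add: Ap_def approximations_def)
    qed
    moreover have "z = g (s, t, p, q)" by (simp add: g_def z x)
    ultimately show "z \<in> g ` ({1, -1} \<times> Sigma Ts Ap)" using s by (intro image_eqI[of _ _ "(s, t, p, q)"]) auto
  qed
  have fin: "finite (Sigma Ts Ap)" using finT Ap by (intro finite_SigmaI) auto
  then have fin2: "finite ({1, -1 :: int} \<times> Sigma Ts Ap)" by simp
  have "card S \<le> card ({1, -1 :: int} \<times> Sigma Ts Ap)"
    using card_mono[OF _ sub] card_image_le[OF fin2, of g] fin2 by (meson finite_imageI order_trans)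
  also have "\<dots> = 2 * (\<Sum>t\<in>Ts. card (Ap t))"
    using finT Ap by (simp add: card_cartesian_product card_SigmaI)
  finally have "real (card S) \<le> real (2 * (\<Sum>t\<in>Ts. card (Ap t)))" by (rule of_nat_mono)
  also have "\<dots> = 2 * (\<Sum>t\<in>Ts. real (card (Ap t)))" by simp
  also have "\<dots> \<le> 2 * (\<Sum>t\<in>Ts. C + 16 * (K / (R / 2) ^ (d - 2)) * (1 / (real t)\<^sup>2))"
    using Ap by (intro mult_left_mono sum_mono) auto
  also have "(\<Sum>t\<in>Ts. C + 16 * (K / (R / 2) ^ (d - 2)) * (1 / (real t)\<^sup>2)) =
      real (card Ts) * C + 16 * (K / (R / 2) ^ (d - 2)) * (\<Sum>t\<in>Ts. 1 / (real t)\<^sup>2)"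
    by (simp only: sum.distrib sum_constant sum_distrib_left)
  also have "\<dots> \<le> real (card Ts) * C + 16 * (K / (R / 2) ^ (d - 2)) * 2"
    using sum_inverse_squares_le[OF finT] K R
    by (intro add_mono mult_left_mono) (auto simp: Ts_def)
  finally have "real (card S) \<le> 2 * (real (card Ts) * C + 32 * K / (R / 2) ^ (d - 2))" by simp
  moreover have "finite S" using finite_subset[OF sub] fin2 by simp
  ultimately show ?thesis by (simp only: Ts_def)
qed

section \<open>The region inside and outside a square\<close>

definition region :: "nat \<Rightarrow> (real \<times> real) set" where
  "region m = {(x, y). \<bar>bform d a x y\<bar> \<le> real m}"

lemma closed_region: "closed (region m)"
proof -
  have "region m = {z. \<bar>bform d a (fst z) (snd z)\<bar> \<le> real m}" by (auto simp: region_def)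
  moreover have "closed {z :: real \<times> real. \<bar>bform d a (fst z) (snd z)\<bar> \<le> real m}"
    unfolding bform_def by (intro closed_Collect_le continuous_intros)
  ultimately show ?thesis by simp
qed

lemma box_discrepancy:
  fixes R m :: nat
  shows "\<bar>real (card {(x, y). x \<in> {- int R..<int R} \<and> y \<in> {- int R..<int R} \<and> \<bar>bform d a x y\<bar> \<le> int m})
    - measure lborel (region m \<inter> {- real R..<real R} \<times> {- real R..<real R})\<bar> \<le> 8 * real d * real R"
proof -
  have int_iff: "(of_int x, of_int y) \<in> region m \<longleftrightarrow> \<bar>bform d a x y\<bar> \<le> int m" for x y
  proof -
    have "\<bar>bform d a (of_int x) (of_int y) :: real\<bar> = of_int \<bar>bform d a x y\<bar>" by (simp add: of_int_bform)
    then have "(of_int x, of_int y) \<in> region m \<longleftrightarrow> of_int \<bar>bform d a x y\<bar> \<le> (of_int (int m) :: real)"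
      by (simp add: region_def)
    then show ?thesis by (simp only: of_int_le_iff)
  qed
  have "\<bar>real (card {(x, y). x \<in> {- int R..<int R} \<and> y \<in> {- int R..<int R} \<and> (of_int x, of_int y) \<in> region m})
    - measure lborel (region m \<inter> {- real R..<real R} \<times> {- real R..<real R})\<bar> \<le> 4 * real R * (2 * real d)"
  proof (rule lattice_discrepancy_square[OF closed_region])
    fix x :: real
    define p where "p = (\<Sum>i\<le>d. monom (of_int (a i) * x ^ i) (d - i))"
    have "degree p \<le> d"
      unfolding p_def by (intro degree_sum_le) (auto intro: order_trans[OF degree_monom_le])
    moreover have "{y. (x, y) \<in> region m} = {t. \<bar>poly p t\<bar> \<le> real m}"
      by (simp add: region_def p_def bform_poly_snd)
    ultimately show "\<bar>real (card {n \<in> {- int R..<int R}. (x, of_int n) \<in> region m})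
        - measure lborel ({y. (x, y) \<in> region m} \<inter> {- real R..<real R})\<bar> \<le> 2 * real d"
      using poly_slice_discrepancy[of p d R "real m"] by (simp add: set_eq_iff)
  next
    fix y :: real
    define p where "p = (\<Sum>i\<le>d. monom (of_int (a i) * y ^ (d - i)) i)"
    have "degree p \<le> d"
      unfolding p_def by (intro degree_sum_le) (auto intro: order_trans[OF degree_monom_le])
    moreover have "{x. (x, y) \<in> region m} = {t. \<bar>poly p t\<bar> \<le> real m}"
      by (simp add: region_def p_def bform_poly_fst)
    ultimately show "\<bar>real (card {n \<in> {- int R..<int R}. (of_int n, y) \<in> region m})
        - measure lborel ({x. (x, y) \<in> region m} \<inter> {- real R..<real R})\<bar> \<le> 2 * real d"
      using poly_slice_discrepancy[of p d R "real m"] by (simp add: set_eq_iff)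
  qed simp
  then show ?thesis by (simp only: int_iff) (simp add: mult_ac)
qed

text \<open>Zeros of the form satisfy \<bar>F\<bar> \<le> m but are not counted, so they must be
  removed from the lattice count of the square. Each linear factor vanishes at no more than one
  point per row, or per column.\<close>

lemma card_zeros_in_box:
  fixes R :: nat
  defines "Z \<equiv> {(x, y). x \<in> {- int R..<int R} \<and> y \<in> {- int R..<int R} \<and> bform d a x y = 0}"
  shows "card Z \<le> 2 * d * R"
proof -
  define I where "I = {- int R..<int R}"
  define L where "L i = {(x, y). x \<in> I \<and> y \<in> I \<and> u i * of_int x + v i * of_int y = 0}" for i
  have fin: "finite (L i)" for i by (rule finite_subset[of _ "I \<times> I"]) (auto simp: L_def I_def)
  have "Z \<subseteq> (\<Union>i<d. L i)"
  proof
    fix z assume "z \<in> Z"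
    then obtain x y where z: "z = (x, y)" "x \<in> I" "y \<in> I" "bform d a x y = 0" by (auto simp: Z_def I_def)
    have "bform d a (of_int x) (of_int y) = (0 :: complex)" using z(4) by (simp add: of_int_bform)
    then obtain i where "i < d" "u i * of_int x + v i * of_int y = 0" by (auto simp: factorization)
    then show "z \<in> (\<Union>i<d. L i)" using z by (auto simp: L_def)
  qed
  then have "card Z \<le> card (\<Union>i<d. L i)" using fin by (intro card_mono) auto
  also have "\<dots> \<le> (\<Sum>i<d. card (L i))" by (rule card_UN_le) simp
  also have "\<dots> \<le> (\<Sum>i<d. 2 * R)"
  proof (rule sum_mono)
    fix i assume "i \<in> {..<d}"
    then have "u i \<noteq> 0 \<or> v i \<noteq> 0" using len_pos[of i] by (auto simp: len_def)
    then have "card (L i) \<le> card I"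
    proof
      assume u: "u i \<noteq> 0"
      have "x = x'" if "(x, y) \<in> L i" "(x', y) \<in> L i" for x x' y
      proof -
        have "u i * of_int x = u i * of_int x'" using that by (auto simp: L_def add_eq_0_iff2)
        then show ?thesis using u by simp
      qed
      then have "inj_on snd (L i)" by (intro inj_onI) (auto simp: prod_eq_iff)
      then show ?thesis by (rule card_inj_on_le) (auto simp: L_def I_def)
    next
      assume v: "v i \<noteq> 0"
      have "y = y'" if "(x, y) \<in> L i" "(x, y') \<in> L i" for x y y'
      proof -
        have "v i * of_int y = v i * of_int y'" using that by (auto simp: L_def add_eq_0_iff)
        then show ?thesis using v by simp
      qed
      then have "inj_on fst (L i)" by (intro inj_onI) (auto simp: prod_eq_iff)
      then show ?thesis by (rule card_inj_on_le) (auto simp: L_def I_def)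
    qed
    then show "card (L i) \<le> 2 * R" by (simp add: I_def)
  qed
  also have "\<dots> = 2 * d * R" by simp
  finally show ?thesis .
qed

text \<open>For real points \<bar>x - \<alpha>y\<bar> dominates its real part, so the cusp of a
  nonreal root lies inside that of the real number \<open>Re \<alpha>\<close>. Each linear factor is
  given one cusp in either chart, hence 8 = 4 + 4.\<close>

lemma emeasure_region_outside_box_le:
  fixes K :: real and R m :: nat
  assumes K: "2 ^ d * height ^ (d - 2) * real m \<le> K" "K \<le> real R ^ (d - 1)" and R: "R \<ge> 2"
  shows "emeasure lborel (region m - {- real R..<real R} \<times> {- real R..<real R})
     \<le> ennreal (real d * (8 * K / (real R / 2) ^ (d - 2)))"
proof -
  define s where "s = real R / 2"
  define T where "T \<beta> = {(x, y). s \<le> \<bar>y\<bar> \<and> \<bar>x - \<beta> * y\<bar> \<le> K / \<bar>y\<bar> ^ (d - 1)}" for \<beta>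
  define W where "W i = T (Re (- v i / u i)) \<union> {(x, y). (y, x) \<in> T (Re (- u i / v i))}" for i
  have K0: "K \<ge> 0"
  proof -
    have "0 \<le> 2 ^ d * height ^ (d - 2) * real m" using height_pos by simp
    then show ?thesis using K by linarith
  qed
  have s: "s > 0" using R by (simp add: s_def)
  have T: "T \<beta> \<in> sets borel" "emeasure lborel (T \<beta>) \<le> ennreal (4 * K / s ^ (d - 2))" for \<beta>
    using emeasure_cusp_tail_le[OF d K0 s] unfolding T_def by blast+
  have W: "W i \<in> sets borel" "emeasure lborel (W i) \<le> ennreal (8 * K / s ^ (d - 2))" for i
  proof -
    show "W i \<in> sets borel" unfolding W_def using T emeasure_lborel_swap(1)[OF T(1)] by blast
    have "emeasure lborel (W i) \<le> emeasure lborel (T (Re (- v i / u i))) + emeasure lborel {(x, y). (y, x) \<in> T (Re (- u i / v i))}"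
      unfolding W_def using T emeasure_lborel_swap(1)[OF T(1)] by (intro emeasure_subadditive) auto
    also have "\<dots> \<le> ennreal (4 * K / s ^ (d - 2)) + ennreal (4 * K / s ^ (d - 2))"
      using T emeasure_lborel_swap(2)[OF T(1)] by (intro add_mono) auto
    also have "\<dots> = ennreal (8 * K / s ^ (d - 2))"
      using K0 s by (subst ennreal_plus[symmetric]) auto
    finally show "emeasure lborel (W i) \<le> ennreal (8 * K / s ^ (d - 2))" .
  qed
  have Re_le: "\<bar>x - Re \<alpha> * y\<bar> \<le> norm (of_real x - \<alpha> * of_real y)" for x y \<alpha>
    using abs_Re_le_cmod[of "of_real x - \<alpha> * of_real y"] by simp
  have in_T: "(x, y) \<in> T (Re \<alpha>)" if "norm \<alpha> \<le> 1" "cusp d \<alpha> K x y" "real R \<le> max \<bar>x\<bar> \<bar>y\<bar>" for \<alpha> x y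
    using cusp_far[OF that(1) K0 K(2) _ that(2,3)] Re_le[of x \<alpha> y] R by (auto simp: T_def s_def)
  have "region m - {- real R..<real R} \<times> {- real R..<real R} \<subseteq> (\<Union>i<d. W i)"
  proof
    fix z assume z: "z \<in> region m - {- real R..<real R} \<times> {- real R..<real R}"
    obtain x y where xy: "z = (x, y)" by (cases z)
    have far: "real R \<le> max \<bar>x\<bar> \<bar>y\<bar>" using z by (auto simp: xy max_def abs_if split: if_splits)
    have "2 ^ d * height ^ (d - 2) * \<bar>bform d a x y\<bar> \<le> 2 ^ d * height ^ (d - 2) * real m"
      using z height_pos by (intro mult_left_mono) (auto simp: xy region_def)
    then have "2 ^ d * height ^ (d - 2) * \<bar>bform d a x y\<bar> \<le> K" using K by linarith
    from exists_cusp[OF this] obtain i where i: "i < d" and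
      "norm (v i) \<le> norm (u i) \<and> cusp d (- v i / u i) K x y \<or> norm (u i) \<le> norm (v i) \<and> cusp d (- u i / v i) K y x"
      by blast
    then consider "norm (- v i / u i) \<le> 1" "cusp d (- v i / u i) K x y" | "norm (- u i / v i) \<le> 1" "cusp d (- u i / v i) K y x"
      by (auto simp: norm_divide divide_le_eq_1)
    then have "z \<in> W i"
    proof cases
      case 1
      then show ?thesis using in_T[of "- v i / u i" x y] far by (simp add: W_def xy)
    next
      case 2
      then show ?thesis using in_T[of "- u i / v i" y x] far by (simp add: W_def xy max.commute)
    qed
    then show "z \<in> (\<Union>i<d. W i)" using i by blast
  qed
  then have "emeasure lborel (region m - {- real R..<real R} \<times> {- real R..<real R}) \<le> emeasure lborel (\<Union>i<d. W i)"
    using W by (intro emeasure_mono) auto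
  also have "\<dots> \<le> (\<Sum>i<d. emeasure lborel (W i))"
    using W by (intro emeasure_subadditive_finite) auto
  also have "\<dots> \<le> (\<Sum>i<d. ennreal (8 * K / s ^ (d - 2)))" using W by (intro sum_mono) auto
  also have "\<dots> = ennreal (\<Sum>i<d. 8 * K / s ^ (d - 2))" using K0 s by (intro sum_ennreal) auto
  also have "(\<Sum>i<d. 8 * K / s ^ (d - 2)) = real d * (8 * K / (real R / 2) ^ (d - 2))" by (simp add: s_def)
  finally show ?thesis .
qed

lemma measure_region_outside_box:
  fixes K :: real and R m :: nat
  assumes K: "2 ^ d * height ^ (d - 2) * real m \<le> K" "K \<le> real R ^ (d - 1)" and R: "R \<ge> 2"
  shows "emeasure lborel (region m) < \<infinity>"
    "\<bar>measure lborel (region m) - measure lborel (region m \<inter> {- real R..<real R} \<times> {- real R..<real R})\<bar>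
       \<le> real d * (8 * K / (real R / 2) ^ (d - 2))"
proof -
  define Q where "Q = {- real R..<real R} \<times> {- real R..<real R}"
  define B where "B = real d * (8 * K / (real R / 2) ^ (d - 2))"
  have K0: "K \<ge> 0"
  proof -
    have "0 \<le> 2 ^ d * height ^ (d - 2) * real m" using height_pos by simp
    then show ?thesis using K by linarith
  qed
  have B0: "0 \<le> B" using K0 by (simp add: B_def)
  have D: "region m \<in> sets borel" using closed_region by (rule borel_closed)
  have Q: "Q \<in> sets borel" unfolding Q_def borel_prod[symmetric] by simp
  have Qsub: "Q \<subseteq> cbox (- real R, - real R) (real R, real R)" by (auto simp: Q_def cbox_Pair_eq)
  have "emeasure lborel (region m \<inter> Q) \<le> emeasure lborel (cbox (- real R, - real R) (real R, real R))"
    using Qsub by (intro emeasure_mono) auto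
  also have "\<dots> < \<infinity>" by (rule emeasure_lborel_cbox_finite)
  finally have in_fin: "emeasure lborel (region m \<inter> Q) < \<infinity>" .
  have out: "emeasure lborel (region m - Q) \<le> ennreal B"
    unfolding Q_def B_def by (rule emeasure_region_outside_box_le[OF K R])
  then have out_fin: "emeasure lborel (region m - Q) < \<infinity>"
    by (rule le_less_trans) simp
  have split: "region m = (region m \<inter> Q) \<union> (region m - Q)" by blast
  have "emeasure lborel (region m) \<le> emeasure lborel (region m \<inter> Q) + emeasure lborel (region m - Q)"
    using D Q by (subst split) (intro emeasure_subadditive; auto)
  then show "emeasure lborel (region m) < \<infinity>"
    using in_fin out_fin by (auto simp: less_top[symmetric] top_unique)
  have "measure lborel (region m) = measure lborel (region m \<inter> Q) + measure lborel (region m - Q)"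
    using D Q in_fin out_fin by (subst split) (intro measure_Union; auto)
  moreover have "measure lborel (region m - Q) \<le> B"
    unfolding measure_def using out B0 by (rule enn2real_leI[rotated])
  ultimately have "\<bar>measure lborel (region m) - measure lborel (region m \<inter> Q)\<bar> \<le> B" by simp
  then show "\<bar>measure lborel (region m) - measure lborel (region m \<inter> {- real R..<real R} \<times> {- real R..<real R})\<bar>
       \<le> real d * (8 * K / (real R / 2) ^ (d - 2))"
    by (simp only: Q_def B_def)
qed

lemma measure_region_scale:
  assumes "m \<ge> 1"
  shows "measure lborel (region m) = real m powr (2 / real d) * measure lborel (region 1)"
proof -
  define c where "c = real m powr (1 / real d)"
  have c: "c > 0" using assms by (simp add: c_def)
  have cd: "c ^ d = real m"
    using d assms by (simp add: c_def powr_realpow[symmetric] powr_powr)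
  have "region m = (\<lambda>z. 0 + c *\<^sub>R z) ` region 1"
  proof (intro equalityI subsetI)
    fix z assume z: "z \<in> region m"
    obtain x y where xy: "z = (x, y)" by (cases z)
    have "bform d a x y = c ^ d * bform d a (x / c) (y / c)"
      using bform_scale[of d a c "x / c" "y / c"] c by simp
    then have "real m * \<bar>bform d a (x / c) (y / c)\<bar> \<le> real m * 1"
      using z by (simp add: xy region_def cd abs_mult)
    then have "(x / c, y / c) \<in> region 1" using assms by (simp add: region_def)
    moreover have "z = 0 + c *\<^sub>R (x / c, y / c)" using c by (simp add: xy)
    ultimately show "z \<in> (\<lambda>z. 0 + c *\<^sub>R z) ` region 1" by blast
  next
    fix z assume "z \<in> (\<lambda>z. 0 + c *\<^sub>R z) ` region 1"
    then obtain w where w: "w \<in> region 1" "z = 0 + c *\<^sub>R w" by blast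
    obtain x y where "w = (x, y)" by (cases w)
    then have xy: "z = (c * x, c * y)" "\<bar>bform d a x y\<bar> \<le> 1" using w by (simp_all add: region_def)
    have "\<bar>bform d a (c * x) (c * y)\<bar> = real m * \<bar>bform d a x y\<bar>"
      unfolding bform_scale by (simp add: abs_mult cd)
    then show "z \<in> region m" using xy mult_left_mono[of "\<bar>bform d a x y\<bar>" 1 "real m"] by (simp add: region_def)
  qed
  then have "measure lebesgue (region m) = \<bar>c\<bar> ^ DIM(real \<times> real) * measure lebesgue (region 1)"
    using measure_lebesgue_affine[of c 0 "region 1"] by simp
  moreover have "measure lebesgue (region n) = measure lborel (region n)" for n
    using closed_region[of n] by (intro measure_completion) (auto intro: borel_closed)
  moreover have "c ^ 2 = real m powr (2 / real d)"
    using c assms by (simp add: c_def powr_realpow[symmetric] powr_powr)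
  ultimately show ?thesis using c by (simp add: power2_eq_square)
qed

definition nonzero_points :: "nat \<Rightarrow> (int \<times> int) set" where
  "nonzero_points m = {(x, y). 0 < \<bar>bform d a x y\<bar> \<and> \<bar>bform d a x y\<bar> \<le> int m}"

text \<open>Per linear factor, 8R comes from the discrepancy in the square and 2R from the zeros in
  it; the term with 8K is the area outside, and 4B bounds the far points of two charts at 2B each.
  The cusps may overlap, since only an upper bound for the far points is needed.\<close>

lemma count_estimate:
  fixes K C :: real and A R m :: nat
  assumes K: "2 ^ d * height ^ (d - 2) * real m \<le> K" "K \<le> real R ^ (d - 1)" and R: "R \<ge> 2"
    and m: "m \<ge> 1" and RT: "\<And>t. t ^ d \<le> m \<Longrightarrow> 2 * t \<le> R"
    and A: "real (d + 1) * 2 ^ d * height \<le> real A"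
    and approx: "\<And>\<alpha> \<kappa> T. bounded_root d A \<alpha> \<Longrightarrow>
       0 \<le> \<kappa> \<Longrightarrow> \<kappa> \<le> K \<Longrightarrow> 1 \<le> T \<Longrightarrow>
       finite {x \<in> approximations d \<alpha> \<kappa>. T \<le> real (snd x)} \<and>
       real (card {x \<in> approximations d \<alpha> \<kappa>. T \<le> real (snd x)}) \<le> C + 16 * \<kappa> / T ^ (d - 2)"
  defines "B \<equiv> real (card {t. 1 \<le> t \<and> t ^ d \<le> m}) * C + 32 * K / (real R / 2) ^ (d - 2)"
  shows "finite (nonzero_points m)"
    "\<bar>real (card (nonzero_points m)) - measure lborel (region m)\<bar>
       \<le> real d * (10 * real R + 8 * K / (real R / 2) ^ (d - 2) + 4 * B)"
proof -
  define I where "I = {- int R..<int R}"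
  define S where "S i = {(x :: int, y :: int). bform d a x y \<noteq> 0 \<and> \<bar>bform d a x y\<bar> \<le> int m \<and>
     cusp d (- v i / u i) K (of_int x) (of_int y) \<and> real R \<le> max \<bar>of_int x\<bar> \<bar>of_int y\<bar>}" for i
  define S' where "S' i = {(x :: int, y :: int). bform d (\<lambda>i. a (d - i)) x y \<noteq> 0 \<and> \<bar>bform d (\<lambda>i. a (d - i)) x y\<bar> \<le> int m \<and>
     cusp d (- u i / v i) K (of_int x) (of_int y) \<and> real R \<le> max \<bar>of_int x\<bar> \<bar>of_int y\<bar>}" for i
  define U where "U i = (if norm (v i) \<le> norm (u i) then S i else {}) \<union>
     prod.swap ` (if norm (u i) \<le> norm (v i) then S' i else {})" for i
  have K0: "K \<ge> 0"
  proof -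
    have "0 \<le> 2 ^ d * height ^ (d - 2) * real m" using height_pos by simp
    then show ?thesis using K by linarith
  qed
  have RT': "2 * real t \<le> real R" if "t ^ d \<le> m" for t
  proof -
    have "real (2 * t) \<le> real R" using RT[OF that] by (rule of_nat_mono)
    then show ?thesis by simp
  qed
  have S: "finite (S i) \<and> real (card (S i)) \<le> 2 * B" if i: "i < d" "norm (v i) \<le> norm (u i)" for i
  proof -
    have br: "bounded_root d A (- v i / u i)" using i A by (rule bounded_root)
    then have "norm (- v i / u i) \<le> 1" by (simp only: bounded_root_def)
    then show ?thesis
      unfolding S_def B_def using R m RT' approx[OF br]
      by (intro finite_card_far_points[OF _ K0 K(2)]) auto
  qed
  have S': "finite (S' i) \<and> real (card (S' i)) \<le> 2 * B" if i: "i < d" "norm (u i) \<le> norm (v i)" for i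
  proof -
    have br: "bounded_root d A (- u i / v i)"
      using factored_form.bounded_root[OF swapped i] A by (simp only: swapped_height)
    then have "norm (- u i / v i) \<le> 1" by (simp only: bounded_root_def)
    then show ?thesis
      unfolding S'_def B_def using R m RT' approx[OF br]
      by (intro factored_form.finite_card_far_points[OF swapped _ K0 K(2)]) auto
  qed
  have U: "finite (U i) \<and> real (card (U i)) \<le> 4 * B" if i: "i < d" for i
  proof -
    define X Y where "X = (if norm (v i) \<le> norm (u i) then S i else {})"
      and "Y = (if norm (u i) \<le> norm (v i) then S' i else {})"
    have B0: "0 \<le> B" using S[OF i] S'[OF i] by linarith
    have X: "finite X" "real (card X) \<le> 2 * B" using S[OF i] B0 by (auto simp: X_def)
    have Y: "finite Y" "real (card Y) \<le> 2 * B" using S'[OF i] B0 by (auto simp: Y_def)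
    have "card (U i) \<le> card X + card Y"
      unfolding U_def X_def[symmetric] Y_def[symmetric]
      using card_Un_le[of X "prod.swap ` Y"] card_image_le[OF Y(1), of prod.swap] by linarith
    then have "real (card (U i)) \<le> 4 * B" using X Y by linarith
    moreover have "finite (U i)" unfolding U_def X_def[symmetric] Y_def[symmetric] using X Y by simp
    ultimately show ?thesis by blast
  qed
  define Near where "Near = {(x, y). x \<in> I \<and> y \<in> I \<and> \<bar>bform d a x y\<bar> \<le> int m}"
  define Zero where "Zero = {(x, y). x \<in> I \<and> y \<in> I \<and> bform d a x y = 0}"
  define Far where "Far = nonzero_points m - I \<times> I"
  have finN: "finite Near" by (rule finite_subset[of _ "I \<times> I"]) (auto simp: Near_def I_def)
  have "Far \<subseteq> (\<Union>i<d. U i)"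
  proof
    fix z assume z: "z \<in> Far"
    obtain x y where xy: "z = (x, y)" by (cases z)
    have pt: "bform d a x y \<noteq> 0" "\<bar>bform d a x y\<bar> \<le> int m" "x \<notin> I \<or> y \<notin> I"
      using z by (auto simp: xy Far_def nonzero_points_def)
    have "int R \<le> \<bar>x\<bar> \<or> int R \<le> \<bar>y\<bar>" using pt(3) by (auto simp: I_def)
    then have "real_of_int (int R) \<le> of_int \<bar>x\<bar> \<or> real_of_int (int R) \<le> of_int \<bar>y\<bar>" by (simp only: of_int_le_iff)
    then have far: "real R \<le> max \<bar>of_int x\<bar> \<bar>of_int y\<bar>" by auto
    have "real_of_int \<bar>bform d a x y\<bar> \<le> real_of_int (int m)" using pt(2) by (simp only: of_int_le_iff)
    then have "\<bar>bform d a (real_of_int x) (real_of_int y)\<bar> \<le> real m" by (simp add: of_int_bform)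
    then have "2 ^ d * height ^ (d - 2) * \<bar>bform d a (real_of_int x) (real_of_int y)\<bar> \<le> 2 ^ d * height ^ (d - 2) * real m"
      using height_pos by (intro mult_left_mono) auto
    then have "2 ^ d * height ^ (d - 2) * \<bar>bform d a (real_of_int x) (real_of_int y)\<bar> \<le> K" using K by linarith
    from exists_cusp[OF this] obtain i where i: "i < d" and
      cs: "norm (v i) \<le> norm (u i) \<and> cusp d (- v i / u i) K (of_int x) (of_int y)
       \<or> norm (u i) \<le> norm (v i) \<and> cusp d (- u i / v i) K (of_int y) (of_int x)"
      by blast
    from cs have "z \<in> U i"
    proof
      assume c: "norm (v i) \<le> norm (u i) \<and> cusp d (- v i / u i) K (of_int x) (of_int y)"
      then have "(x, y) \<in> S i" using pt far by (simp add: S_def)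
      then show ?thesis using c by (simp add: U_def xy)
    next
      assume c: "norm (u i) \<le> norm (v i) \<and> cusp d (- u i / v i) K (of_int y) (of_int x)"
      then have "(y, x) \<in> S' i" using pt far by (simp add: S'_def bform_swap max.commute)
      then have "(x, y) \<in> prod.swap ` S' i" by (force simp: image_iff)
      then show ?thesis using c by (simp add: U_def xy)
    qed
    then show "z \<in> (\<Union>i<d. U i)" using i by blast
  qed
  moreover have "finite (\<Union>i<d. U i)" using U by blast
  ultimately have finF: "finite Far" and cF: "card Far \<le> card (\<Union>i<d. U i)"
    by (auto intro: finite_subset card_mono)
  have "card (\<Union>i<d. U i) \<le> (\<Sum>i<d. card (U i))" by (rule card_UN_le) simp
  with cF have "card Far \<le> (\<Sum>i<d. card (U i))" by (rule order_trans)
  then have "real (card Far) \<le> real (\<Sum>i<d. card (U i))" by (rule of_nat_mono)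
  also have "\<dots> = (\<Sum>i<d. real (card (U i)))" by simp
  also have "\<dots> \<le> (\<Sum>i<d. 4 * B)" using U by (intro sum_mono) auto
  finally have cardF: "real (card Far) \<le> real d * (4 * B)" by simp
  have parts: "nonzero_points m = (Near - Zero) \<union> Far"
    by (auto simp: nonzero_points_def Near_def Zero_def Far_def)
  then show fin: "finite (nonzero_points m)" using finN finF by simp
  have sub: "Zero \<subseteq> Near" by (auto simp: Zero_def Near_def)
  have "(Near - Zero) \<inter> Far = {}" by (auto simp: Near_def Far_def)
  then have "card (nonzero_points m) = card (Near - Zero) + card Far"
    unfolding parts using finN finF by (intro card_Un_disjoint) auto
  moreover have "card (Near - Zero) + card Zero = card Near"
    using finN sub by (metis card_Diff_subset card_mono finite_subset le_add_diff_inverse2)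
  ultimately have "real (card (nonzero_points m)) + real (card Zero) = real (card Near) + real (card Far)"
    by (metis (no_types) add.assoc add.commute of_nat_add)
  moreover have "real (card Zero) \<le> 2 * real d * real R"
  proof -
    have "real (card Zero) \<le> real (2 * d * R)"
      using card_zeros_in_box[of R] by (intro of_nat_mono) (simp only: Zero_def I_def)
    then show ?thesis by simp
  qed
  moreover have "\<bar>real (card Near) - measure lborel (region m \<inter> {- real R..<real R} \<times> {- real R..<real R})\<bar> \<le> 8 * real d * real R"
    unfolding Near_def I_def by (rule box_discrepancy)
  moreover have "\<bar>measure lborel (region m) - measure lborel (region m \<inter> {- real R..<real R} \<times> {- real R..<real R})\<bar>
       \<le> real d * (8 * K / (real R / 2) ^ (d - 2))"
    by (rule measure_region_outside_box(2)[OF K R])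
  ultimately have "\<bar>real (card (nonzero_points m)) - measure lborel (region m)\<bar>
     \<le> 10 * real d * real R + real d * (8 * K / (real R / 2) ^ (d - 2)) + real d * (4 * B)"
    using cardF by linarith
  also have "\<dots> = real d * (10 * real R + 8 * K / (real R / 2) ^ (d - 2) + 4 * B)"
    by (simp only: distrib_left mult_ac)
  finally show "\<bar>real (card (nonzero_points m)) - measure lborel (region m)\<bar>
       \<le> real d * (10 * real R + 8 * K / (real R / 2) ^ (d - 2) + 4 * B)" .
qed

end

section \<open>Choice of constants\<close>

text \<open>
  Here \<open>n\<close> is the number of dyadic shells to be counted before Thue's theorem applies.
\<close>

lemma thue_threshold_less_power:
  assumes d: "d \<ge> 3"
  shows "\<exists>c0 c1 c2. c0 \<ge> 0 \<and> c1 \<ge> 0 \<and> c2 \<ge> 0 \<and> (\<forall>A H K m. A \<ge> 1 \<longrightarrow> H \<ge> 1 \<longrightarrow> m \<ge> 1 \<longrightarrow>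
    real A \<le> real (d + 2) * 2 ^ d * H \<longrightarrow> K = 2 ^ d * H ^ (d - 2) * m \<longrightarrow>
    (\<exists>n. thue_threshold d A K < 2 ^ n \<and> real n \<le> c0 + c1 * ln H + c2 * ln m))"
proof -
  define e where "e = 8 * d * (4 * d + 3)"
  define a1 where "a1 = 8 * (real (d + 2) * 2 ^ d)"
  \<comment> \<open>Both constants are read off from the logarithm of the threshold, doubled because
    1 / ln 2 \<le> 2. The coefficient 16 of ln m used below is the exponent 8 of K, doubled in the
    same way.\<close>
  define c0 where "c0 = 2 * (ln 2 + real e * (ln 64 + 2 * real d * ln a1) + 8 * real d * ln 2) + 1"
  define c1 where "c1 = 2 * (real e * (2 * real d) + 8 * real d)"
  have a1: "a1 \<ge> 1"
  proof -
    have "1 * 1 \<le> real (d + 2) * 2 ^ d" by (intro mult_mono) auto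
    then show ?thesis by (simp add: a1_def)
  qed
  show ?thesis
  proof (rule exI[of _ c0], rule exI[of _ c1], rule exI[of _ 16], intro conjI allI impI)
    show "c0 \<ge> 0" using a1 by (simp add: c0_def)
    show "c1 \<ge> 0" by (simp add: c1_def)
    fix A :: nat and H K m :: real
    assume A: "A \<ge> 1" "real A \<le> real (d + 2) * 2 ^ d * H" and H: "H \<ge> 1" and m: "m \<ge> 1"
      and K: "K = 2 ^ d * H ^ (d - 2) * m"
    have Ar: "real A \<ge> 1" using A by simp
    have lnA: "ln (8 * real A) \<le> ln a1 + ln H"
    proof -
      have "ln (8 * real A) \<le> ln (a1 * H)"
        using A(2) Ar H by (subst ln_le_cancel_iff) (auto simp: a1_def intro: mult_pos_pos)
      also have "\<dots> = ln a1 + ln H" using a1 H by (simp add: ln_mult)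
      finally show ?thesis .
    qed
    have lnZ: "ln (real (thue_base d A)) = ln 64 + 2 * real d * ln (8 * real A)"
    proof -
      define X where "X = (8 * real A) ^ (2 * d)"
      have "X > 0" using Ar by (simp add: X_def)
      moreover have "real (thue_base d A) = 64 * X" by (simp add: thue_base_def X_def)
      ultimately have "ln (real (thue_base d A)) = ln 64 + ln X" by (simp add: ln_mult)
      also have "ln X = real (2 * d) * ln (8 * real A)" unfolding X_def by (rule ln_realpow)
      finally show ?thesis by simp
    qed
    have Z1: "real (thue_base d A) \<ge> 1"
    proof -
      have "1 * 1 \<le> 64 * (8 * real A) ^ (2 * d)" using Ar by (intro mult_mono one_le_power) auto
      then show ?thesis by (simp add: thue_base_def)
    qed
    have K1: "K \<ge> 1"
    proof -
      have "1 * 1 * 1 \<le> 2 ^ d * H ^ (d - 2) * m" using H m by (intro mult_mono one_le_power) auto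
      then show ?thesis by (simp add: K)
    qed
    have lnK: "ln K \<le> real d * ln 2 + real d * ln H + ln m"
    proof -
      have "ln K = ln (2 ^ d) + ln (H ^ (d - 2)) + ln m"
        unfolding K using H m by (simp add: ln_mult)
      also have "\<dots> = real d * ln 2 + real (d - 2) * ln H + ln m" using H by (simp add: ln_realpow)
      also have "\<dots> \<le> real d * ln 2 + real d * ln H + ln m"
        using H by (intro add_mono mult_right_mono) auto
      finally show ?thesis .
    qed
    define t where "t = thue_threshold d A K"
    have t_eq: "t = 2 * real (thue_base d A) ^ e * K ^ 8" by (simp add: t_def thue_threshold_def e_def)
    have t1: "t \<ge> 1"
    proof -
      have "1 * 1 * 1 \<le> 2 * real (thue_base d A) ^ e * K ^ 8"
        using Z1 K1 by (intro mult_mono one_le_power) auto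
      then show ?thesis by (simp add: t_eq)
    qed
    have lnt: "ln t = ln 2 + real e * ln (real (thue_base d A)) + 8 * ln K"
      unfolding t_eq using Z1 K1 by (simp add: ln_mult ln_realpow)
    define n where "n = nat \<lfloor>log 2 t\<rfloor> + 1"
    have log0: "0 \<le> log 2 t" using t1 by simp
    have "log 2 t < real n" using log0 by (simp add: n_def) linarith
    then have "t < 2 powr real n" using t1 by (simp add: log_less_iff)
    then have 1: "t < 2 ^ n" by (simp add: powr_realpow)
    have "real n = of_int \<lfloor>log 2 t\<rfloor> + 1" using log0 by (simp add: n_def)
    also have "\<dots> \<le> log 2 t + 1" by simp
    also have "\<dots> \<le> 2 * ln t + 1"
    proof -
      have "ln (2 :: real) \<ge> 1 / 2"
      proof -
        have "exp (1 / 2 :: real) \<le> 2" using exp_bound_half[of "1/2 :: real"] by simp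
        then show ?thesis by (subst ln_ge_iff) auto
      qed
      then have "ln t / ln 2 \<le> ln t / (1 / 2)" using t1 by (intro divide_left_mono) auto
      then show ?thesis by (simp add: log_def)
    qed
    also have "ln t \<le> ln 2 + real e * (ln 64 + 2 * real d * (ln a1 + ln H)) + 8 * (real d * ln 2 + real d * ln H + ln m)"
      unfolding lnt lnZ using lnA lnK by (intro add_mono mult_left_mono) auto
    also have "2 * \<dots> + 1 = c0 + c1 * ln H + 16 * ln m"
      by (simp add: c0_def c1_def algebra_simps)
    finally have "real n \<le> c0 + c1 * ln H + 16 * ln m" by simp
    then show "\<exists>n. thue_threshold d A K < 2 ^ n \<and> real n \<le> c0 + c1 * ln H + 16 * ln m"
      using 1 unfolding t_def by blast
  qed simp
qed

text \<open>The exponents 1/(d-1) and 1/d differ by s = 1/(d(d-1)), and ln x \<le> x at x = m^s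
  gives ln m \<le> m^s / s.\<close>

lemma powr_times_ln_le:
  fixes m :: real
  assumes d: "d \<ge> 3" and m: "m \<ge> 1"
  shows "m powr (1 / real d) * ln m \<le> real (d * (d - 1)) * m powr (1 / (real d - 1))"
proof -
  define s where "s = 1 / (real d - 1) - 1 / real d"
  have s: "s = 1 / real (d * (d - 1))" using d by (simp add: s_def of_nat_diff field_simps)
  then have s0: "s > 0" using d by simp
  have "s * ln m \<le> m powr s"
  proof -
    have "ln (m powr s) \<le> m powr s - 1" using m by (intro ln_le_minus_one) auto
    then show ?thesis using m by (simp add: ln_powr)
  qed
  then have "ln m \<le> real (d * (d - 1)) * m powr s"
    using s0 unfolding s using d by (simp add: field_simps)
  then have "m powr (1 / real d) * ln m \<le> m powr (1 / real d) * (real (d * (d - 1)) * m powr s)"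
    by (rule mult_left_mono) simp
  also have "\<dots> = real (d * (d - 1)) * (m powr (1 / real d) * m powr s)" by (simp only: mult_ac)
  also have "m powr (1 / real d) * m powr s = m powr (1 / (real d - 1))"
    by (simp add: s_def flip: powr_add)
  finally show ?thesis .
qed

lemma card_powers_le:
  assumes d: "d \<ge> 3" and m: "m \<ge> 1"
  shows "real (card {t :: nat. 1 \<le> t \<and> t ^ d \<le> m}) \<le> real m powr (1 / real d)"
    and "t ^ d \<le> m \<Longrightarrow> real t \<le> real m powr (1 / real d)"
proof -
  define c where "c = real m powr (1 / real d)"
  have c: "c \<ge> 0" by (simp add: c_def)
  have cd: "c ^ d = real m"
    using d m by (simp add: c_def powr_realpow[symmetric] powr_powr)
  have le: "real t \<le> c" if "t ^ d \<le> m" for t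
  proof (rule ccontr)
    assume "\<not> real t \<le> c"
    then have "c ^ d < real t ^ d" using c d by (intro power_strict_mono) auto
    moreover have "real (t ^ d) \<le> real m" using that by (rule of_nat_mono)
    ultimately show False by (simp add: cd)
  qed
  then show "t ^ d \<le> m \<Longrightarrow> real t \<le> real m powr (1 / real d)" by (simp add: c_def)
  have "{t :: nat. 1 \<le> t \<and> t ^ d \<le> m} \<subseteq> {1..nat \<lfloor>c\<rfloor>}"
    using le_nat_floor[OF le] by auto
  then have "card {t :: nat. 1 \<le> t \<and> t ^ d \<le> m} \<le> card {1..nat \<lfloor>c\<rfloor>}" by (intro card_mono) auto
  then have "real (card {t :: nat. 1 \<le> t \<and> t ^ d \<le> m}) \<le> real (nat \<lfloor>c\<rfloor>)" by simp
  also have "\<dots> \<le> c" using c by simp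
  finally show "real (card {t :: nat. 1 \<le> t \<and> t ^ d \<le> m}) \<le> real m powr (1 / real d)" by (simp add: c_def)
qed

theorem factored_form_count:
  assumes d: "d \<ge> 3"
  shows "\<exists>c > 0. \<forall>a u v m. factored_form d a u v \<longrightarrow> m \<ge> 1 \<longrightarrow>
    finite (factored_form.nonzero_points d a m) \<and>
    emeasure lborel (factored_form.region d a 1) < \<infinity> \<and>
    \<bar>real (card (factored_form.nonzero_points d a m))
       - real m powr (2 / real d) * measure lborel (factored_form.region d a 1)\<bar>
      \<le> c * real m powr (1 / (real d - 1)) * factored_form.height d u v ^ (d - 2)"
proof -
  from card_approximations_le[OF d] obtain c where c: "\<forall>\<alpha> A K \<kappa> T n. bounded_root d A \<alpha> \<longrightarrow> A \<ge> 1 \<longrightarrow> K \<ge> 1 \<longrightarrow>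
    0 \<le> \<kappa> \<longrightarrow> \<kappa> \<le> K \<longrightarrow> 1 \<le> T \<longrightarrow> thue_threshold d A K < 2 ^ n \<longrightarrow>
    finite {x \<in> approximations d \<alpha> \<kappa>. T \<le> real (snd x)}
    \<and> real (card {x \<in> approximations d \<alpha> \<kappa>. T \<le> real (snd x)}) \<le> real (n + c) + 16 * \<kappa> / T ^ (d - 2)" ..
  from thue_threshold_less_power[OF d] obtain c0 c1 c2 where c012: "c0 \<ge> 0" "c1 \<ge> 0" "c2 \<ge> 0"
    and thr: "\<forall>A H K m. A \<ge> 1 \<longrightarrow> H \<ge> 1 \<longrightarrow> m \<ge> 1 \<longrightarrow>
    real A \<le> real (d + 2) * 2 ^ d * H \<longrightarrow> K = 2 ^ d * H ^ (d - 2) * m \<longrightarrow>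
    (\<exists>n. thue_threshold d A K < 2 ^ n \<and> real n \<le> c0 + c1 * ln H + c2 * ln m)" by blast
  \<comment> \<open>The summand 128 is 32 times the bound 4E for K / (R/2)^(d-2); in
    \<open>cc\<close> the numbers 50 and 32 are 10 * 5 and 8 * 4, from R \<le> 5E and the same tail
    bound.\<close>
  define cB where "cB = c0 + real c + c1 + c2 * real (d * (d - 1)) + 128"
  define cc where "cc = real d * (50 + 32 + 4 * cB)"
  have cB: "cB > 0" using c012 unfolding cB_def by (intro add_nonneg_pos add_nonneg_nonneg mult_nonneg_nonneg) auto
  have cc: "cc > 0" using cB d by (simp add: cc_def)
  show ?thesis
  proof (intro exI[of _ cc] conjI[OF cc] allI impI)
    fix a :: "nat \<Rightarrow> int" and u v :: "nat \<Rightarrow> complex" and m :: nat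
    assume ff: "factored_form d a u v" and m: "m \<ge> 1"
    interpret factored_form d a u v by (rule ff)
    define \<mu> where "\<mu> = real m powr (1 / (real d - 1))"
    define E where "E = \<mu> * height ^ (d - 2)"
    \<comment> \<open>Since K \<le> 2^d E^(d-1), the factor 4 gives both K \<le> R^(d-1), by 2^d
      \<le> 4^(d-1), and R/2 \<ge> 2E, which cancels the power of 2 in the tail.\<close>
    define R where "R = nat \<lceil>4 * E\<rceil>"
    define K where "K = 2 ^ d * height ^ (d - 2) * real m"
    define A where "A = nat \<lceil>real (d + 1) * 2 ^ d * height\<rceil>"
    define Ts where "Ts = real (card {t :: nat. 1 \<le> t \<and> t ^ d \<le> m})"
    have mr: "real m \<ge> 1" using m by simp
    have \<mu>1: "\<mu> \<ge> 1" unfolding \<mu>_def using mr d by (intro ge_one_powr_ge_zero) auto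
    have H1: "height ^ (d - 2) \<ge> 1" using height_ge_1 by (rule one_le_power)
    have HE: "height \<le> height ^ (d - 2)" using height_ge_1 d by (intro self_le_power) auto
    have \<mu>E: "\<mu> \<le> E" using \<mu>1 H1 mult_left_mono[of 1 "height ^ (d - 2)" \<mu>] by (simp add: E_def)
    have E1: "E \<ge> 1" using \<mu>1 \<mu>E by linarith
    have R_lo: "4 * E \<le> real R" using E1 by (simp add: R_def)
    have R_hi: "real R \<le> 5 * E"
    proof -
      have "real R = of_int \<lceil>4 * E\<rceil>" using E1 by (simp add: R_def)
      then show ?thesis using E1 by linarith
    qed
    have KE: "K \<le> 2 ^ d * E ^ (d - 1)"
    proof -
      have "real m = \<mu> ^ (d - 1)"
        using mr d by (simp add: \<mu>_def powr_realpow[symmetric] powr_powr of_nat_diff)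
      moreover have "height ^ (d - 2) \<le> (height ^ (d - 2)) ^ (d - 1)" using H1 d by (intro self_le_power) auto
      ultimately have "height ^ (d - 2) * real m \<le> (height ^ (d - 2)) ^ (d - 1) * \<mu> ^ (d - 1)"
        using \<mu>1 by (simp add: mult_right_mono)
      then have "height ^ (d - 2) * real m \<le> E ^ (d - 1)" by (simp add: E_def power_mult_distrib mult.commute)
      then show ?thesis unfolding K_def mult.assoc by (intro mult_left_mono) auto
    qed
    have K1: "K \<ge> 1"
    proof -
      have "1 * 1 * 1 \<le> K" unfolding K_def using height_ge_1 mr by (intro mult_mono one_le_power) auto
      then show ?thesis by simp
    qed
    have KR: "K \<le> real R ^ (d - 1)"
    proof -
      have "(2 :: real) ^ d \<le> 4 ^ (d - 1)"
      proof -
        have "(2 :: real) ^ d \<le> 2 ^ (2 * (d - 1))" using d by (intro power_increasing) auto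
        then show ?thesis by (simp add: power_mult)
      qed
      then have "2 ^ d * E ^ (d - 1) \<le> 4 ^ (d - 1) * E ^ (d - 1)" using E1 by (intro mult_right_mono) auto
      also have "\<dots> = (4 * E) ^ (d - 1)" by (simp only: power_mult_distrib)
      also have "\<dots> \<le> real R ^ (d - 1)" using R_lo E1 by (intro power_mono) auto
      finally show ?thesis using KE by linarith
    qed
    have Ktail: "K / (real R / 2) ^ (d - 2) \<le> 4 * E"
    proof -
      have pos: "0 < (2 * E) ^ (d - 2)" using E1 by (intro zero_less_power) auto
      have "(2 * E) ^ (d - 2) \<le> (real R / 2) ^ (d - 2)" using R_lo E1 by (intro power_mono) auto
      then have "K / (real R / 2) ^ (d - 2) \<le> K / (2 * E) ^ (d - 2)"
        using pos K1 by (intro divide_left_mono) (auto intro: mult_pos_pos less_le_trans)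
      also have "\<dots> \<le> 2 ^ d * E ^ (d - 1) / (2 * E) ^ (d - 2)"
        using KE pos by (intro divide_right_mono) auto
      also have "\<dots> = 4 * E"
      proof -
        obtain e where e: "d = e + 3" using d by (metis add.commute le_Suc_ex)
        have "d - 1 = Suc (Suc e)" "d - 2 = Suc e" "d = Suc (Suc (Suc e))" by (simp_all add: e)
        then show ?thesis using E1 by (simp add: power_mult_distrib)
      qed
      finally show ?thesis .
    qed
    have R2: "R \<ge> 2"
    proof -
      have "real R \<ge> 4" using R_lo E1 by linarith
      then show ?thesis by simp
    qed
    have RT: "2 * t \<le> R" if "t ^ d \<le> m" for t
    proof -
      have "real t \<le> real m powr (1 / real d)" using card_powers_le(2)[OF d m that] .
      also have "\<dots> \<le> \<mu>" unfolding \<mu>_def using mr d by (intro powr_mono) (auto simp: field_simps)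
      finally have "real (2 * t) \<le> real R" using \<mu>E R_lo E1 by simp
      then show ?thesis by (simp only: of_nat_le_iff)
    qed
    have A_lo: "real (d + 1) * 2 ^ d * height \<le> real A"
      unfolding A_def by (rule real_nat_ceiling_ge)
    have base1: "1 \<le> 2 ^ d * height"
    proof -
      have "1 * 1 \<le> 2 ^ d * height" using height_ge_1 by (intro mult_mono one_le_power) auto
      then show ?thesis by simp
    qed
    have A_hi: "real A \<le> real (d + 2) * 2 ^ d * height"
    proof -
      have "0 \<le> real (d + 1) * 2 ^ d * height" using height_ge_1 by simp
      then have "real A = of_int \<lceil>real (d + 1) * 2 ^ d * height\<rceil>" by (simp add: A_def)
      also have "\<dots> \<le> real (d + 1) * 2 ^ d * height + 1" by linarith
      also have "\<dots> \<le> real (d + 2) * 2 ^ d * height" using base1 by (simp add: algebra_simps)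
      finally show ?thesis .
    qed
    have A1: "A \<ge> 1"
    proof -
      have "1 * 1 \<le> real (d + 1) * (2 ^ d * height)" using base1 by (intro mult_mono) auto
      then have "1 \<le> real A" using A_lo by (simp only: mult.assoc mult_1)
      then show ?thesis by simp
    qed
    obtain n where n: "thue_threshold d A K < 2 ^ n" "real n \<le> c0 + c1 * ln height + c2 * ln (real m)"
      using thr[rule_format, OF A1 height_ge_1 mr A_hi K_def] by blast
    define C where "C = real (n + c)"
    have approx: "finite {x \<in> approximations d \<alpha> \<kappa>. T \<le> real (snd x)} \<and>
       real (card {x \<in> approximations d \<alpha> \<kappa>. T \<le> real (snd x)}) \<le> C + 16 * \<kappa> / T ^ (d - 2)"
      if "bounded_root d A \<alpha>" "0 \<le> \<kappa>" "\<kappa> \<le> K" "1 \<le> T" for \<alpha> \<kappa> T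
      unfolding C_def by (rule c[rule_format, OF that(1) A1 K1 that(2-4) n(1)])
    have K0: "2 ^ d * height ^ (d - 2) * real m \<le> K" by (simp add: K_def)
    have fin: "finite (nonzero_points m)"
      by (rule count_estimate(1)[OF K0 KR R2 m _ A_lo]) (erule RT, (rule approx; assumption))
    have est: "\<bar>real (card (nonzero_points m)) - measure lborel (region m)\<bar>
       \<le> real d * (10 * real R + 8 * K / (real R / 2) ^ (d - 2) + 4 * (Ts * C + 32 * K / (real R / 2) ^ (d - 2)))"
      unfolding Ts_def
      by (rule count_estimate(2)[OF K0 KR R2 m _ A_lo]) (erule RT, (rule approx; assumption))
    have lnH: "ln height \<le> height ^ (d - 2)"
      using ln_le_minus_one[of height] height_ge_1 HE by linarith
    have Ts0: "0 \<le> Ts" by (simp add: Ts_def)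
    have Ts\<mu>: "Ts \<le> \<mu>"
    proof -
      have "Ts \<le> real m powr (1 / real d)" unfolding Ts_def by (rule card_powers_le(1)[OF d m])
      also have "\<dots> \<le> \<mu>" unfolding \<mu>_def using mr d by (intro powr_mono) (auto simp: field_simps)
      finally show ?thesis .
    qed
    \<comment> \<open>The number of multipliers t times the number of shells. Here ln H is absorbed
      by H^(d-2), which requires d \<ge> 3, and ln m by the step from exponent 1/d to
      1/(d-1).\<close>
    have TsC: "Ts * C \<le> (c0 + real c + c1 + c2 * real (d * (d - 1))) * E"
    proof -
      have "Ts * C \<le> Ts * (c0 + real c + c1 * ln height + c2 * ln (real m))"
        using n(2) Ts0 by (intro mult_left_mono) (auto simp: C_def)
      also have "\<dots> = Ts * (c0 + real c) + c1 * (Ts * ln height) + c2 * (Ts * ln (real m))"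
        by (simp add: algebra_simps)
      also have "\<dots> \<le> E * (c0 + real c) + c1 * E + c2 * (real (d * (d - 1)) * E)"
      proof (intro add_mono mult_right_mono mult_left_mono)
        show "Ts \<le> E" using Ts\<mu> \<mu>E by linarith
        have "Ts * ln height \<le> \<mu> * height ^ (d - 2)"
          using Ts\<mu> Ts0 lnH height_ge_1 \<mu>1 by (intro mult_mono) auto
        then show "Ts * ln height \<le> E" by (simp add: E_def)
        have "Ts * ln (real m) \<le> real m powr (1 / real d) * ln (real m)"
          unfolding Ts_def using card_powers_le(1)[OF d m] mr by (intro mult_right_mono) auto
        also have "\<dots> \<le> real (d * (d - 1)) * \<mu>" unfolding \<mu>_def by (rule powr_times_ln_le[OF d mr])
        also have "\<dots> \<le> real (d * (d - 1)) * E" using \<mu>E by (intro mult_left_mono) auto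
        finally show "Ts * ln (real m) \<le> real (d * (d - 1)) * E" .
      qed (use c012 in auto)
      also have "\<dots> = (c0 + real c + c1 + c2 * real (d * (d - 1))) * E" by (simp add: algebra_simps)
      finally show ?thesis .
    qed
    have "10 * real R + 8 * K / (real R / 2) ^ (d - 2) + 4 * (Ts * C + 32 * K / (real R / 2) ^ (d - 2))
        \<le> (50 + 32 + 4 * cB) * E"
    proof -
      have e: "8 * K / (real R / 2) ^ (d - 2) = 8 * (K / (real R / 2) ^ (d - 2))"
        "32 * K / (real R / 2) ^ (d - 2) = 32 * (K / (real R / 2) ^ (d - 2))" by simp_all
      define q Y P where "q = K / (real R / 2) ^ (d - 2)"
        and "Y = (c0 + real c + c1 + c2 * real (d * (d - 1))) * E" and "P = Ts * C"
      have e2: "(50 + 32 + 4 * cB) * E = 82 * E + 4 * (Y + 128 * E)"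
        by (simp add: Y_def cB_def algebra_simps)
      have qP: "q \<le> 4 * E" "P \<le> Y" using Ktail TsC by (simp_all only: q_def P_def Y_def)
      have "10 * real R + 8 * q + 4 * (P + 32 * q) \<le> 10 * (5 * E) + 8 * (4 * E) + 4 * (Y + 32 * (4 * E))"
        by (intro add_mono mult_left_mono R_hi qP) simp_all
      also have "\<dots> = (50 + 32 + 4 * cB) * E" unfolding e2 by (simp add: algebra_simps)
      finally show ?thesis unfolding e q_def[symmetric] P_def[symmetric] .
    qed
    then have "real d * (10 * real R + 8 * K / (real R / 2) ^ (d - 2) + 4 * (Ts * C + 32 * K / (real R / 2) ^ (d - 2)))
        \<le> real d * ((50 + 32 + 4 * cB) * E)" by (rule mult_left_mono) simp
    also have "\<dots> = cc * \<mu> * height ^ (d - 2)" by (simp add: cc_def E_def)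
    finally have bound: "real d * (10 * real R + 8 * K / (real R / 2) ^ (d - 2) + 4 * (Ts * C + 32 * K / (real R / 2) ^ (d - 2)))
        \<le> cc * \<mu> * height ^ (d - 2)" .
    \<comment> \<open>The same K and R are admissible for m = 1, which shows that the region
      defining the area has finite measure.\<close>
    have "2 ^ d * height ^ (d - 2) * real 1 \<le> K"
      unfolding K_def using mr height_ge_1 by (intro mult_left_mono) auto
    then have "emeasure lborel (region 1) < \<infinity>" by (rule measure_region_outside_box(1)[OF _ KR R2])
    moreover have "\<bar>real (card (nonzero_points m)) - real m powr (2 / real d) * measure lborel (region 1)\<bar>
      \<le> cc * real m powr (1 / (real d - 1)) * height ^ (d - 2)"
      using order_trans[OF est bound] unfolding measure_region_scale[OF m] \<mu>_def .
    ultimately show "finite (nonzero_points m) \<and> emeasure lborel (region 1) < \<infinity> \<and>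
      \<bar>real (card (nonzero_points m)) - real m powr (2 / real d) * measure lborel (region 1)\<bar>
      \<le> cc * real m powr (1 / (real d - 1)) * height ^ (d - 2)"
      using fin by blast
  qed
qed

section \<open>Return to \<open>form_eval\<close>, the chosen linear factors and vectors\<close>

lemma factored_form_linear_factors:
  assumes d: "d \<ge> 3" and disc: "form_discriminant d a \<noteq> 0"
  shows "factored_form d a (\<lambda>i. linear_factors d a i $ 1) (\<lambda>i. linear_factors d a i $ 2)"
proof
  let ?L = "linear_factors d a"
  have "\<exists>L. linear_factorization d a L" using d by (intro linear_factorization_exists) simp
  then have "linear_factorization d a (SOME L. linear_factorization d a L)" by (rule someI_ex)
  then have L: "linear_factorization d a ?L" by (simp only: linear_factors_def)
  show "bform d a x y = (\<Prod>i<d. ?L i $ 1 * x + ?L i $ 2 * y)" for x y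
  proof -
    have "bform d a x y = form_eval d a (vector [x, y] :: complex ^ 2)"
      by (simp add: bform_def form_eval_def vector_2)
    also have "\<dots> = (\<Prod>i<d. ?L i $ 1 * x + ?L i $ 2 * y)"
      using L by (simp add: linear_factorization_def vector_2)
    finally show ?thesis .
  qed
  show "?L i $ 1 * ?L j $ 2 - ?L j $ 1 * ?L i $ 2 \<noteq> 0" if ij: "i < d" "j < d" "i \<noteq> j" for i j
  proof -
    have "finite {(i, j). i < d \<and> j < d \<and> i \<noteq> j}"
      by (rule finite_subset[of _ "{..<d} \<times> {..<d}"]) auto
    then have "Determinants.det (Finite_Cartesian_Product.transpose (vector [?L i, ?L j]) :: complex ^ 2 ^ 2) \<noteq> 0"
      using disc ij by (auto simp: form_discriminant_def)
    then show ?thesis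
      by (simp add: Determinants.det_2 Finite_Cartesian_Product.transpose_def vector_2 mult.commute)
  qed
qed (rule d)

theorem corollary4:
  fixes d :: nat
  assumes "d \<ge> 3"
  shows "\<exists>c :: real. c > 0 \<and>
    (\<forall>(a :: nat \<Rightarrow> int) (m :: nat). form_discriminant d a \<noteq> 0 \<and> m > 0 \<longrightarrow>
       finite (form_solutions d a m) \<and>
       form_region d a \<in> lmeasurable \<and>
       \<bar>real (card (form_solutions d a m)) - real m powr (2 / real d) * form_area d a\<bar>
         \<le> c * real m powr (1 / (real d - 1)) * form_height d a ^ (d - 2))"
proof -
  from factored_form_count[OF assms] obtain c where c: "c > 0"
    and count: "\<forall>a u v m. factored_form d a u v \<longrightarrow> m \<ge> 1 \<longrightarrow>
    finite (factored_form.nonzero_points d a m) \<and>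
    emeasure lborel (factored_form.region d a 1) < \<infinity> \<and>
    \<bar>real (card (factored_form.nonzero_points d a m))
       - real m powr (2 / real d) * measure lborel (factored_form.region d a 1)\<bar>
      \<le> c * real m powr (1 / (real d - 1)) * factored_form.height d u v ^ (d - 2)" by blast
  show ?thesis
  proof (intro exI[of _ c] conjI[OF c] allI impI)
    fix a :: "nat \<Rightarrow> int" and m :: nat
    assume *: "form_discriminant d a \<noteq> 0 \<and> m > 0"
    define u v where "u = (\<lambda>i. linear_factors d a i $ 1)" and "v = (\<lambda>i. linear_factors d a i $ 2)"
    interpret factored_form d a u v
      unfolding u_def v_def using factored_form_linear_factors[OF assms] * by blast
    have count': "finite (nonzero_points m)" "emeasure lborel (region 1) < \<infinity>"
      "\<bar>real (card (nonzero_points m)) - real m powr (2 / real d) * measure lborel (region 1)\<bar>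
      \<le> c * real m powr (1 / (real d - 1)) * height ^ (d - 2)"
      using count[rule_format, OF factored_form_axioms, of m] * by auto
    have height: "height = form_height d a"
      unfolding height_def len_def unfolding u_def v_def
      by (simp add: form_height_def norm_vec_def L2_set_def UNIV_2)
    define g where "g = (\<lambda>z :: int ^ 2. (z $ 1, z $ 2))"
    have "inj g" by (auto simp: g_def inj_on_def Finite_Cartesian_Product.vec_eq_iff forall_2)
    have "g ` form_solutions d a m = nonzero_points m"
    proof (intro equalityI subsetI)
      fix z assume "z \<in> g ` form_solutions d a m"
      then show "z \<in> nonzero_points m"
        by (auto simp: g_def form_solutions_def nonzero_points_def form_eval_def bform_def)
    next
      fix z assume z: "z \<in> nonzero_points m"
      obtain x y where xy: "z = (x, y)" by (cases z)
      then have "vector [x, y] \<in> form_solutions d a m"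
        using z by (simp add: form_solutions_def nonzero_points_def form_eval_def bform_def vector_2)
      then show "z \<in> g ` form_solutions d a m"
        by (intro image_eqI[of _ _ "vector [x, y]"]) (simp_all add: g_def xy vector_2)
    qed
    then have bij: "bij_betw g (form_solutions d a m) (nonzero_points m)"
      using \<open>inj g\<close> by (auto simp: bij_betw_def intro: inj_on_subset)
    \<comment> \<open>Finiteness and measurability belong to the conclusion because
      \<open>card\<close> and \<open>measure\<close> return 0 in the infinite case, where the
      inequality would not speak about the intended quantities.\<close>
    have fin: "finite (form_solutions d a m)" using bij count'(1) by (simp add: bij_betw_finite)
    have card: "card (form_solutions d a m) = card (nonzero_points m)" using bij by (rule bij_betw_same_card)
    have "closed (form_region d a)"
      unfolding form_region_def form_eval_def by (intro closed_Collect_le continuous_intros)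
    then have borel: "form_region d a \<in> sets borel" by (rule borel_closed)
    have pre: "{(x, y). vector [x, y] \<in> form_region d a} = region 1"
      by (simp add: form_region_def region_def form_eval_def bform_def vector_2)
    have em: "emeasure lborel (form_region d a) = emeasure lborel (region 1)"
      using emeasure_lborel_vec2[OF borel] by (simp only: pre)
    have "emeasure lebesgue (form_region d a) = emeasure lborel (form_region d a)"
      using borel by (simp add: emeasure_completion main_part_sets)
    then have lm: "form_region d a \<in> lmeasurable"
      using borel em count'(2) by (intro fmeasurableI) auto
    have "measure lebesgue (form_region d a) = measure lborel (form_region d a)"
      using borel by (intro measure_completion) auto
    then have area: "form_area d a = measure lborel (region 1)"
      unfolding form_area_def using em by (simp add: measure_def)
    show "finite (form_solutions d a m) \<and>
       form_region d a \<in> lmeasurable \<and>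
       \<bar>real (card (form_solutions d a m)) - real m powr (2 / real d) * form_area d a\<bar>
         \<le> c * real m powr (1 / (real d - 1)) * form_height d a ^ (d - 2)"
      using fin lm count'(3) unfolding card area height by blast
  qed
qed

end
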